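(* Let $\omega\in\widehat{\mathcal{D}}$. Then the following statements are equivalent: (i) $H_\omega:H^1\to H^1$ is bounded; (ii) the measure $\mu_\omega$ on $\mathbb{D}$ supported on the radius $[0,1)$ and given there by $d\mu_\omega(t)=\omega(t)\left(1+\int_0^{t}\frac{ds}{\widehat{\omega}(s)}\right)dt$, $t\in[0,1)$, is a $1$-Carleson measure for $H^1$; (iii) $\omega$ satisfies the condition $$\sup_{a\in[0,1)}\frac{1}{1-a}\int_a^1\omega(t)\left(1+\int_0^t\frac{ds}{\widehat{\omega}(s)}\right)dt<\infty.$$
   Context: $\mathbb{D}=\{z\in\mathbb{C}:|z|<1\}$, and $dA=\frac{dx\,dy}{\pi}$ is the normalized area measure. $\mathcal{H}(\mathbb{D})$ is the space of analytic functions on $\mathbb{D}$. A radial weight is a nonnegative function $\omega\in L^1_{[0,1)}$, extended to $\mathbb{D}$ by $\omega(z)=\omega(|z|)$; it is assumed throughout that $\widehat{\omega}(z)=\int_{|z|}^1\omega(s)\,ds>0$ for all $z\in\mathbb{D}$. A radial weight $\omega$ belongs to $\widehat{\mathcal{D}}$ if there is a constant $C=C(\omega)\ge1$ with $\widehat{\omega}(r)\le C\,\widehat{\omega}\left(\frac{1+r}{2}\right)$ for all $0\le r<1$. The Bergman space $A^2_\omega$ consists of the $f\in\mathcal{H}(\mathbb{D})$ with $\int_{\mathbb{D}}|f|^2\omega\,dA<\infty$. Its reproducing kernels $B^\omega_z\in A^2_\omega$ satisfy $f(z)=\int_{\mathbb{D}}f(\zeta)\overline{B^\omega_z(\zeta)}\,\omega(\zeta)\,dA(\zeta)$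 for all $f\in A^2_\omega$. Explicitly, $B^\omega_z(\zeta)=\sum_{n=0}^\infty\frac{(\overline{z}\zeta)^n}{2\omega_{2n+1}}$, where $\omega_x=\int_0^1r^x\omega(r)\,dr$ for $x\ge0$. The Hilbert-type operator is $$H_\omega(f)(z)=\int_0^1 f(t)\left(\frac1z\int_0^zB^\omega_t(\zeta)\,d\zeta\right)\omega(t)\,dt,$$ where the kernel $\frac1z\int_0^zB^\omega_t(\zeta)\,d\zeta$ is extended analytically to $z=0$. A function on $\mathbb{D}$ is evaluated in this formula through its restriction to $[0,1)$. Boundedness of $H_\omega:X\to Y$ means that $H_\omega(f)$ is well defined and belongs to $Y$ for every $f\in X$, with $\|H_\omega(f)\|_Y\le C\|f\|_X$ for a constant $C$ independent of $f$. The Hardy space $H^1$ consists of the $f\in\mathcal{H}(\mathbb{D})$ with $\|f\|_{H^1}=\sup_{0<r<1}\frac1{2\pi}\int_0^{2\pi}|f(re^{i\theta})|\,d\theta<\infty$. A positive Borel measure $\mu$ on $\mathbb{D}$ is a $1$-Carleson measure for $H^1$ if the identity operator $I_d:H^1\to L^1(\mu)$ is bounded. *)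

theory Defs
  imports "HOL-Complex_Analysis.Complex_Analysis"
begin

abbreviation unit_disc :: "complex set" where
  "unit_disc \<equiv> ball 0 1"

text \<open>A radial weight is given by its profile on \<open>[0,1)\<close>; the values of \<open>\<omega>\<close> elsewhere are
  never used, and the extension to the disc is \<open>\<lambda>z. \<omega> (cmod z)\<close>.\<close>

definition weight_hat :: "(real \<Rightarrow> real) \<Rightarrow> real \<Rightarrow> real" where
  "weight_hat \<omega> r = (LINT s:{r..<1}|lebesgue. \<omega> s)"

definition radial_weight :: "(real \<Rightarrow> real) \<Rightarrow> bool" where
  "radial_weight \<omega> \<longleftrightarrow>
     (\<forall>r\<in>{0..<1}. 0 \<le> \<omega> r) \<and>
     set_integrable lebesgue {0..<1} \<omega> \<and>
     (\<forall>r\<in>{0..<1}. 0 < weight_hat \<omega> r)"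

definition D_hat :: "(real \<Rightarrow> real) set" where
  "D_hat = {\<omega>. radial_weight \<omega> \<and>
     (\<exists>C\<ge>1. \<forall>r\<in>{0..<1}. weight_hat \<omega> r \<le> C * weight_hat \<omega> ((1 + r) / 2))}"

definition bergman2 :: "(real \<Rightarrow> real) \<Rightarrow> (complex \<Rightarrow> complex) set" where
  "bergman2 \<omega> = {f. f holomorphic_on unit_disc \<and>
     set_integrable lebesgue unit_disc (\<lambda>\<zeta>. (cmod (f \<zeta>))\<^sup>2 * \<omega> (cmod \<zeta>))}"

text \<open>The factor \<open>1 / pi\<close> normalizes the area measure of the disc to one.\<close>

definition is_bergman_kernel ::
    "(real \<Rightarrow> real) \<Rightarrow> complex \<Rightarrow> (complex \<Rightarrow> complex) \<Rightarrow> bool" where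
  "is_bergman_kernel \<omega> z B \<longleftrightarrow> B \<in> bergman2 \<omega> \<and>
     (\<forall>f\<in>bergman2 \<omega>.
        f z = complex_of_real (1 / pi) *
          (LINT \<zeta>:unit_disc|lebesgue. f \<zeta> * cnj (B \<zeta>) * complex_of_real (\<omega> (cmod \<zeta>))))"

text \<open>For a radial weight and \<open>z\<close> in the disc, the reproducing property determines the kernel
  uniquely on the disc (its power series there is
  \<open>\<Sum>n. (cnj z * \<zeta>) ^ n / (2 * \<omega>\<^bsub>2n+1\<^esub>)\<close>, with \<open>\<omega>\<^bsub>x\<^esub>\<close> the moment
  \<open>\<integral> r\<^sup>x \<omega>(r) dr\<close> over \<open>[0,1)\<close>). Its values off the disc are unspecified and never used.\<close>

definition bergman_kernel :: "(real \<Rightarrow> real) \<Rightarrow> complex \<Rightarrow> complex \<Rightarrow> complex" where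
  "bergman_kernel \<omega> z = (SOME B. is_bergman_kernel \<omega> z B)"

text \<open>The analytic extension of the average \<open>(1/z) \<integral>\<^sub>0\<^sup>z B\<close> to \<open>z = 0\<close> takes the value \<open>B 0\<close>.\<close>

definition hilbert_kernel :: "(real \<Rightarrow> real) \<Rightarrow> real \<Rightarrow> complex \<Rightarrow> complex" where
  "hilbert_kernel \<omega> t z =
     (if z = 0 then bergman_kernel \<omega> (complex_of_real t) 0
      else contour_integral (linepath 0 z) (bergman_kernel \<omega> (complex_of_real t)) / z)"

definition hilbert_integrand ::
    "(real \<Rightarrow> real) \<Rightarrow> (complex \<Rightarrow> complex) \<Rightarrow> complex \<Rightarrow> real \<Rightarrow> complex" where
  "hilbert_integrand \<omega> f z t =
     f (complex_of_real t) * hilbert_kernel \<omega> t z * complex_of_real (\<omega> t)"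

definition hilbert_op ::
    "(real \<Rightarrow> real) \<Rightarrow> (complex \<Rightarrow> complex) \<Rightarrow> complex \<Rightarrow> complex" where
  "hilbert_op \<omega> f z = (LINT t:{0..<1}|lebesgue. hilbert_integrand \<omega> f z t)"

definition hilbert_op_defined :: "(real \<Rightarrow> real) \<Rightarrow> (complex \<Rightarrow> complex) \<Rightarrow> bool" where
  "hilbert_op_defined \<omega> f \<longleftrightarrow>
     (\<forall>z\<in>unit_disc. set_integrable lebesgue {0..<1} (hilbert_integrand \<omega> f z))"

definition circle_mean :: "(complex \<Rightarrow> complex) \<Rightarrow> real \<Rightarrow> real" where
  "circle_mean f r =
     1 / (2 * pi) * integral {0..2 * pi} (\<lambda>\<theta>. cmod (f (complex_of_real r * cis \<theta>)))"

definition H1 :: "(complex \<Rightarrow> complex) set" where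
  "H1 = {f. f holomorphic_on unit_disc \<and> bdd_above (circle_mean f ` {0<..<1})}"

definition H1_norm :: "(complex \<Rightarrow> complex) \<Rightarrow> real" where
  "H1_norm f = (SUP r\<in>{0<..<1}. circle_mean f r)"

definition hilbert_op_bounded_H1 :: "(real \<Rightarrow> real) \<Rightarrow> bool" where
  "hilbert_op_bounded_H1 \<omega> \<longleftrightarrow>
     (\<exists>C. \<forall>f\<in>H1. hilbert_op_defined \<omega> f \<and> hilbert_op \<omega> f \<in> H1 \<and>
        H1_norm (hilbert_op \<omega> f) \<le> C * H1_norm f)"

definition carleson_H1 :: "complex measure \<Rightarrow> bool" where
  "carleson_H1 \<mu> \<longleftrightarrow>
     sets \<mu> = sets (restrict_space borel unit_disc) \<and>
     (\<exists>C. \<forall>f\<in>H1. integrable \<mu> f \<and> (LINT z|\<mu>. cmod (f z)) \<le> C * H1_norm f)"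

definition mu_density :: "(real \<Rightarrow> real) \<Rightarrow> real \<Rightarrow> real" where
  "mu_density \<omega> t = \<omega> t * (1 + (LINT s:{0..t}|lebesgue. 1 / weight_hat \<omega> s))"

definition mu_weight :: "(real \<Rightarrow> real) \<Rightarrow> complex measure" where
  "mu_weight \<omega> =
     distr (density (restrict_space lebesgue {0..<1}) (\<lambda>t. ennreal (mu_density \<omega> t)))
       (restrict_space borel unit_disc) complex_of_real"

end

theory Submission
  imports Defs "HOL-Real_Asymp.Real_Asymp"
begin

text \<open>
Write \<open>W\<close> for \<open>weight_hat \<omega>\<close>, \<open>m\<^sub>n\<close> for the moment \<open>\<integral> r\<^sup>2\<^sup>n\<^sup>+\<^sup>1 \<omega>(r) dr\<close> over \<open>[0,1)\<close> and
\<open>J(t) = \<integral> 1 / W(s) ds\<close> over \<open>[0,t]\<close>.  All three statements are compared with the third one, which says that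
the measure \<open>\<mu> = (1 + J(t)) \<omega>(t) dt\<close> satisfies \<open>\<mu>([a,1)) \<le> B (1 - a)\<close>.

The kernel of the operator is a power series.  Rotation invariance and polar coordinates show that
integration of an analytic function against the conjugate of \<open>z\<^sup>n\<close> in the weighted area measure picks out its
Taylor coefficient of order \<open>n\<close>, times \<open>2 \<pi> m\<^sub>n\<close> (\<open>integral_area_monomial\<close>).  Hence the reproducing kernel
is \<open>\<Sum> (t z)\<^sup>n / (2 m\<^sub>n)\<close>, and its average is \<open>F(t z)\<close> with \<open>F(w) = \<Sum> w\<^sup>n / (2 (n + 1) m\<^sub>n)\<close>
(\<open>hilbert_kernel_eq\<close>).

Carleson's embedding is elementary for a measure on a radius.  Cauchy's formula for
\<open>f(z) (1 - z) (1 + t) / (1 - t z)\<close> represents \<open>f(t)\<close> by a kernel that is the Poisson kernel damped by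
\<open>\<bar>1 - z\<bar> / (1 - t)\<close>.  The damping makes the integral of the kernel with respect to \<open>\<mu>\<close> bounded
uniformly on the circle, so that Fubini's theorem yields \<open>\<integral> \<bar>f\<bar> d\<mu> \<le> 32 B \<parallel>f\<parallel>\<close>
(\<open>radial_carleson_embedding\<close>).  Conversely the squared Cauchy kernels \<open>(1 - a\<^sup>2) / (1 - a z)\<^sup>2\<close> have norm
at most one and are at least \<open>1 / (2 (1 - a))\<close> on \<open>[a,1)\<close>.

For the sufficiency, Fubini's theorem reduces the boundedness of the operator to the embedding and to the
estimate \<open>C (1 + J(\<rho>))\<close> of the mean of \<open>\<bar>F\<bar>\<close> over the circle of radius \<open>\<rho>\<close> (\<open>averaged_series_mean\<close>).
Here the doubling condition enters.  In terms of moments it says that \<open>\<integral> r\<^sup>n \<omega> dr\<close> and \<open>\<integral> r\<^sup>2\<^sup>n \<omega> dr\<close>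
are comparable (\<open>mom_doubling\<close>).  The function \<open>G = (w\<^sup>2 F)''\<close> has coefficients \<open>(n + 2) / (2 m\<^sub>n)\<close>, and the
differences of these coefficients are only of the order \<open>1 / m\<^sub>n\<close>.  The Cauchy-Schwarz inequality
for the product of \<open>1 / (1 - w)\<close> and \<open>(1 - w) G\<close> then bounds the mean of \<open>\<bar>G\<bar>\<close> over the circle of
radius \<open>x\<close> by a multiple of \<open>1 / (W(x) (1 - x))\<close>.  Integrating this twice gives the estimate for \<open>F\<close>, because the
factor \<open>\<rho> - x \<le> 1 - x\<close> in the integral remainder cancels the singularity.

For the necessity, the operator maps the squared Cauchy kernel to a function with nonnegative
coefficients.  Hardy's inequality, applied to its image, bounds the integral of the squared Cauchy kernel against
\<open>S(t) \<omega>(t) dt\<close>, where \<open>S(t) = \<Sum> t\<^sup>n / ((n + 1)\<^sup>2 m\<^sub>n)\<close>.  By the comparison of \<open>m\<^sub>n\<close> with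
\<open>W(1 - 1 / (n + 1))\<close> in \<open>mom_upper\<close>, the sum \<open>S(t)\<close> dominates a multiple of \<open>1 + J(t)\<close>
(\<open>hardy_sum_lower\<close>).
\<close>

section \<open>Mean values and Fourier series on the circle\<close>

text \<open>Every exchange of a power series with an integral below has a majorant in which the index and the
  variable are separated.\<close>

lemma sums_integral_dominated:
  fixes g :: "nat \<Rightarrow> 'a \<Rightarrow> 'b::{banach, second_countable_topology}"
  assumes g: "\<And>n. g n \<in> borel_measurable M" and w: "integrable M w"
    and le: "\<And>n x. x \<in> space M \<Longrightarrow> norm (g n x) \<le> c n * w x" and c: "summable c"
    and S: "\<And>x. x \<in> space M \<Longrightarrow> (\<lambda>n. g n x) sums S x"
  shows "(\<lambda>n. integral\<^sup>L M (g n)) sums integral\<^sup>L M S"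
proof -
  have gi: "integrable M (g n)" for n
    by (rule Bochner_Integration.integrable_bound[OF integrable_mult_right[OF w, of "c n"] g])
       (use le order_trans[OF _ abs_ge_self] in \<open>auto intro!: AE_I2\<close>)
  have s1: "AE x in M. summable (\<lambda>n. norm (g n x))"
    using le by (intro AE_I2 summable_comparison_test'[OF summable_mult2[OF c], of 0]) auto
  have "(\<integral>x. norm (g n x) \<partial>M) \<le> (\<integral>x. c n * w x \<partial>M)" for n
    using gi w le by (intro integral_mono) auto
  then have s2: "summable (\<lambda>n. \<integral>x. norm (g n x) \<partial>M)"
    by (intro summable_comparison_test'[OF summable_mult2[OF c, of "integral\<^sup>L M w"], of 0]) auto
  have "(\<integral>x. (\<Sum>n. g n x) \<partial>M) = integral\<^sup>L M S"
    using S by (intro Bochner_Integration.integral_cong refl) (simp add: sums_iff)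
  then show ?thesis using sums_integral[OF gi s1 s2] by simp
qed

text \<open>A probability measure on the angles, so that the means over circles become Lebesgue integrals, to which
  dominated convergence and Fubini's theorem apply.\<close>

definition circ :: "real measure" where
  "circ = uniform_measure lborel {0..2 * pi}"

lemma emeasure_circ_UNIV: "emeasure circ UNIV = 1"
  unfolding circ_def by (subst emeasure_uniform_measure) (simp_all add: ennreal_divide_self ennreal_eq_0_iff not_le mult_le_0_iff)

interpretation circ: finite_measure circ
  by standard (simp add: circ_def[THEN arg_cong, of space] emeasure_circ_UNIV)

lemma measure_circ_UNIV [simp]: "measure circ UNIV = 1"
  by (simp add: measure_def emeasure_circ_UNIV)

lemma sets_circ [simp, measurable_cong]: "sets circ = sets borel" and space_circ [simp]: "space circ = UNIV"
  by (simp_all add: circ_def)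

lemma measurable_circ [simp]: "measurable circ N = measurable borel N"
  by (rule measurable_cong_sets) auto

lemma integral_circ:
  fixes f :: "real \<Rightarrow> 'a::{banach, second_countable_topology}"
  assumes [measurable]: "f \<in> borel_measurable borel"
  shows "integral\<^sup>L circ f = (1 / (2 * pi)) *\<^sub>R (LINT x:{0..2*pi}|lborel. f x)"
proof -
  have eq: "circ = density lborel (\<lambda>x. ennreal (indicator {0..2*pi} x / (2 * pi)))"
    unfolding circ_def uniform_measure_def
    by (auto intro!: density_cong simp: divide_ennreal ennreal_indicator[symmetric] simp del: ennreal_indicator)
  have "integral\<^sup>L circ f = (LINT x|lborel. (indicator {0..2*pi} x / (2 * pi)) *\<^sub>R f x)"
    unfolding eq by (rule integral_density) auto
  also have "\<dots> = (LINT x|lborel. (1 / (2 * pi)) *\<^sub>R (indicator {0..2*pi} x *\<^sub>R f x))"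
    by (intro Bochner_Integration.integral_cong) auto
  also have "\<dots> = (1 / (2 * pi)) *\<^sub>R (LINT x:{0..2*pi}|lborel. f x)"
    unfolding set_lebesgue_integral_def by (rule integral_scaleR_right)
  finally show ?thesis .
qed

lemma integral_circ_continuous:
  fixes f :: "real \<Rightarrow> 'a::euclidean_space"
  assumes "continuous_on UNIV f"
  shows "integral\<^sup>L circ f = (1 / (2 * pi)) *\<^sub>R integral {0..2*pi} f"
proof -
  have "set_integrable lborel {0..2*pi} f"
    by (rule borel_integrable_atLeastAtMost') (use assms continuous_on_subset in blast)
  then show ?thesis
    using set_borel_integral_eq_integral(2)[of "{0..2*pi}" f] assms
    by (subst integral_circ) (auto intro: borel_measurable_continuous_onI)
qed

lemma integrable_circ_bounded:
  fixes f :: "real \<Rightarrow> 'a::{banach, second_countable_topology}"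
  assumes "f \<in> borel_measurable borel" "\<And>x. norm (f x) \<le> B"
  shows "integrable circ f"
  by (rule circ.integrable_const_bound[where B = B]) (use assms in auto)

lemma integrable_circ_continuous:
  fixes f :: "real \<Rightarrow> 'a::{banach, second_countable_topology}"
  assumes "continuous_on UNIV f"
  shows "integrable circ f"
proof -
  obtain B where B: "\<And>x. x \<in> {0..2*pi} \<Longrightarrow> norm (f x) \<le> B"
  proof -
    have "compact (f ` {0..2*pi})"
      by (rule compact_continuous_image) (use assms continuous_on_subset in blast, simp)
    then show ?thesis
      using that by (metis compact_imp_bounded bounded_iff imageI)
  qed
  show ?thesis
  proof (rule circ.integrable_const_bound[where B = B])
    show "AE x in circ. norm (f x) \<le> B"
      unfolding circ_def by (rule AE_uniform_measureI) (use B in auto)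
  qed (use assms in \<open>auto intro: borel_measurable_continuous_onI\<close>)
qed

lemma circle_mean_eq:
  assumes "continuous_on (sphere 0 r) f" "0 \<le> r"
  shows "circle_mean f r = (\<integral>x. cmod (f (of_real r * cis x)) \<partial>circ)"
    and "integrable circ (\<lambda>x. f (of_real r * cis x))"
    and "(\<lambda>x. f (of_real r * cis x)) \<in> borel_measurable borel"
proof -
  have c: "continuous_on UNIV (\<lambda>x. f (of_real r * cis x))"
    by (rule continuous_on_compose2[OF assms(1)]) (use assms(2) in \<open>auto intro!: continuous_intros simp: norm_mult\<close>)
  then have "continuous_on UNIV (\<lambda>x. cmod (f (of_real r * cis x)))"
    by (rule continuous_on_norm)
  then show "circle_mean f r = (\<integral>x. cmod (f (of_real r * cis x)) \<partial>circ)"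
    by (simp add: integral_circ_continuous circle_mean_def)
  show "integrable circ (\<lambda>x. f (of_real r * cis x))"
    using c by (rule integrable_circ_continuous)
  show "(\<lambda>x. f (of_real r * cis x)) \<in> borel_measurable borel"
    using c by (rule borel_measurable_continuous_onI)
qed

lemma cis_borel_measurable [measurable]: "(\<lambda>x. cis x) \<in> borel_measurable borel"
  by (intro borel_measurable_continuous_onI continuous_intros)

lemma integral_circ_cis:
  "(\<integral>x. cis (of_int k * x) \<partial>circ) = (if k = 0 then 1 else 0)"
proof (cases "k = 0")
  case False
  have "((\<lambda>x. cis (of_int k * x)) has_integral
          (cis (of_int k * (2*pi)) / (\<i> * of_int k) - cis (of_int k * 0) / (\<i> * of_int k))) {0..2*pi}"
    using False
    by (intro fundamental_theorem_of_calculus)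
       (auto simp: cis_conv_exp algebra_simps intro!: derivative_eq_intros has_vector_derivative_real_field)
  moreover have "cis (of_int k * (2*pi)) = 1"
    by (metis cis_multiple_2pi mult.commute Ints_of_int)
  ultimately have "integral {0..2*pi} (\<lambda>x. cis (of_int k * x)) = 0"
    by (auto dest: integral_unique)
  then show ?thesis using False
    by (subst integral_circ_continuous) (auto intro!: continuous_intros)
qed auto

text \<open>The source of Parseval's identity, Cauchy's formula and Hardy's inequality below, which differ in the
choice of \<open>\<phi>\<close>.\<close>

lemma integral_circ_series:
  fixes a :: "nat \<Rightarrow> complex"
  assumes a: "summable (\<lambda>n. cmod (a n))" and \<phi>[measurable]: "\<phi> \<in> borel_measurable borel" and B: "\<And>x. cmod (\<phi> x) \<le> B"
  shows "(\<lambda>n. a n * (\<integral>x. cis (real n * x) * \<phi> x \<partial>circ)) sums (\<integral>x. (\<Sum>n. a n * cis (real n * x)) * \<phi> x \<partial>circ)"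
proof -
  have S: "(\<lambda>n. a n * (cis (real n * x) * \<phi> x)) sums ((\<Sum>n. a n * cis (real n * x)) * \<phi> x)" for x
  proof -
    have "summable (\<lambda>n. a n * cis (real n * x))"
      by (rule summable_norm_cancel) (simp add: norm_mult a)
    from sums_mult2[OF summable_sums[OF this], of "\<phi> x"] show ?thesis by (simp add: mult.assoc)
  qed
  have "(\<lambda>n. \<integral>x. a n * (cis (real n * x) * \<phi> x) \<partial>circ) sums (\<integral>x. (\<Sum>n. a n * cis (real n * x)) * \<phi> x \<partial>circ)"
    by (rule sums_integral_dominated[where c = "\<lambda>n. cmod (a n)" and w = "\<lambda>_. B"])
       (use a B S in \<open>auto simp: norm_mult intro!: mult_left_mono\<close>)
  then show ?thesis by simp
qed

lemma series_circle_bounds: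
  fixes a :: "nat \<Rightarrow> complex"
  assumes a: "summable (\<lambda>n. cmod (a n))"
  shows "cmod (\<Sum>n. a n * cis (real n * x)) \<le> (\<Sum>n. cmod (a n))"
    and "continuous_on UNIV (\<lambda>x. \<Sum>n. a n * cis (real n * x))"
    and "(\<lambda>x. \<Sum>n. a n * cis (real n * x)) \<in> borel_measurable borel"
proof -
  have "summable (\<lambda>n. norm (a n * cis (real n * x)))" by (simp add: norm_mult a)
  from summable_norm[OF this] show "cmod (\<Sum>n. a n * cis (real n * x)) \<le> (\<Sum>n. cmod (a n))"
    by (simp add: norm_mult)
  have "uniform_limit UNIV (\<lambda>N x. \<Sum>n<N. a n * cis (real n * x)) (\<lambda>x. \<Sum>n. a n * cis (real n * x)) sequentially"
    by (rule Weierstrass_m_test[OF _ a]) (simp add: norm_mult)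
  then show "continuous_on UNIV (\<lambda>x. \<Sum>n. a n * cis (real n * x))"
    by (rule uniform_limit_theorem[rotated]) (auto intro!: always_eventually continuous_intros)
  then show "(\<lambda>x. \<Sum>n. a n * cis (real n * x)) \<in> borel_measurable borel"
    by (rule borel_measurable_continuous_onI)
qed

lemma cis_power: "of_real (x ^ n) * cis (real n * \<theta>) = (of_real x * cis \<theta>) ^ n"
  by (simp only: power_mult_distrib Complex.DeMoivre of_real_power)

lemma circle_geometric_series:
  assumes "\<bar>x\<bar> < 1"
  shows "(\<Sum>n. of_real (x ^ n) * cis (real n * \<theta>)) = 1 / (1 - of_real x * cis \<theta>)"
  unfolding cis_power by (rule suminf_geometric) (use assms in \<open>simp add: norm_mult\<close>)

lemma measurable_polar:
  fixes g :: "complex \<Rightarrow> complex"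
  assumes g: "continuous_on (cball 0 r) g" and r: "0 \<le> r"
  shows "(\<lambda>p. indicator (UNIV \<times> {0..r}) p *\<^sub>R g (of_real (snd p) * cis (fst p))) \<in> borel_measurable (borel \<Otimes>\<^sub>M borel)"
proof -
  have "continuous_on (UNIV \<times> {0..r}) (\<lambda>p::real \<times> real. g (of_real (snd p) * cis (fst p)))"
    by (intro continuous_on_compose2[OF g] continuous_intros) (auto simp: norm_mult)
  then have "(\<lambda>p. indicator (UNIV \<times> {0..r}) p *\<^sub>R g (of_real (snd p) * cis (fst p))) \<in> borel_measurable (borel :: (real \<times> real) measure)"
    by (intro borel_measurable_continuous_on_indicator) (auto intro!: borel_closed closed_Times)
  then show ?thesis by (simp only: borel_prod)
qed

lemma circle_parseval:
  fixes a b :: "nat \<Rightarrow> complex"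
  assumes a: "summable (\<lambda>n. cmod (a n))" and b: "summable (\<lambda>n. cmod (b n))"
  shows "(\<lambda>n. a n * cnj (b n)) sums
    (\<integral>x. (\<Sum>n. a n * cis (real n * x)) * cnj (\<Sum>n. b n * cis (real n * x)) \<partial>circ)"
proof -
  have in1: "(\<integral>x. cis (real n * x) * cnj (\<Sum>m. b m * cis (real m * x)) \<partial>circ) = cnj (b n)" for n
  proof -
    have "(\<lambda>m. b m * (\<integral>x. cis (real m * x) * cis (- real n * x) \<partial>circ)) sums
        (\<integral>x. (\<Sum>m. b m * cis (real m * x)) * cis (- real n * x) \<partial>circ)"
      by (rule integral_circ_series[OF b, of _ 1]) auto
    moreover have "(\<integral>x. cis (real m * x) * cis (- real n * x) \<partial>circ) = (if m = n then 1 else 0)" for m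
    proof -
      have "cis (real m * x) * cis (- real n * x) = cis (of_int (int m - int n) * x)" for x
        by (simp add: cis_mult algebra_simps)
      then have "(\<integral>x. cis (real m * x) * cis (- real n * x) \<partial>circ) = (\<integral>x. cis (of_int (int m - int n) * x) \<partial>circ)"
        by (intro Bochner_Integration.integral_cong refl)
      then show ?thesis by (simp only: integral_circ_cis) auto
    qed
    ultimately have "(\<lambda>m. if m = n then b m else 0) sums
        (\<integral>x. (\<Sum>m. b m * cis (real m * x)) * cis (- real n * x) \<partial>circ)"
      by (simp only: if_distrib mult_1_right mult_zero_right)
    then have "(\<integral>x. (\<Sum>m. b m * cis (real m * x)) * cis (- real n * x) \<partial>circ) = b n"
      using sums_single[of n b] sums_unique2 by blast
    then have "cnj (\<integral>x. (\<Sum>m. b m * cis (real m * x)) * cis (- real n * x) \<partial>circ) = cnj (b n)"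
      by simp
    then show ?thesis
      by (simp flip: Bochner_Integration.integral_cnj add: cis_cnj mult.commute)
  qed
  note [measurable] = series_circle_bounds(3)[OF b]
  have "(\<lambda>n. a n * (\<integral>x. cis (real n * x) * cnj (\<Sum>m. b m * cis (real m * x)) \<partial>circ)) sums
    (\<integral>x. (\<Sum>n. a n * cis (real n * x)) * cnj (\<Sum>n. b n * cis (real n * x)) \<partial>circ)"
    by (rule integral_circ_series[OF a, of _ "\<Sum>n. cmod (b n)"])
       (simp_all add: series_circle_bounds(1)[OF b]
          borel_measurable_continuous_onI[OF continuous_on_cnj[OF series_circle_bounds(2)[OF b]]])
  then show ?thesis by (simp only: in1)
qed

lemma circle_l2_norm:
  fixes a :: "nat \<Rightarrow> complex"
  assumes a: "summable (\<lambda>n. cmod (a n))"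
  shows "(\<lambda>n. (cmod (a n))\<^sup>2) sums (\<integral>x. (cmod (\<Sum>n. a n * cis (real n * x)))\<^sup>2 \<partial>circ)"
proof -
  have "(\<lambda>n. complex_of_real ((cmod (a n))\<^sup>2)) sums
      (\<integral>x. complex_of_real ((cmod (\<Sum>n. a n * cis (real n * x)))\<^sup>2) \<partial>circ)"
    using circle_parseval[OF a a] by (simp only: complex_norm_square)
  then have "(\<lambda>n. complex_of_real ((cmod (a n))\<^sup>2)) sums
      complex_of_real (\<integral>x. (cmod (\<Sum>n. a n * cis (real n * x)))\<^sup>2 \<partial>circ)"
    by (simp only: integral_complex_of_real)
  then show ?thesis by (simp only: sums_of_real_iff)
qed

text \<open>Hardy's inequality by duality: the pairing of \<open>e\<^sup>i\<^sup>n\<^sup>x\<close> with the bounded function \<open>(\<pi> - x) e\<^sup>i\<^sup>x\<close> is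
  \<open>\<i> / (n + 1)\<close>, so that the left-hand side is the modulus of the pairing with this function.\<close>

lemma hardy_inequality_nonneg:
  fixes c :: "nat \<Rightarrow> real"
  assumes c: "summable c" "\<And>n. 0 \<le> c n"
  shows "(\<Sum>n. c n / real (n + 1)) \<le> pi * (\<integral>x. cmod (\<Sum>n. of_real (c n) * cis (real n * x)) \<partial>circ)"
    and "summable (\<lambda>n. c n / real (n + 1))"
proof -
  have c': "summable (\<lambda>n. cmod (of_real (c n)))" and c'': "summable (\<lambda>n. \<bar>c n\<bar>)" using c by simp_all
  show sm: "summable (\<lambda>n. c n / real (n + 1))"
    by (rule summable_comparison_test'[OF c(1), of 0]) (use c in \<open>auto simp: field_simps mult_left_le\<close>)
  define \<phi> where "\<phi> x = (if x \<in> {0..2*pi} then (of_real (pi - x) * cis x :: complex) else 0)" for x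
  have \<phi>m[measurable]: "\<phi> \<in> borel_measurable borel" unfolding \<phi>_def by measurable
  have \<phi>b: "cmod (\<phi> x) \<le> pi" for x
    by (auto simp: \<phi>_def norm_mult simp del: of_real_diff)
  have coef: "(\<integral>x. cis (real n * x) * \<phi> x \<partial>circ) = \<i> / of_nat (n + 1)" for n
  proof -
    define k where "k = n + 1"
    have k: "k > 0" by (simp add: k_def)
    have "((\<lambda>x. of_real (pi - x) * cis (real k * x)) has_integral
            ((of_real (pi - 2*pi) * cis (real k * (2*pi)) / (\<i> * of_nat k) - cis (real k * (2*pi)) / (of_nat k)^2) -
             (of_real (pi - 0) * cis (real k * 0) / (\<i> * of_nat k) - cis (real k * 0) / (of_nat k)^2))) {0..2*pi}"
      using k
      by (intro fundamental_theorem_of_calculus)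
         (auto simp: cis_conv_exp field_simps power2_eq_square intro!: derivative_eq_intros has_vector_derivative_real_field)
    moreover have "cis (real k * (2*pi)) = 1"
      by (metis cis_multiple_2pi mult.commute Ints_of_nat)
    ultimately have "((\<lambda>x. of_real (pi - x) * cis (real k * x)) has_integral (2 * pi * \<i> / of_nat k)) {0..2*pi}"
      using k by (simp add: field_simps)
    then have "integral {0..2*pi} (\<lambda>x. of_real (pi - x) * cis (real k * x)) = 2 * pi * \<i> / of_nat k"
      by (rule integral_unique)
    moreover have "continuous_on {0..2*pi} (\<lambda>x. of_real (pi - x) * cis (real k * x))"
      by (intro continuous_intros)
    ultimately have L: "(LINT x:{0..2*pi}|lborel. of_real (pi - x) * cis (real k * x)) = 2 * pi * \<i> / of_nat k"
      by (subst set_borel_integral_eq_integral(2)) (auto intro: borel_integrable_atLeastAtMost')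
    have "(\<integral>x. cis (real n * x) * \<phi> x \<partial>circ) = (1 / (2 * pi)) *\<^sub>R (LINT x:{0..2*pi}|lborel. cis (real n * x) * \<phi> x)"
      by (rule integral_circ) measurable
    also have "(LINT x:{0..2*pi}|lborel. cis (real n * x) * \<phi> x) = (LINT x:{0..2*pi}|lborel. of_real (pi - x) * cis (real k * x))"
      by (rule set_lebesgue_integral_cong) (auto simp: \<phi>_def cis_mult k_def distrib_right add.commute)
    finally show ?thesis using L by (simp add: scaleR_conv_of_real k_def)
  qed
  have "(\<lambda>n. of_real (c n) * (\<i> / of_nat (n + 1))) sums (\<integral>x. (\<Sum>n. of_real (c n) * cis (real n * x)) * \<phi> x \<partial>circ)"
    using integral_circ_series[OF c' \<phi>m \<phi>b] by (simp only: coef)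
  moreover have "(\<lambda>n. \<i> * of_real (c n / real (n + 1))) sums (\<i> * of_real (\<Sum>n. c n / real (n + 1)))"
    by (intro sums_mult sums_of_real summable_sums sm)
  ultimately have eq: "(\<integral>x. (\<Sum>n. of_real (c n) * cis (real n * x)) * \<phi> x \<partial>circ) = \<i> * of_real (\<Sum>n. c n / real (n + 1))"
    by (intro sums_unique2) (simp_all add: mult_ac)
  note b = series_circle_bounds[OF c']
  have "(\<Sum>n. c n / real (n + 1)) = cmod (\<i> * of_real (\<Sum>n. c n / real (n + 1)))"
    using suminf_nonneg[OF sm] c by (simp add: norm_mult)
  also have "\<dots> = cmod (\<integral>x. (\<Sum>n. of_real (c n) * cis (real n * x)) * \<phi> x \<partial>circ)"
    by (simp only: eq)
  also have "\<dots> \<le> (\<integral>x. cmod (\<Sum>n. of_real (c n) * cis (real n * x)) * pi \<partial>circ)"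
    using b by (intro Bochner_Integration.integral_norm_bound_integral integrable_circ_bounded[where B = "(\<Sum>n. cmod (of_real (c n))) * pi"])
      (auto simp: norm_mult intro!: mult_mono \<phi>b suminf_nonneg c'')
  also have "\<dots> = pi * (\<integral>x. cmod (\<Sum>n. of_real (c n) * cis (real n * x)) \<partial>circ)"
    by simp
  finally show "(\<Sum>n. c n / real (n + 1)) \<le> pi * (\<integral>x. cmod (\<Sum>n. of_real (c n) * cis (real n * x)) \<partial>circ)" .
qed

section \<open>The Hardy space and its test functions\<close>

lemma circle_mean_nonneg: "0 \<le> circle_mean f r"
  unfolding circle_mean_def
  by (cases "(\<lambda>x. cmod (f (of_real r * cis x))) integrable_on {0..2*pi}")
     (auto simp: not_integrable_integral intro!: divide_nonneg_nonneg integral_nonneg)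

lemma continuous_on_sphere_disc:
  assumes "f holomorphic_on unit_disc" "r < 1"
  shows "continuous_on (sphere 0 r) f"
  by (rule holomorphic_on_imp_continuous_on[OF holomorphic_on_subset[OF assms(1)]]) (use assms(2) in auto)

lemma circle_mean_le_H1_norm:
  assumes "f \<in> H1" "0 < r" "r < 1"
  shows "circle_mean f r \<le> H1_norm f"
  unfolding H1_norm_def using assms by (intro cSUP_upper) (auto simp: H1_def)

lemma H1_norm_nonneg: "f \<in> H1 \<Longrightarrow> 0 \<le> H1_norm f"
  using circle_mean_le_H1_norm[of f "1/2"] circle_mean_nonneg[of f "1/2"] by simp

lemma H1_I:
  assumes "f holomorphic_on unit_disc" "\<And>r. 0 < r \<Longrightarrow> r < 1 \<Longrightarrow> circle_mean f r \<le> B"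
  shows "f \<in> H1" "H1_norm f \<le> B"
proof -
  show "f \<in> H1" using assms by (auto simp: H1_def intro!: bdd_aboveI2)
  show "H1_norm f \<le> B" unfolding H1_norm_def using assms by (intro cSUP_least) auto
qed

lemma holomorphic_taylor_abs_summable:
  assumes g: "g holomorphic_on ball 0 R" and s: "0 \<le> s" "s < R"
  shows "summable (\<lambda>n. cmod ((deriv ^^ n) g 0 / fact n) * s ^ n)"
proof -
  obtain q where q: "s < q" "q < R" using s dense by blast
  have "summable (\<lambda>n. (deriv ^^ n) g 0 / fact n * (of_real q) ^ n)"
    using holomorphic_power_series[OF g, of "of_real q"] q s by (auto simp: sums_iff)
  from powser_insidea[OF this, of "of_real s"] show ?thesis
    using q s by (simp add: norm_mult norm_divide norm_power)
qed

text \<open>Parseval's identity for \<open>g\<close> and the geometric series.\<close>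

lemma circle_cauchy_formula:
  assumes g: "g holomorphic_on ball 0 R" "1 < R" and t: "0 \<le> t" "t < 1"
  shows "g (of_real t) = (\<integral>x. g (cis x) / (1 - of_real t * cis (-x)) \<partial>circ)"
proof -
  define a where "a n = (deriv ^^ n) g 0 / fact n" for n
  have a: "(\<lambda>n. a n * w ^ n) sums g w" if "cmod w < R" for w
    using holomorphic_power_series[OF g(1), of w] that by (simp add: a_def)
  have sa: "summable (\<lambda>n. cmod (a n))"
    using holomorphic_taylor_abs_summable[OF g(1), of 1] g(2) by (simp add: a_def)
  have st: "summable (\<lambda>n. cmod (of_real (t ^ n)))"
    using t by (simp add: norm_power)
  have "(\<Sum>n. a n * cis (real n * x)) = g (cis x)" for x
    using sums_unique[OF a[of "cis x"]] g(2) by (simp add: Complex.DeMoivre)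
  then have "(\<lambda>n. a n * cnj (of_real (t ^ n))) sums (\<integral>x. g (cis x) * cnj (1 / (1 - of_real t * cis x)) \<partial>circ)"
    using circle_parseval[OF sa st] t by (simp only: circle_geometric_series abs_of_nonneg)
  moreover have "(\<lambda>n. a n * cnj (of_real (t ^ n))) sums g (of_real t)"
    using a[of "of_real t"] t g(2) by simp
  ultimately have "g (of_real t) = (\<integral>x. g (cis x) * cnj (1 / (1 - of_real t * cis x)) \<partial>circ)"
    by (rule sums_unique2[symmetric])
  then show ?thesis by (simp add: cis_cnj)
qed

text \<open>On the unit circle the modulus is the Poisson kernel of \<open>a\<close>, which explains the normalization.\<close>

definition squared_cauchy :: "real \<Rightarrow> complex \<Rightarrow> complex" where
  "squared_cauchy a z = of_real (1 - a\<^sup>2) / (1 - of_real a * z)\<^sup>2"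

lemma squared_cauchy_H1:
  assumes a: "0 \<le> a" "a < 1"
  shows "squared_cauchy a \<in> H1" "H1_norm (squared_cauchy a) \<le> 1"
proof -
  have lt: "cmod (of_real a * z) < 1" if "cmod z < 1" for z
    using mult_left_le_one_le[of "cmod z" a] a that by (simp add: norm_mult)
  have nz: "1 - of_real a * z \<noteq> 0" if "cmod z < 1" for z
    using lt[OF that] by (metis eq_iff_diff_eq_0 less_irrefl norm_one)
  have hol: "squared_cauchy a holomorphic_on unit_disc"
    unfolding squared_cauchy_def using nz by (intro holomorphic_intros) auto
  have "circle_mean (squared_cauchy a) r \<le> 1" if r: "0 < r" "r < 1" for r
  proof -
    define s where "s = a * r"
    have s: "0 \<le> s" "s \<le> a" "s < 1" using a r mult_left_le[of r a] by (auto simp: s_def)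
    have sm: "summable (\<lambda>n. cmod (of_real (s ^ n)))" using s by (simp add: norm_power)
    have e: "(\<Sum>n. of_real (s ^ n) * cis (real n * \<theta>)) = 1 / (1 - of_real s * cis \<theta>)" for \<theta>
      using s by (intro circle_geometric_series) auto
    have n: "(cmod (of_real (s ^ n)))\<^sup>2 = (s\<^sup>2) ^ n" for n
      by (simp only: norm_of_real power2_abs power_mult[symmetric] mult.commute)
    have s2: "s\<^sup>2 < 1" using s by (simp add: abs_square_less_1)
    have "(\<lambda>n. (s\<^sup>2) ^ n) sums (\<integral>\<theta>. (cmod (1 / (1 - of_real s * cis \<theta>)))\<^sup>2 \<partial>circ)"
      using circle_l2_norm[OF sm] by (simp only: e n)
    moreover have "(\<lambda>n. (s\<^sup>2) ^ n) sums (1 / (1 - s\<^sup>2))"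
      using s2 by (intro geometric_sums) simp
    ultimately have i: "(\<integral>\<theta>. (cmod (1 / (1 - of_real s * cis \<theta>)))\<^sup>2 \<partial>circ) = 1 / (1 - s\<^sup>2)"
      by (rule sums_unique2)
    have a2: "0 \<le> 1 - a\<^sup>2" using a by (simp add: power_le_one)
    have "circle_mean (squared_cauchy a) r = (\<integral>\<theta>. cmod (squared_cauchy a (of_real r * cis \<theta>)) \<partial>circ)"
      using circle_mean_eq(1)[OF continuous_on_sphere_disc[OF hol r(2)]] r by simp
    also have "\<dots> = (\<integral>\<theta>. (1 - a\<^sup>2) * (cmod (1 / (1 - of_real s * cis \<theta>)))\<^sup>2 \<partial>circ)"
    proof -
      have "cmod (squared_cauchy a (of_real r * cis \<theta>)) = (1 - a\<^sup>2) * (cmod (1 / (1 - of_real s * cis \<theta>)))\<^sup>2" for \<theta>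
      proof -
        have "cmod (squared_cauchy a (of_real r * cis \<theta>)) = cmod (of_real (1 - a\<^sup>2)) / (cmod (1 - of_real s * cis \<theta>))\<^sup>2"
          by (simp only: squared_cauchy_def norm_divide norm_power s_def of_real_mult mult.assoc)
        also have "cmod (of_real (1 - a\<^sup>2)) = 1 - a\<^sup>2" using a2 by (simp only: norm_of_real abs_of_nonneg)
        finally show ?thesis by (simp add: norm_divide power_divide)
      qed
      then show ?thesis by simp
    qed
    also have "\<dots> = (1 - a\<^sup>2) * (1 / (1 - s\<^sup>2))" by (simp only: i integral_mult_right_zero)
    also have "\<dots> \<le> 1"
    proof -
      have "s\<^sup>2 \<le> a\<^sup>2" using s by (intro power_mono) auto
      then show ?thesis using s2 by simp
    qed
    finally show ?thesis .
  qed
  from H1_I[OF hol this] show "squared_cauchy a \<in> H1" "H1_norm (squared_cauchy a) \<le> 1" by auto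
qed

lemma squared_cauchy_real:
  assumes a: "0 \<le> a" "a < 1" and t: "0 \<le> t" "t < 1"
  shows "squared_cauchy a (of_real t) = of_real ((1 - a\<^sup>2) / (1 - a * t)\<^sup>2)"
    and "0 \<le> (1 - a\<^sup>2) / (1 - a * t)\<^sup>2"
    and "a \<le> t \<Longrightarrow> 1 \<le> 2 * (1 - a) * ((1 - a\<^sup>2) / (1 - a * t)\<^sup>2)"
proof -
  show "squared_cauchy a (of_real t) = of_real ((1 - a\<^sup>2) / (1 - a * t)\<^sup>2)"
    by (simp add: squared_cauchy_def)
  have a2: "0 \<le> 1 - a\<^sup>2" using a by (simp add: power_le_one)
  then show "0 \<le> (1 - a\<^sup>2) / (1 - a * t)\<^sup>2" by simp
  assume at: "a \<le> t"
  have "a * a < 1" using a mult_strict_mono[of a 1 a 1] by (cases "a = 0") auto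
  then have p: "0 < 1 - a\<^sup>2" by (simp add: power2_eq_square)
  have "a * t < 1" using a t mult_le_one[of a t] mult_strict_mono[of a 1 t 1] by (cases "t = 0") auto
  moreover have "1 - a * t \<le> 1 - a\<^sup>2" using mult_left_mono[OF at a(1)] by (simp add: power2_eq_square)
  ultimately have sq: "(1 - a * t)\<^sup>2 \<le> (1 - a\<^sup>2)\<^sup>2" "0 < (1 - a * t)\<^sup>2"
    by (auto intro!: power_mono)
  have "1 - a\<^sup>2 = (1 - a) * (1 + a)" by (simp add: power2_eq_square algebra_simps)
  also have "\<dots> \<le> (1 - a) * 2" using a by (intro mult_left_mono) auto
  finally have "(1 - a\<^sup>2) * (1 - a\<^sup>2) \<le> (2 * (1 - a)) * (1 - a\<^sup>2)"
    using p by (intro mult_right_mono) auto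
  then have "(1 - a * t)\<^sup>2 \<le> 2 * (1 - a) * (1 - a\<^sup>2)" using sq(1) by (simp add: power2_eq_square)
  then show "1 \<le> 2 * (1 - a) * ((1 - a\<^sup>2) / (1 - a * t)\<^sup>2)"
    using sq(2) by (simp add: pos_le_divide_eq)
qed

lemma measurable_holomorphic_radius:
  assumes "f holomorphic_on unit_disc"
  shows "(\<lambda>t. f (of_real t)) \<in> borel_measurable (restrict_space borel {0..<1})"
  by (intro borel_measurable_continuous_on_restrict
        continuous_on_compose2[OF holomorphic_on_imp_continuous_on[OF assms]] continuous_intros) auto

section \<open>Embedding of the Hardy space along a radius\<close>

text \<open>Up to a factor between \<open>1\<close> and \<open>2\<close>, this is the Poisson kernel \<open>(1 - t\<^sup>2) / \<bar>1 - t z\<bar>\<^sup>2\<close> at \<open>z = e\<^sup>i\<^sup>x\<close>,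
  multiplied by \<open>\<bar>1 - z\<bar> / (1 - t)\<close>.\<close>

definition damped_kernel :: "real \<Rightarrow> real \<Rightarrow> real" where
  "damped_kernel t x = 2 * cmod (1 - cis x) / (cmod (1 - of_real t * cis x))\<^sup>2"

lemma damped_kernel_nonneg: "0 \<le> damped_kernel t x"
  by (simp add: damped_kernel_def)

text \<open>Cauchy's formula at \<open>t\<close> for the product of \<open>f(r z)\<close> and the multiplier \<open>(1 - z) (1 + t) / (1 - t z)\<close>, which is
\<open>1\<close> at \<open>z = t\<close> and vanishes at \<open>z = 1\<close>.\<close>

lemma dilated_value_le:
  assumes f: "f holomorphic_on unit_disc" and r: "0 < r" "r < 1" and t: "0 \<le> t" "t < 1"
  shows "ennreal (cmod (f (of_real (r * t)))) \<le>
    (\<integral>\<^sup>+x. ennreal (cmod (f (of_real r * cis x)) * damped_kernel t x) \<partial>circ)"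
proof -
  \<comment> \<open>On the circle \<open>\<bar>z - t\<bar> = \<bar>1 - t z\<bar>\<close>, so that the multiplier turns the Cauchy kernel into a square.\<close>
  define g where "g z = f (of_real r * z) * ((1 - z) * (1 + of_real t) / (1 - of_real t * z))" for z
  define R where "R = 1 / max r t"
  have R: "1 < R" using r t by (auto simp: R_def)
  have ball: "cmod (of_real r * z) < 1" "cmod (of_real t * z) < 1" if "z \<in> ball 0 R" for z
  proof -
    have z: "max r t * cmod z < 1" using that r by (auto simp: R_def field_simps)
    have "r * cmod z \<le> max r t * cmod z" "t * cmod z \<le> max r t * cmod z" by (auto intro!: mult_right_mono)
    then show "cmod (of_real r * z) < 1" "cmod (of_real t * z) < 1" using z r t by (auto simp: norm_mult)
  qed
  have nz: "1 - of_real t * z \<noteq> (0::complex)" if "z \<in> ball 0 R" for z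
    using ball(2)[OF that] by (metis eq_iff_diff_eq_0 less_irrefl norm_one)
  have fr: "(\<lambda>z. f (of_real r * z)) holomorphic_on ball 0 R"
    by (rule holomorphic_on_compose_gen[OF _ f, unfolded o_def]) (use ball in \<open>auto intro!: holomorphic_intros\<close>)
  have g: "g holomorphic_on ball 0 R"
    unfolding g_def using nz by (intro holomorphic_intros fr) auto
  have nz1: "1 - of_real t * cis x \<noteq> 0" "1 - of_real t * cis (-x) \<noteq> 0" for x
    using nz[of "cis x"] nz[of "cis (-x)"] R by auto
  have gt: "g (of_real t) = f (of_real (r * t))"
  proof -
    have "(1 - of_real t :: complex) * (1 + of_real t) = 1 - of_real t * of_real t" by (simp add: algebra_simps)
    moreover have "1 - of_real t * of_real t \<noteq> (0::complex)" using nz[of "of_real t"] t R by auto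
    ultimately show ?thesis by (simp add: g_def)
  qed
  have cont: "continuous_on UNIV (\<lambda>x. g (cis x) / (1 - of_real t * cis (-x)))"
    by (intro continuous_intros continuous_on_compose2[OF holomorphic_on_imp_continuous_on[OF g]])
       (use R nz1 in auto)
  have "ennreal (cmod (f (of_real (r * t)))) = ennreal (norm (\<integral>x. g (cis x) / (1 - of_real t * cis (-x)) \<partial>circ))"
    using circle_cauchy_formula[OF g R t] gt by simp
  also have "\<dots> \<le> (\<integral>\<^sup>+x. ennreal (norm (g (cis x) / (1 - of_real t * cis (-x)))) \<partial>circ)"
    by (rule integral_norm_bound_ennreal) (rule integrable_circ_continuous[OF cont])
  also have "\<dots> \<le> (\<integral>\<^sup>+x. ennreal (cmod (f (of_real r * cis x)) * damped_kernel t x) \<partial>circ)"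
  proof (intro nn_integral_mono ennreal_leI)
    fix x
    have c: "cmod (1 - of_real t * cis (-x)) = cmod (1 - of_real t * cis x)"
      by (metis cis_cnj complex_cnj_complex_of_real complex_cnj_diff complex_cnj_mult complex_cnj_one complex_mod_cnj)
    have "cmod (1 + of_real t) = 1 + t" using t by (metis abs_of_nonneg add_nonneg_nonneg norm_of_real of_real_1 of_real_add zero_le_one)
    then have "norm (g (cis x) / (1 - of_real t * cis (-x))) =
      cmod (f (of_real r * cis x)) * (cmod (1 - cis x) * (1 + t) / (cmod (1 - of_real t * cis x))\<^sup>2)"
      by (simp add: g_def norm_mult norm_divide c power2_eq_square)
    also have "\<dots> \<le> cmod (f (of_real r * cis x)) * damped_kernel t x"
      unfolding damped_kernel_def using t by (intro mult_left_mono divide_right_mono) (auto simp: mult.commute intro!: mult_right_mono)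
    finally show "norm (g (cis x) / (1 - of_real t * cis (-x))) \<le> cmod (f (of_real r * cis x)) * damped_kernel t x" .
  qed
  finally show ?thesis .
qed

lemma damped_kernel_le:
  assumes t: "0 \<le> t" "t < 1"
  shows "damped_kernel t x \<le> 4 * (cmod (1 - cis x) / 2) / (max (1 - t) (cmod (1 - cis x) / 2))\<^sup>2"
proof -
  let ?d = "cmod (1 - of_real t * cis x)"
  have e: "cmod (of_real t * cis x) = t" using t by (simp add: norm_mult)
  have 1: "1 - t \<le> ?d" using norm_triangle_ineq2[of 1 "of_real t * cis x"] e by simp
  have "cmod (1 - cis x) \<le> ?d + cmod (of_real t * cis x - cis x)"
    using norm_triangle_ineq[of "1 - of_real t * cis x" "of_real t * cis x - cis x"] by simp
  also have "of_real t * cis x - cis x = of_real (t - 1) * cis x" by (simp add: algebra_simps)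
  also have "cmod \<dots> = 1 - t" using t by (simp add: norm_mult del: of_real_diff)
  finally have 2: "cmod (1 - cis x) / 2 \<le> ?d" using 1 by simp
  have "0 < max (1 - t) (cmod (1 - cis x) / 2)" using t by simp
  moreover have "(max (1 - t) (cmod (1 - cis x) / 2))\<^sup>2 \<le> ?d\<^sup>2"
    using 1 2 t by (intro power_mono) auto
  moreover have "0 < ?d" using 1 t by linarith
  ultimately show ?thesis unfolding damped_kernel_def
    by (simp add: divide_left_mono)
qed

text \<open>For \<open>d = 1 - t\<close> and \<open>e = \<bar>1 - z\<bar> / 2\<close> the left-hand side of the second bound is the upper bound of
  \<open>damped_kernel_le\<close>, and the least \<open>k\<close> with the first property satisfies the second one.\<close>

lemma damped_kernel_dyadic:
  fixes d e :: real
  assumes d: "0 < d" and e: "0 < e"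
  obtains k :: nat where "d \<le> 2 ^ k * e" "4 * e / (max d e)\<^sup>2 \<le> 16 / (4 ^ k * e)"
proof -
  have ex: "\<exists>k::nat. d \<le> 2 ^ k * e"
  proof -
    obtain k :: nat where "d / e < 2 ^ k" using real_arch_pow[of 2 "d / e"] by auto
    then show ?thesis using e by (intro exI[of _ k]) (simp add: field_simps)
  qed
  define k where "k = (LEAST k. d \<le> 2 ^ k * e)"
  have k: "d \<le> 2 ^ k * e" unfolding k_def by (rule LeastI_ex[OF ex])
  have "4 * e / (max d e)\<^sup>2 \<le> 16 / (4 ^ k * e)"
  proof (cases k)
    case 0
    have "4 * e / (max d e)\<^sup>2 \<le> 4 * e / e\<^sup>2"
      using e by (intro divide_left_mono power_mono) auto
    also have "\<dots> \<le> 16 / e" using e by (simp add: power2_eq_square divide_simps)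
    finally show ?thesis using 0 by simp
  next
    case (Suc j)
    then have "\<not> d \<le> 2 ^ j * e" using not_less_Least[of j "\<lambda>k. d \<le> 2 ^ k * e"] by (simp add: k_def)
    then have "2 ^ j * e \<le> max d e" by simp
    then have "(2 ^ j * e)\<^sup>2 \<le> (max d e)\<^sup>2" using e by (intro power_mono) auto
    then have "4 * e / (max d e)\<^sup>2 \<le> 4 * e / (2 ^ j * e)\<^sup>2"
      using e by (intro divide_left_mono) (auto simp: max_def)
    also have "(2 ^ j * e)\<^sup>2 = 4 ^ j * (e * e)"
      by (simp add: power_mult_distrib power2_eq_square flip: power_mult_distrib[of 2 2])
    also have "4 * e / (4 ^ j * (e * e)) = 16 / (4 ^ k * e)" using e Suc by (simp add: field_simps)
    finally show ?thesis .
  qed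
  with k that show ?thesis by blast
qed

text \<open>For the Poisson kernel itself every dyadic piece could contribute the same amount, and their sum could
be unbounded; the factor \<open>\<bar>1 - z\<bar> / (1 - t)\<close> makes the contributions decay geometrically.\<close>

lemma nn_integral_damped_kernel:
  assumes sets[measurable_cong]: "sets M = sets (restrict_space borel {0..<1})"
    and K: "0 \<le> K" "\<And>a. 0 \<le> a \<Longrightarrow> a < 1 \<Longrightarrow> emeasure M {a..<1} \<le> ennreal (K * (1 - a))"
  shows "(\<integral>\<^sup>+t. ennreal (damped_kernel t x) \<partial>M) \<le> ennreal (32 * K)"
proof (cases "cis x = 1")
  case False
  \<comment> \<open>Half the distance to \<open>1\<close>, as in \<open>damped_kernel_le\<close>.\<close>
  define e where "e = cmod (1 - cis x) / 2"
  have e: "0 < e" using False by (auto simp: e_def)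
  have space: "space M = {0..<1}" using sets_eq_imp_space_eq[OF sets] by (simp add: space_restrict_space)
  define A where "A k = {max 0 (1 - 2 ^ k * e)..<1}" for k :: nat
  have A[measurable]: "A k \<in> sets M" for k
    by (auto simp: sets A_def sets_restrict_space_iff)
  have "(\<integral>\<^sup>+t. ennreal (damped_kernel t x) \<partial>M) \<le> (\<integral>\<^sup>+t. (\<Sum>k. ennreal (16 / (4 ^ k * e)) * indicator (A k) t) \<partial>M)"
  proof (rule nn_integral_mono)
    fix t assume "t \<in> space M"
    then have t: "0 \<le> t" "t < 1" by (auto simp: space)
    obtain k :: nat where k: "1 - t \<le> 2 ^ k * e" "4 * e / (max (1 - t) e)\<^sup>2 \<le> 16 / (4 ^ k * e)"
      using damped_kernel_dyadic[of "1 - t" e] t e by auto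
    have "damped_kernel t x \<le> 16 / (4 ^ k * e)"
      using damped_kernel_le[OF t, of x] k(2) unfolding e_def by linarith
    then have "ennreal (damped_kernel t x) \<le> ennreal (16 / (4 ^ k * e)) * indicator (A k) t"
      using t k(1) by (auto simp: A_def indicator_def intro!: ennreal_leI)
    also have "\<dots> \<le> (\<Sum>k. ennreal (16 / (4 ^ k * e)) * indicator (A k) t)"
      
    proof -
      have "h k \<le> suminf h" for h :: "nat \<Rightarrow> ennreal"
        using sum_le_suminf[OF summableI, of "{k}" h] by simp
      then show ?thesis .
    qed
    finally show "ennreal (damped_kernel t x) \<le> (\<Sum>k. ennreal (16 / (4 ^ k * e)) * indicator (A k) t)" .
  qed
  also have "\<dots> = (\<Sum>k. ennreal (16 / (4 ^ k * e)) * emeasure M (A k))"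
    by (subst nn_integral_suminf) (auto simp: nn_integral_cmult)
  also have "\<dots> \<le> (\<Sum>k. ennreal (16 * K * (1/2) ^ k))"
  proof (intro suminf_le summableI)
    fix k :: nat
    have "emeasure M (A k) \<le> ennreal (K * (1 - max 0 (1 - 2 ^ k * e)))"
      unfolding A_def using e by (intro K(2)) auto
    also have "\<dots> \<le> ennreal (K * (2 ^ k * e))"
      using K(1) by (intro ennreal_leI mult_left_mono) auto
    finally have "ennreal (16 / (4 ^ k * e)) * emeasure M (A k) \<le> ennreal (16 / (4 ^ k * e)) * ennreal (K * (2 ^ k * e))"
      by (rule mult_left_mono) simp
    also have "\<dots> = ennreal (16 / (4 ^ k * e) * (K * (2 ^ k * e)))"
      using e K(1) by (intro ennreal_mult[symmetric]) auto
    also have "16 / (4 ^ k * e) * (K * (2 ^ k * e)) = 16 * K * (1/2) ^ k"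
    proof -
      have "(4::real) ^ k = 2 ^ k * 2 ^ k" by (simp flip: power_mult_distrib)
      then show ?thesis using e by (simp add: field_simps power_one_over)
    qed
    finally show "ennreal (16 / (4 ^ k * e)) * emeasure M (A k) \<le> ennreal (16 * K * (1/2) ^ k)" .
  qed
  also have "\<dots> = ennreal (32 * K)"
  proof (rule suminf_ennreal_eq)
    have "(\<lambda>k. 16 * K * (1/2) ^ k) sums (16 * K * (1 / (1 - 1/2)))"
      by (intro sums_mult geometric_sums) simp
    then show "(\<lambda>k. 16 * K * (1/2) ^ k) sums (32 * K)" by simp
  qed (use K in auto)
  finally show ?thesis .
qed (simp add: damped_kernel_def)

text \<open>The dilations \<open>f(r z)\<close> are estimated by Fubini's theorem, and \<open>f\<close> itself by Fatou's lemma as \<open>r\<close> tends to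
\<open>1\<close>.\<close>

lemma radial_carleson_embedding:
  assumes sets[measurable_cong]: "sets M = sets (restrict_space borel {0..<1})"
    and K: "0 \<le> K" "\<And>a. 0 \<le> a \<Longrightarrow> a < 1 \<Longrightarrow> emeasure M {a..<1} \<le> ennreal (K * (1 - a))"
    and f: "f \<in> H1"
  shows "(\<integral>\<^sup>+t. ennreal (cmod (f (of_real t))) \<partial>M) \<le> ennreal (32 * K * H1_norm f)"
proof -
  have hol: "f holomorphic_on unit_disc" using f by (simp add: H1_def)
  have space: "space M = {0..<1}" using sets_eq_imp_space_eq[OF sets] by (simp add: space_restrict_space)
  interpret finite_measure M
  proof
    have "emeasure M {0..<1} \<le> ennreal (K * (1 - 0))" by (rule K(2)) auto
    also have "\<dots> < \<infinity>" by simp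
    finally show "emeasure M (space M) \<noteq> \<infinity>" by (simp add: space)
  qed
  interpret P: pair_sigma_finite M circ ..
  have idM[measurable]: "(\<lambda>t. t) \<in> borel_measurable M"
    by (subst measurable_cong_sets[OF sets refl]) (auto intro!: measurable_restrict_space1)
  have fst: "fst \<in> borel_measurable (M \<Otimes>\<^sub>M circ)"
    using measurable_compose[OF measurable_fst idM] by simp
  have snd: "snd \<in> borel_measurable (M \<Otimes>\<^sub>M circ)"
    using measurable_snd[of M circ] by simp
  have fr: "(\<lambda>t. f (of_real (r * t))) \<in> borel_measurable M" if "0 < r" "r \<le> 1" for r
  proof -
    have "r * t < 1" if "0 \<le> t" "t < 1" for t 
      using mult_left_le_one_le[of t r] that \<open>0 < r\<close> \<open>r \<le> 1\<close> by auto
    then have "continuous_on {0..<1} (\<lambda>t. f (of_real (r * t)))"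
      using that by (intro continuous_on_compose2[OF holomorphic_on_imp_continuous_on[OF hol]] continuous_intros)
        (auto simp: norm_mult)
    then have "(\<lambda>t. f (of_real (r * t))) \<in> borel_measurable (restrict_space borel {0..<1})"
      by (rule borel_measurable_continuous_on_restrict)
    then show ?thesis by (subst measurable_cong_sets[OF sets refl])
  qed
  have dil: "(\<integral>\<^sup>+t. ennreal (cmod (f (of_real (r * t)))) \<partial>M) \<le> ennreal (32 * K * H1_norm f)" if r: "0 < r" "r < 1" for r
  proof -
    note cm = circle_mean_eq[OF continuous_on_sphere_disc[OF hol r(2)] less_imp_le[OF r(1)]]
    have fm: "(\<lambda>x. ennreal (cmod (f (of_real r * cis x)))) \<in> borel_measurable circ"
      using measurable_compose[OF cm(3), of "\<lambda>z. ennreal (cmod z)" borel] by simp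
    have "(\<integral>\<^sup>+t. ennreal (cmod (f (of_real (r * t)))) \<partial>M) \<le>
       (\<integral>\<^sup>+t. (\<integral>\<^sup>+x. ennreal (cmod (f (of_real r * cis x)) * damped_kernel t x) \<partial>circ) \<partial>M)"
      using r by (intro nn_integral_mono dilated_value_le hol) (auto simp: space)
    also have "\<dots> = (\<integral>\<^sup>+x. (\<integral>\<^sup>+t. ennreal (cmod (f (of_real r * cis x)) * damped_kernel t x) \<partial>M) \<partial>circ)"
    proof (rule P.Fubini'[symmetric])
      have "(\<lambda>p. ennreal (cmod (f (of_real r * cis (snd p))) * damped_kernel (fst p) (snd p)))
          \<in> borel_measurable (borel \<Otimes>\<^sub>M borel)"
      proof -
        have [measurable]: "(\<lambda>p. f (of_real r * cis (snd p))) \<in> borel_measurable (borel \<Otimes>\<^sub>M borel)"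
          by (rule measurable_compose[OF measurable_snd cm(3)])
        have [measurable]: "(\<lambda>p::real \<times> real. damped_kernel (fst p) (snd p)) \<in> borel_measurable (borel \<Otimes>\<^sub>M borel)"
          unfolding damped_kernel_def by measurable
        show ?thesis by measurable
      qed
      from measurable_compose[OF measurable_Pair[OF fst snd] this]
      show "(\<lambda>(t, x). ennreal (cmod (f (of_real r * cis x)) * damped_kernel t x)) \<in> borel_measurable (M \<Otimes>\<^sub>M circ)"
        by (simp add: case_prod_beta)
    qed
    also have "\<dots> = (\<integral>\<^sup>+x. ennreal (cmod (f (of_real r * cis x))) * (\<integral>\<^sup>+t. ennreal (damped_kernel t x) \<partial>M) \<partial>circ)"
    proof (rule nn_integral_cong)
      fix x
      have "(\<lambda>t. ennreal (damped_kernel t x)) \<in> borel_measurable M"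
        unfolding damped_kernel_def by measurable
      then show "(\<integral>\<^sup>+t. ennreal (cmod (f (of_real r * cis x)) * damped_kernel t x) \<partial>M) =
         ennreal (cmod (f (of_real r * cis x))) * (\<integral>\<^sup>+t. ennreal (damped_kernel t x) \<partial>M)"
        by (simp add: nn_integral_cmult ennreal_mult' damped_kernel_nonneg)
    qed
    also have "\<dots> \<le> (\<integral>\<^sup>+x. ennreal (cmod (f (of_real r * cis x))) * ennreal (32 * K) \<partial>circ)"
      by (intro nn_integral_mono mult_left_mono nn_integral_damped_kernel[OF sets K]) auto
    also have "\<dots> = (\<integral>\<^sup>+x. ennreal (cmod (f (of_real r * cis x))) \<partial>circ) * ennreal (32 * K)"
      by (rule nn_integral_multc) (rule fm)
    also have "(\<integral>\<^sup>+x. ennreal (cmod (f (of_real r * cis x))) \<partial>circ) = ennreal (circle_mean f r)"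
      using cm(1,2) by (simp add: nn_integral_eq_integral)
    also have "ennreal (circle_mean f r) * ennreal (32 * K) \<le> ennreal (H1_norm f) * ennreal (32 * K)"
      by (intro mult_right_mono ennreal_leI circle_mean_le_H1_norm f r) simp
    also have "\<dots> = ennreal (32 * K * H1_norm f)"
      using K(1) H1_norm_nonneg[OF f] by (simp add: mult_ac flip: ennreal_mult)
    finally show ?thesis .
  qed
  \<comment> \<open>The shift by \<open>2\<close> keeps all radii positive.\<close>
  define r where "r n = 1 - 1 / real (n + 2)" for n
  have r: "0 < r n" "r n < 1" for n by (auto simp: r_def field_simps)
  have rlim: "r \<longlonglongrightarrow> 1" unfolding r_def by real_asymp
  have "(\<integral>\<^sup>+t. ennreal (cmod (f (of_real t))) \<partial>M) = (\<integral>\<^sup>+t. liminf (\<lambda>n. ennreal (cmod (f (of_real (r n * t))))) \<partial>M)"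
  proof (rule nn_integral_cong)
    fix t assume "t \<in> space M"
    then have t: "0 \<le> t" "t < 1" by (auto simp: space)
    have "isCont f (of_real t)"
      using hol t by (intro continuous_on_interior[OF holomorphic_on_imp_continuous_on[OF hol]]) auto
    moreover have "(\<lambda>n. complex_of_real (r n * t)) \<longlonglongrightarrow> of_real t"
      using tendsto_of_real[OF tendsto_mult_right[OF rlim, of t]] by simp
    ultimately have "(\<lambda>n. f (of_real (r n * t))) \<longlonglongrightarrow> f (of_real t)"
      by (rule isCont_tendsto_compose)
    then have "(\<lambda>n. ennreal (cmod (f (of_real (r n * t))))) \<longlonglongrightarrow> ennreal (cmod (f (of_real t)))"
      by (intro tendsto_intros)
    then show "ennreal (cmod (f (of_real t))) = liminf (\<lambda>n. ennreal (cmod (f (of_real (r n * t)))))"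
      by (rule lim_imp_Liminf[OF trivial_limit_sequentially, symmetric])
  qed
  also have "\<dots> \<le> liminf (\<lambda>n. \<integral>\<^sup>+t. ennreal (cmod (f (of_real (r n * t)))) \<partial>M)"
    using fr r by (intro nn_integral_liminf) (auto simp: less_imp_le)
  also have "\<dots> \<le> ennreal (32 * K * H1_norm f)"
    using dil r by (intro Liminf_le) (auto intro!: always_eventually)
  finally show ?thesis .
qed

section \<open>Weighted measures\<close>

text \<open>The measure with density \<open>w\<close> on \<open>S\<close>, as a Borel measure on \<open>S\<close>.  The density is only assumed to
  be Lebesgue measurable; restricting the measurable sets to the Borel sets makes Fubini's theorem
  applicable without completing product measures.\<close>

definition weighted_measure :: "'a::euclidean_space set \<Rightarrow> ('a \<Rightarrow> real) \<Rightarrow> 'a measure" where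
  "weighted_measure S w =
     distr (density (restrict_space lebesgue S) (\<lambda>t. ennreal (w t))) (restrict_space borel S) (\<lambda>t. t)"

lemma sets_weighted_measure [simp, measurable_cong]: "sets (weighted_measure S w) = sets (restrict_space borel S)"
  and space_weighted_measure [simp]: "space (weighted_measure S w) = S"
  by (simp_all add: weighted_measure_def space_restrict_space)

lemma measurable_weighted_measure: "measurable (weighted_measure S w) N = measurable (restrict_space borel S) N"
  by (rule measurable_cong_sets) auto

lemma measurable_restrict_borel_lebesgue:
  "(\<lambda>t. t) \<in> restrict_space lebesgue S \<rightarrow>\<^sub>M restrict_space borel (S::'a::euclidean_space set)"
  by (intro measurable_restrict_space2 measurable_restrict_space1)
     (auto simp: space_restrict_space intro!: measurable_completion)

lemma measurable_restrict_lebesgue: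
  "g \<in> measurable (restrict_space borel (S::'a::euclidean_space set)) N \<Longrightarrow> g \<in> measurable (restrict_space lebesgue S) N"
  by (rule measurable_compose[OF measurable_restrict_borel_lebesgue])

lemma nn_integral_weighted_measure:
  assumes w: "w \<in> borel_measurable (restrict_space lebesgue S)" and S: "S \<in> sets borel"
    and g: "g \<in> borel_measurable (restrict_space borel S)"
  shows "(\<integral>\<^sup>+t. g t \<partial>weighted_measure S w) = (\<integral>\<^sup>+t\<in>S. ennreal (w t) * g t \<partial>lebesgue)"
proof -
  note [measurable] = w measurable_restrict_lebesgue[OF g] measurable_restrict_borel_lebesgue
  have "(\<integral>\<^sup>+t. g t \<partial>weighted_measure S w) = (\<integral>\<^sup>+t. g t \<partial>density (restrict_space lebesgue S) (\<lambda>t. ennreal (w t)))"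
    unfolding weighted_measure_def by (rule nn_integral_distr) (use g in auto)
  also have "\<dots> = (\<integral>\<^sup>+t. ennreal (w t) * g t \<partial>restrict_space lebesgue S)"
    by (rule nn_integral_density) auto
  also have "\<dots> = (\<integral>\<^sup>+t\<in>S. ennreal (w t) * g t \<partial>lebesgue)"
    using S by (intro nn_integral_restrict_space) auto
  finally show ?thesis .
qed

lemma weighted_measure_integral:
  fixes g :: "'a::euclidean_space \<Rightarrow> 'b::{banach, second_countable_topology}"
  assumes w: "w \<in> borel_measurable (restrict_space lebesgue S)" "\<And>t. t \<in> S \<Longrightarrow> 0 \<le> w t"
    and S: "S \<in> sets borel" and g: "g \<in> borel_measurable (restrict_space borel S)"
  shows "integrable (weighted_measure S w) g \<longleftrightarrow> set_integrable lebesgue S (\<lambda>t. w t *\<^sub>R g t)"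
    and "integral\<^sup>L (weighted_measure S w) g = (LINT t:S|lebesgue. w t *\<^sub>R g t)"
proof -
  note [measurable] = w(1) measurable_restrict_lebesgue[OF g] measurable_restrict_borel_lebesgue
  have ae: "AE t in restrict_space lebesgue S. 0 \<le> w t"
    using w(2) by (auto intro!: AE_I2 simp: space_restrict_space)
  have "integrable (weighted_measure S w) g \<longleftrightarrow> integrable (density (restrict_space lebesgue S) (\<lambda>t. ennreal (w t))) g"
    unfolding weighted_measure_def by (rule integrable_distr_eq) (use g in auto)
  also have "\<dots> \<longleftrightarrow> integrable (restrict_space lebesgue S) (\<lambda>t. w t *\<^sub>R g t)"
    using ae by (intro integrable_density) auto
  also have "\<dots> \<longleftrightarrow> set_integrable lebesgue S (\<lambda>t. w t *\<^sub>R g t)"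
    using S by (simp add: integrable_restrict_space set_integrable_def)
  finally show "integrable (weighted_measure S w) g \<longleftrightarrow> set_integrable lebesgue S (\<lambda>t. w t *\<^sub>R g t)" .
  have "integral\<^sup>L (weighted_measure S w) g = integral\<^sup>L (density (restrict_space lebesgue S) (\<lambda>t. ennreal (w t))) g"
    unfolding weighted_measure_def by (rule integral_distr) (use g in auto)
  also have "\<dots> = integral\<^sup>L (restrict_space lebesgue S) (\<lambda>t. w t *\<^sub>R g t)"
    using ae by (intro integral_density) auto
  also have "\<dots> = (LINT t:S|lebesgue. w t *\<^sub>R g t)"
    using S by (simp add: integral_restrict_space set_lebesgue_integral_def)
  finally show "integral\<^sup>L (weighted_measure S w) g = (LINT t:S|lebesgue. w t *\<^sub>R g t)" .
qed

abbreviation radial_measure :: "(real \<Rightarrow> real) \<Rightarrow> real measure" where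
  "radial_measure \<equiv> weighted_measure {0..<1}"

lemma emeasure_radial_measure_tail:
  assumes w: "w \<in> borel_measurable (restrict_space lebesgue {0..<1})" and a: "0 \<le> a"
  shows "emeasure (radial_measure w) {a..<1} = (\<integral>\<^sup>+t\<in>{a..<1}. ennreal (w t) \<partial>lebesgue)"
proof -
  have s: "{a..<1} \<in> sets (restrict_space borel {0..<1})"
    using a by (auto simp: sets_restrict_space_iff)
  then have "emeasure (radial_measure w) {a..<1} = (\<integral>\<^sup>+t. indicator {a..<1} t \<partial>radial_measure w)"
    by simp
  also have "\<dots> = (\<integral>\<^sup>+t\<in>{0..<1}. ennreal (w t) * indicator {a..<1} t \<partial>lebesgue)"
    by (rule nn_integral_weighted_measure[OF w]) (use s in auto)
  also have "\<dots> = (\<integral>\<^sup>+t\<in>{a..<1}. ennreal (w t) \<partial>lebesgue)"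
    using a by (intro nn_integral_cong) (auto split: split_indicator)
  finally show ?thesis .
qed

section \<open>Moments of radial weights\<close>

locale disc_weight =
  fixes \<omega> :: "real \<Rightarrow> real"
  assumes radial: "radial_weight \<omega>"
begin

abbreviation "\<nu> \<equiv> radial_measure \<omega>"
abbreviation "W \<equiv> weight_hat \<omega>"

definition mom :: "nat \<Rightarrow> real" where
  "mom n = (\<integral>t. t ^ n \<partial>\<nu>)"

lemma weight_nonneg: "t \<in> {0..<1} \<Longrightarrow> 0 \<le> \<omega> t"
  using radial by (auto simp: radial_weight_def)

lemma weight_integrable: "set_integrable lebesgue {0..<1} \<omega>"
  using radial by (auto simp: radial_weight_def)

lemma weight_measurable: "\<omega> \<in> borel_measurable (restrict_space lebesgue {0..<1})"
proof -
  have "integrable (restrict_space lebesgue {0..<1}) \<omega>"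
    using weight_integrable by (simp add: integrable_restrict_space set_integrable_def)
  then show ?thesis by auto
qed

lemmas integral_nu = weighted_measure_integral[OF weight_measurable weight_nonneg atLeastLessThan_borel]

sublocale nu: finite_measure \<nu>
proof
  have "integrable \<nu> (\<lambda>_. 1::real)"
    by (subst integral_nu) (use weight_integrable in auto)
  then have "emeasure \<nu> (space \<nu>) < \<infinity>"
    unfolding integrable_iff_bounded by simp
  then show "emeasure \<nu> (space \<nu>) \<noteq> \<infinity>" by simp
qed

lemma measurable_ident_nu [measurable]: "(\<lambda>t. t) \<in> borel_measurable \<nu>"
  by (auto simp: measurable_weighted_measure intro!: measurable_restrict_space1)

lemma measurable_borel_nu: "g \<in> measurable borel N \<Longrightarrow> g \<in> measurable \<nu> N"
  using measurable_compose[OF measurable_ident_nu] by simp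

lemma integrable_nu_bounded:
  fixes g :: "real \<Rightarrow> 'a::{banach, second_countable_topology}"
  assumes "g \<in> borel_measurable \<nu>" "\<And>t. t \<in> {0..<1} \<Longrightarrow> norm (g t) \<le> B"
  shows "integrable \<nu> g"
  by (rule nu.integrable_const_bound[where B = B]) (use assms in \<open>auto intro!: AE_I2\<close>)

lemma tail_sets [measurable]: "0 \<le> a \<Longrightarrow> {a..<1} \<in> sets \<nu>"
  by (auto simp: sets_restrict_space_iff)

lemma weight_hat_eq: 
  assumes a: "0 \<le> a"
  shows "W a = measure \<nu> {a..<1}"
proof -
  have "measure \<nu> {a..<1} = (\<integral>t. indicator {a..<1} t \<partial>\<nu>)"
    using tail_sets[OF a] a by (simp add: max_def)
  also have "\<dots> = (LINT t:{0..<1}|lebesgue. \<omega> t *\<^sub>R indicator {a..<1} t)"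
    by (rule integral_nu) (use a in \<open>auto simp: sets_restrict_space_iff intro!: borel_measurable_indicator\<close>)
  also have "\<dots> = W a"
    unfolding weight_hat_def set_lebesgue_integral_def using a
    by (intro Bochner_Integration.integral_cong) (auto split: split_indicator)
  finally show ?thesis by simp
qed

lemma emeasure_tail: "0 \<le> a \<Longrightarrow> emeasure \<nu> {a..<1} = ennreal (W a)"
  by (simp add: weight_hat_eq nu.emeasure_eq_measure)

lemma weight_hat_pos: "0 \<le> a \<Longrightarrow> a < 1 \<Longrightarrow> 0 < W a"
  using radial by (auto simp: radial_weight_def)

lemma weight_hat_antimono: "0 \<le> a \<Longrightarrow> a \<le> b \<Longrightarrow> W b \<le> W a"
  using nu.finite_measure_mono[OF _ tail_sets[of a], of "{b..<1}"] by (simp add: weight_hat_eq)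

lemma integrable_power: "integrable \<nu> (\<lambda>t. t ^ n)"
  by (rule integrable_nu_bounded[where B = 1])
     (auto intro!: measurable_borel_nu simp: power_le_one)

lemma mom_lower: assumes a: "0 \<le> a" shows "a ^ n * W a \<le> mom n"
proof -
  have "a ^ n * W a = (\<integral>t. a ^ n * indicator {a..<1} t \<partial>\<nu>)"
    using tail_sets[OF a] by (simp add: weight_hat_eq a)
  also have "\<dots> \<le> mom n"
    unfolding mom_def
    by (intro integral_mono integrable_power integrable_mult_right)
       (use a tail_sets[OF a] in \<open>auto simp: nu.emeasure_eq_measure split: split_indicator intro!: power_mono\<close>)
  finally show ?thesis .
qed

lemma mom_pos: "0 < mom n"
proof -
  have "0 < (1/2)^n * W (1/2)" using weight_hat_pos[of "1/2"] by simp
  also have "\<dots> \<le> mom n" by (rule mom_lower) simp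
  finally show ?thesis .
qed

lemma mom_antimono: assumes "m \<le> n" shows "mom n \<le> mom m"
  unfolding mom_def using assms
  by (intro integral_mono integrable_power) (auto intro!: power_decreasing)

text \<open>Convexity of the moments in steps of two, from \<open>t\<^sup>n (1 - t\<^sup>2)\<^sup>2 \<ge> 0\<close>.\<close>

lemma mom_second_difference: "mom (n + 2) - mom (n + 4) \<le> mom n - mom (n + 2)"
proof -
  have "mom (n + 2) - mom (n + 4) = (\<integral>t. t^(n+2) - t^(n+4) \<partial>\<nu>)"
    unfolding mom_def by (rule Bochner_Integration.integral_diff[symmetric]) (rule integrable_power)+
  also have "\<dots> \<le> (\<integral>t. t^n - t^(n+2) \<partial>\<nu>)"
  proof (intro integral_mono Bochner_Integration.integrable_diff integrable_power)
    fix t :: real assume "t \<in> space \<nu>"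
    then have t: "0 \<le> t" "t \<le> 1" by auto
    then have "t^2 \<le> 1" by (simp add: power_le_one)
    then have "0 \<le> t^n * (1 - t^2)^2" using t by simp
    also have "\<dots> = (t^n - t^(n+2)) - (t^(n+2) - t^(n+4))"
      by (simp add: power_add power2_eq_square algebra_simps eval_nat_numeral)
    finally show "t^(n+2) - t^(n+4) \<le> t^n - t^(n+2)" by simp
  qed
  also have "\<dots> = mom n - mom (n + 2)"
    unfolding mom_def by (rule Bochner_Integration.integral_diff) (rule integrable_power)+
  finally show ?thesis .
qed

text \<open>The layer-cake formula for the function \<open>max 0 (c t - (c - 1)) ^ n\<close>.  It is the moment of order \<open>n\<close> for
  \<open>c = 1\<close>; for \<open>c = 2\<close> the tails start at \<open>(s + 1) / 2\<close>, as on the right-hand side of the doubling condition.\<close>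

lemma nn_integral_power_layers:
  assumes n: "0 < n" and c: "1 \<le> c"
  shows "(\<integral>\<^sup>+t. ennreal (max 0 (c * t - (c - 1)) ^ n) \<partial>\<nu>) =
    (\<integral>\<^sup>+s\<in>{0..<1}. ennreal (real n * s ^ (n - 1)) * emeasure \<nu> {(s + (c - 1)) / c..<1} \<partial>lborel)"
proof -
  have [measurable]: "fst \<in> borel_measurable (\<nu> \<Otimes>\<^sub>M lborel)"
    using measurable_compose[OF measurable_fst measurable_ident_nu] by simp
  interpret P: pair_sigma_finite \<nu> lborel ..
  let ?h = "\<lambda>t s. ennreal (real n * s ^ (n - 1)) * (if 0 \<le> s \<and> s \<le> c * t - (c - 1) then 1 else 0)"
  have "ennreal (max 0 (c * t - (c - 1)) ^ n) = (\<integral>\<^sup>+s. ?h t s \<partial>lborel)" for t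
  proof -
    have "(\<integral>\<^sup>+s. ?h t s \<partial>lborel) =
        (\<integral>\<^sup>+s. ennreal (real n * s ^ (n - 1)) * indicator {0..max 0 (c * t - (c - 1))} s \<partial>lborel)"
    proof (rule nn_integral_cong_AE)
      have "AE s in lborel. s \<noteq> (0::real)" by (rule AE_lborel_singleton)
      then show "AE s in lborel. ?h t s = ennreal (real n * s ^ (n - 1)) * indicator {0..max 0 (c * t - (c - 1))} s"
        by eventually_elim (auto split: split_indicator)
    qed
    also have "\<dots> = ennreal (max 0 (c * t - (c - 1)) ^ n - 0 ^ n)"
      by (rule nn_integral_FTC_Icc) (auto intro!: derivative_eq_intros)
    finally show ?thesis using n by simp
  qed
  then have "(\<integral>\<^sup>+t. ennreal (max 0 (c * t - (c - 1)) ^ n) \<partial>\<nu>) = (\<integral>\<^sup>+t. (\<integral>\<^sup>+s. ?h t s \<partial>lborel) \<partial>\<nu>)"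
    by simp
  also have "\<dots> = (\<integral>\<^sup>+s. (\<integral>\<^sup>+t. ?h t s \<partial>\<nu>) \<partial>lborel)"
    by (rule P.Fubini'[symmetric]) (simp add: case_prod_beta, measurable)
  also have "\<dots> = (\<integral>\<^sup>+s\<in>{0..<1}. ennreal (real n * s ^ (n - 1)) * emeasure \<nu> {(s + (c - 1)) / c..<1} \<partial>lborel)"
  proof (rule nn_integral_cong)
    fix s :: real
    show "(\<integral>\<^sup>+t. ?h t s \<partial>\<nu>) = ennreal (real n * s ^ (n - 1)) * emeasure \<nu> {(s + (c - 1)) / c..<1} * indicator {0..<1} s"
    proof (cases "s \<in> {0..<1}")
      case True
      then have s: "{(s + (c - 1)) / c..<1} \<in> sets \<nu>" using c by (intro tail_sets) auto
      have "(\<integral>\<^sup>+t. ?h t s \<partial>\<nu>) = (\<integral>\<^sup>+t. ennreal (real n * s ^ (n - 1)) * indicator {(s + (c - 1)) / c..<1} t \<partial>\<nu>)"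
        by (rule nn_integral_cong) (use True c in \<open>auto split: split_indicator simp: field_simps\<close>)
      also have "\<dots> = ennreal (real n * s ^ (n - 1)) * emeasure \<nu> {(s + (c - 1)) / c..<1}"
        using s by (simp add: nn_integral_cmult)
      finally show ?thesis using True by simp
    next
      case False
      have "c * t < c" if "t < 1" for t using c that by simp
      then have "?h t s = 0" if "t \<in> space \<nu>" for t using False that by force
      then have "(\<integral>\<^sup>+t. ?h t s \<partial>\<nu>) = (\<integral>\<^sup>+t. 0 \<partial>\<nu>)" by (intro nn_integral_cong)
      then show ?thesis using False by simp
    qed
  qed
  finally show ?thesis .
qed

end

locale doubling_weight = disc_weight +
  fixes K :: real
  assumes K_ge_1: "1 \<le> K"
    and doubling: "\<And>r. r \<in> {0..<1} \<Longrightarrow> W r \<le> K * W ((1 + r) / 2)"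
begin

text \<open>In the layer-cake formula the doubling condition replaces \<open>t ^ n\<close> by \<open>(max 0 (2 * t - 1)) ^ n\<close>, which is at
  most \<open>t ^ (2 * n)\<close> because \<open>2 * t - 1 \<le> t\<^sup>2\<close>.\<close>

lemma mom_doubling:
  assumes n: "0 < n"
  shows "mom n \<le> K * mom (2 * n)"
proof -
  have "ennreal (mom n) = (\<integral>\<^sup>+t. ennreal (t ^ n) \<partial>\<nu>)"
    unfolding mom_def using integrable_power by (intro nn_integral_eq_integral[symmetric]) auto
  also have "\<dots> = (\<integral>\<^sup>+t. ennreal (max 0 (1 * t - (1 - 1)) ^ n) \<partial>\<nu>)"
    by (intro nn_integral_cong) auto
  also have "\<dots> = (\<integral>\<^sup>+s\<in>{0..<1}. ennreal (real n * s ^ (n - 1)) * emeasure \<nu> {(s + (1 - 1)) / 1..<1} \<partial>lborel)"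
    by (rule nn_integral_power_layers[OF n]) simp
  also have "\<dots> \<le> (\<integral>\<^sup>+s. ennreal K * (ennreal (real n * s ^ (n - 1)) * emeasure \<nu> {(s + (2 - 1)) / 2..<1} * indicator {0..<1} s) \<partial>lborel)"
  proof (rule nn_integral_mono)
    fix s :: real
    have "emeasure \<nu> {s..<1} \<le> ennreal K * emeasure \<nu> {(s + 1) / 2..<1}" if "s \<in> {0..<1}"
      using doubling[OF that] that K_ge_1 weight_hat_pos[of "(s+1)/2"]
      by (subst (1 2) emeasure_tail) (auto simp: ennreal_mult'[symmetric] add.commute intro!: ennreal_leI)
    then show "ennreal (real n * s ^ (n - 1)) * emeasure \<nu> {(s + (1 - 1)) / 1..<1} * indicator {0..<1} s
      \<le> ennreal K * (ennreal (real n * s ^ (n - 1)) * emeasure \<nu> {(s + (2 - 1)) / 2..<1} * indicator {0..<1} s)"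
      using mult_left_mono[of "emeasure \<nu> {s..<1}" "ennreal K * emeasure \<nu> {(s + 1) / 2..<1}" "ennreal (real n * s ^ (n - 1))"]
      by (auto split: split_indicator simp: mult.left_commute)
  qed
  also have "\<dots> = ennreal K * (\<integral>\<^sup>+s\<in>{0..<1}. ennreal (real n * s ^ (n - 1)) * emeasure \<nu> {(s + (2 - 1)) / 2..<1} \<partial>lborel)"
  proof (rule nn_integral_cmult)
    have "(\<lambda>s. ennreal (real n * s ^ (n - 1)) * emeasure \<nu> {(s + (2 - 1)) / 2..<1} * indicator {0..<1} s) =
      (\<lambda>s. ennreal (real n * s ^ (n - 1)) * ennreal (measure \<nu> {(s + 1) / 2..<1}) * indicator {0..<1} s)"
      by (auto simp: nu.emeasure_eq_measure)
    moreover have "(\<lambda>s. measure \<nu> {max 0 ((s + 1) / 2)..<1}) \<in> borel_measurable borel"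
    proof -
      have "mono (\<lambda>s. - measure \<nu> {max 0 ((s + 1) / 2)..<1})"
        by (intro monoI) (auto intro!: nu.finite_measure_mono simp: sets_restrict_space_iff)
      from borel_measurable_uminus[OF borel_measurable_mono[OF this]] show ?thesis by simp
    qed
    then have "(\<lambda>s. ennreal (real n * s ^ (n - 1)) * ennreal (measure \<nu> {max 0 ((s + 1) / 2)..<1}) * indicator {0..<1} s) \<in> borel_measurable lborel"
      by simp
    moreover have "(\<lambda>s. ennreal (real n * s ^ (n - 1)) * ennreal (measure \<nu> {max 0 ((s + 1) / 2)..<1}) * indicator {0..<1} s) =
       (\<lambda>s. ennreal (real n * s ^ (n - 1)) * ennreal (measure \<nu> {(s + 1) / 2..<1}) * indicator {0..<1} s)"
      by (auto split: split_indicator)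
    ultimately show "(\<lambda>s. ennreal (real n * s ^ (n - 1)) * emeasure \<nu> {(s + (2 - 1)) / 2..<1} * indicator {0..<1} s) \<in> borel_measurable lborel"
      by simp
  qed
  also have "\<dots> = ennreal K * (\<integral>\<^sup>+t. ennreal (max 0 (2 * t - (2 - 1)) ^ n) \<partial>\<nu>)"
    by (subst nn_integral_power_layers[OF n]) simp_all
  also have "\<dots> \<le> ennreal K * (\<integral>\<^sup>+t. ennreal (t ^ (2 * n)) \<partial>\<nu>)"
  proof (intro mult_left_mono nn_integral_mono ennreal_leI)
    fix t assume "t \<in> space \<nu>"
    have "0 \<le> (t - 1)^2" by simp
    then have "max 0 (2 * t - (2 - 1)) \<le> t^2" by (auto simp: power2_eq_square algebra_simps)
    then show "max 0 (2 * t - (2 - 1)) ^ n \<le> t ^ (2 * n)"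
      unfolding power_mult by (intro power_mono) auto
  qed simp
  also have "(\<integral>\<^sup>+t. ennreal (t ^ (2 * n)) \<partial>\<nu>) = ennreal (mom (2 * n))"
    unfolding mom_def using integrable_power by (intro nn_integral_eq_integral) auto
  also have "ennreal K * ennreal (mom (2 * n)) = ennreal (K * mom (2 * n))"
    using K_ge_1 by (simp add: ennreal_mult')
  finally show ?thesis
    using K_ge_1 mom_pos[of "2 * n"] by (simp add: ennreal_le_iff)
qed

lemma mom_doubling_power:
  assumes n: "0 < n"
  shows "mom n \<le> K ^ k * mom (2 ^ k * n)"
proof (induction k)
  case (Suc k)
  have "mom n \<le> K ^ k * mom (2 ^ k * n)" by (rule Suc)
  also have "\<dots> \<le> K ^ k * (K * mom (2 * (2 ^ k * n)))"
    using K_ge_1 n by (intro mult_left_mono mom_doubling) auto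
  finally show ?case by (simp add: mult_ac)
qed simp

lemma mom_le_mom_doubled: 
  assumes "0 < n" "m \<le> 2 * n" shows "mom n \<le> K * mom m"
proof -
  have "mom n \<le> K * mom (2 * n)" by (rule mom_doubling) fact
  also have "\<dots> \<le> K * mom m" using assms K_ge_1 by (intro mult_left_mono mom_antimono) auto
  finally show ?thesis .
qed

text \<open>The differences \<open>mom (2 * n - 1) - mom (2 * n + 1)\<close> decrease in \<open>n\<close>, so that the last of them is at
  most the average of those with index between \<open>n / 2\<close> and \<open>n\<close>; the sum of the latter telescopes, and is at most
  a moment of about half the order.\<close>

lemma mom_difference_bound:
  assumes n: "0 < n"
  shows "real (n + 1) * (mom (2 * n - 1) - mom (2 * n + 1)) \<le> 4 * K * mom (2 * n - 1)"
proof -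
  define m where "m k = mom (2 * k + 1)" for k
  have dec1: "m (Suc k) - m (Suc (Suc k)) \<le> m k - m (Suc k)" for k
    using mom_second_difference[of "2 * k + 1"] by (simp add: m_def numeral_eq_Suc)
  have dec: "m q - m (Suc q) \<le> m p - m (Suc p)" if "p \<le> q" for p q
    using lift_Suc_antimono_le[of "\<lambda>k. m k - m (Suc k)", OF dec1 that] .
  define j where "j = n div 2"
  have tel: "(\<Sum>k=j..<n. m k - m (Suc k)) = m j - m n"
    using sum_Suc_diff'[of j n "\<lambda>k. - m k"] by (simp add: j_def)
  have nj: "real (n + 1) \<le> 4 * real (n - j)" using n by (simp add: j_def of_nat_diff)
  have e: "m (n - 1) - m n = mom (2 * n - 1) - mom (2 * n + 1)"
    using n by (auto simp: m_def algebra_simps numeral_eq_Suc gr0_conv_Suc)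
  have nn: "0 \<le> m (n - 1) - m n" unfolding m_def using n by (auto intro!: mom_antimono)
  have "real (n + 1) * (m (n - 1) - m n) \<le> 4 * (real (n - j) * (m (n - 1) - m n))"
    using mult_right_mono[OF nj nn] by simp
  also have "real (n - j) * (m (n - 1) - m n) \<le> (\<Sum>k=j..<n. m k - m (Suc k))"
  proof -
    have "m (n - 1) - m n \<le> m k - m (Suc k)" if "k \<in> {j..<n}" for k
      using dec[of k "n - 1"] that n by auto
    then have "(\<Sum>k=j..<n. m (n - 1) - m n) \<le> (\<Sum>k=j..<n. m k - m (Suc k))"
      by (rule sum_mono)
    then show ?thesis by simp
  qed
  also have "\<dots> \<le> m j" using mom_pos[of "2 * n + 1"] unfolding tel by (simp add: m_def)
  also have "m j \<le> K * mom (2 * n - 1)"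
    unfolding m_def by (rule mom_le_mom_doubled) (auto simp: j_def)
  finally show ?thesis by (simp add: e[simplified])
qed

text \<open>Let \<open>x = 2 n + 1\<close> and \<open>a = 1 - 1 / (n + 1)\<close>.  Doubling \<open>k\<close> times bounds \<open>mom x\<close> by \<open>K ^ k * mom (2 ^ k * x)\<close>.
  The part of the last moment over \<open>[a,1)\<close> is at most \<open>W a\<close>, and the part below \<open>a\<close> is at most
  \<open>exp (1 - 2 ^ k) * mom x\<close>, which can be absorbed on the left when \<open>k\<close> is large.\<close>

lemma mom_upper:
  obtains C where "1 \<le> C" "\<And>n. mom (2 * n + 1) \<le> C * W (1 - 1 / real (n + 1))"
proof -
  have "((\<lambda>x::real. x powr log 2 K * exp (1 - x)) \<longlongrightarrow> 0) at_top"
    by real_asymp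
  then have "eventually (\<lambda>x::real. x powr log 2 K * exp (1 - x) < 1/2) at_top"
    by (rule order_tendstoD) simp
  moreover have "filterlim (\<lambda>k::nat. 2 ^ k :: real) at_top at_top" by real_asymp
  ultimately have "eventually (\<lambda>k::nat. (2 ^ k) powr log 2 K * exp (1 - 2 ^ k) < (1/2::real)) at_top"
    by (rule eventually_compose_filterlim)
  then obtain k :: nat where "(2 ^ k) powr log 2 K * exp (1 - 2 ^ k) < (1/2::real)"
    by (auto simp: eventually_at_top_linorder)
  moreover have "((2::real) ^ k) powr log 2 K = K ^ k"
  proof -
    have "((2::real) ^ k) powr log 2 K = (2 powr real k) powr log 2 K" by (simp add: powr_realpow)
    also have "\<dots> = (2 powr log 2 K) powr real k" by (simp add: powr_powr mult.commute)
    also have "\<dots> = K ^ k" using K_ge_1 by (simp add: powr_realpow)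
    finally show ?thesis .
  qed
  ultimately have k: "K ^ k * exp (1 - 2 ^ k) < (1/2::real)" by simp
  show ?thesis
  proof
    \<comment> \<open>The factor \<open>2\<close> comes from absorbing half of \<open>mom x\<close>.\<close>
    show "1 \<le> 2 * K ^ k" using K_ge_1 one_le_power[of K k] by linarith
    fix n :: nat
    define a where "a = 1 - 1 / real (n + 1)"
    define x where "x = 2 * n + 1"
    have a: "0 \<le> a" "a < 1" by (simp_all add: a_def field_simps)
    have ax: "a ^ x \<le> exp (-1)"
    proof -
      have "a \<le> exp (- (1 / real (n + 1)))" using exp_ge_add_one_self[of "- (1 / real (n + 1))"] by (simp add: a_def)
      then have "a ^ x \<le> exp (- (1 / real (n + 1))) ^ x" using a by (intro power_mono)
      also have "\<dots> = exp (- (real x / real (n + 1)))" by (simp flip: exp_of_nat_mult)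
      also have "\<dots> \<le> exp (-1)" by (simp add: x_def field_simps)
      finally show ?thesis .
    qed
    define p where "p = (2 ^ k - 1) * x"
    have px: "2 ^ k * x = p + x"
    proof -
      have "(2 ^ k - 1) * x + x = (2 ^ k - 1 + 1) * x" by (simp add: algebra_simps)
      then show ?thesis by (simp add: p_def)
    qed
    have ap: "a ^ p \<le> exp (1 - 2 ^ k)"
    proof -
      have "a ^ p = (a ^ x) ^ (2 ^ k - 1)" by (simp add: p_def mult.commute flip: power_mult)
      also have "\<dots> \<le> exp (-1) ^ (2 ^ k - 1)" using ax a by (intro power_mono) auto
      also have "\<dots> = exp (1 - 2 ^ k)" by (simp add: of_nat_diff flip: exp_of_nat_mult)
      finally show ?thesis .
    qed
    have "mom (2 ^ k * x) \<le> (\<integral>t. a ^ p * t ^ x + indicator {a..<1} t \<partial>\<nu>)"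
      unfolding mom_def
    proof (intro integral_mono integrable_power Bochner_Integration.integrable_add integrable_mult_right)
      show "integrable \<nu> (indicat_real {a..<1})" using tail_sets[OF a(1)] by (simp add: nu.emeasure_eq_measure)
      fix t assume "t \<in> space \<nu>"
      then have t: "0 \<le> t" "t < 1" by auto
      show "t ^ (2 ^ k * x) \<le> a ^ p * t ^ x + indicator {a..<1} t"
      proof (cases "a \<le> t")
        case True
        have "t ^ (2 ^ k * x) \<le> 1" using t by (simp add: power_le_one)
        moreover have "0 \<le> a ^ p * t ^ x" using a t by simp
        ultimately show ?thesis using True t by (simp add: indicator_def)
      next
        case False
        then have "t ^ p \<le> a ^ p" using t by (intro power_mono) auto
        then show ?thesis using False t by (simp add: px power_add mult_right_mono)
      qed
    qed
    also have "\<dots> = a ^ p * mom x + W a"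
      using tail_sets[OF a(1)] integrable_power[of x]
      by (subst Bochner_Integration.integral_add) (auto simp: mom_def weight_hat_eq a nu.emeasure_eq_measure)
    finally have "K ^ k * mom (2 ^ k * x) \<le> K ^ k * (a ^ p * mom x + W a)"
      using K_ge_1 by (intro mult_left_mono) auto
    moreover have "mom x \<le> K ^ k * mom (2 ^ k * x)" by (rule mom_doubling_power) (simp add: x_def)
    moreover have "K ^ k * (a ^ p * mom x) \<le> 1/2 * mom x"
    proof -
      have "K ^ k * a ^ p \<le> K ^ k * exp (1 - 2 ^ k)" using ap K_ge_1 by (intro mult_left_mono) auto
      then have "K ^ k * a ^ p \<le> 1/2" using k by simp
      then have "K ^ k * a ^ p * mom x \<le> 1/2 * mom x" using mom_pos[of x] by (intro mult_right_mono) auto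
      then show ?thesis by (simp add: mult.assoc)
    qed
    ultimately have "mom x \<le> 2 * K ^ k * W a" by (simp add: distrib_left)
    then show "mom (2 * n + 1) \<le> 2 * K ^ k * W (1 - 1 / real (n + 1))" by (simp add: x_def a_def)
  qed
qed

end

section \<open>Rotations and polar coordinates in the plane\<close>

text \<open>The image \<open>M\<close> of Lebesgue measure is translation invariant, too.  Translating once in each
variable of the product measure gives \<open>\<lambda>(A) M(B) = M(A) \<lambda>(B)\<close>, and the unit ball, whose two measures agree,
serves as \<open>B\<close>.\<close>

lemma distr_isometry_lborel:
  fixes T :: "'a::euclidean_space \<Rightarrow> 'a"
  assumes lin: "linear T" and iso: "\<And>x. norm (T x) = norm x"
  shows "distr lborel borel T = lborel"
proof -
  have contT: "continuous_on UNIV T"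
    using lin by (simp add: linear_continuous_on linear_conv_bounded_linear)
  have T[measurable]: "T \<in> borel_measurable borel"
    using contT by (rule borel_measurable_continuous_onI)
  have inj: "inj T"
    using lin iso by (metis linear_injective_0 norm_eq_zero)
  have surj: "surj T"
    using lin inj by (simp add: linear_injective_imp_surjective)
  define M where "M = distr lborel borel T"
  have sM[simp, measurable_cong]: "sets M = sets borel" and [simp]: "space M = UNIV"
    by (simp_all add: M_def)
  have meas[simp]: "measurable M N = measurable borel N" "measurable N M = measurable N borel"
    for N :: "'z measure" by (auto intro!: measurable_cong_sets)
  have ballM: "emeasure M (ball 0 r) = emeasure lborel (ball (0::'a) r)" for r
    by (simp add: M_def emeasure_distr vimage_def iso ball_def)
  interpret M: sigma_finite_measure M
  proof
    have "countable (range (\<lambda>n::nat. ball (0::'a) (real n)))" by simp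
    moreover have "\<Union>(range (\<lambda>n::nat. ball (0::'a) (real n))) = UNIV"
      by (auto intro: reals_Archimedean2)
    ultimately show "\<exists>A. countable A \<and> A \<subseteq> sets M \<and> \<Union>A = space M \<and> (\<forall>a\<in>A. emeasure M a \<noteq> \<infinity>)"
      by (intro exI[of _ "range (\<lambda>n::nat. ball (0::'a) (real n))"])
         (auto simp: ballM emeasure_ball)
  qed
  have transM: "distr M borel ((+) c) = M" for c
  proof -
    obtain d where d: "T d = c" using surj by (metis surjD)
    have "distr M borel ((+) c) = distr lborel borel (\<lambda>x. c + T x)"
      unfolding M_def by (subst distr_distr) (auto simp: comp_def)
    also have "(\<lambda>x. c + T x) = (\<lambda>x. T (d + x))" using lin d by (auto simp: linear_add)
    also have "distr lborel borel (\<lambda>x. T (d + x)) = distr (distr lborel borel ((+) d)) borel T"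
      by (subst distr_distr) (auto simp: comp_def)
    also have "\<dots> = M" by (simp add: lborel_distr_plus M_def)
    finally show ?thesis .
  qed
  interpret P: pair_sigma_finite lborel M ..
  have key: "emeasure lborel A * emeasure M B = emeasure M A * emeasure lborel B"
    if A[measurable]: "A \<in> sets borel" and B[measurable]: "B \<in> sets borel" for A B
  proof -
    have "emeasure M A * emeasure lborel B = (\<integral>\<^sup>+x. indicator A x * emeasure lborel B \<partial>M)"
      by (simp add: nn_integral_multc)
    also have "\<dots> = (\<integral>\<^sup>+x. indicator A x * (\<integral>\<^sup>+y. indicator B y \<partial>distr lborel borel ((+) x)) \<partial>M)"
      by (simp add: lborel_distr_plus)
    also have "\<dots> = (\<integral>\<^sup>+x. (\<integral>\<^sup>+y. indicator A x * indicator B (x + y) \<partial>lborel) \<partial>M)"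
      by (simp add: nn_integral_distr nn_integral_cmult del: nn_integral_indicator)
    also have "\<dots> = (\<integral>\<^sup>+y. (\<integral>\<^sup>+x. indicator A x * indicator B (x + y) \<partial>M) \<partial>lborel)"
      by (rule P.Fubini') simp
    also have "\<dots> = (\<integral>\<^sup>+y. (\<integral>\<^sup>+x. indicator A x * indicator B (x + y) \<partial>distr M borel ((+) (-y))) \<partial>lborel)"
      by (simp only: transM)
    also have "\<dots> = (\<integral>\<^sup>+y. (\<integral>\<^sup>+x. indicator A (x - y) * indicator B x \<partial>M) \<partial>lborel)"
      by (simp add: nn_integral_distr del: transM)
    also have "\<dots> = (\<integral>\<^sup>+x. (\<integral>\<^sup>+y. indicator A (x - y) * indicator B x \<partial>lborel) \<partial>M)"
      by (rule P.Fubini'[symmetric]) simp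
    also have "\<dots> = (\<integral>\<^sup>+x. (\<integral>\<^sup>+y. indicator A (x - y) \<partial>lborel) * indicator B x \<partial>M)"
      by (simp add: nn_integral_multc)
    also have "\<dots> = (\<integral>\<^sup>+x. emeasure lborel A * indicator B x \<partial>M)"
    proof (intro nn_integral_cong)
      fix x :: 'a
      have "(\<integral>\<^sup>+y. indicator A (x - y) \<partial>lborel) = (\<integral>\<^sup>+y. indicator A y \<partial>distr lborel borel (\<lambda>y. x + (-1) *\<^sub>R y))"
        by (subst nn_integral_distr) auto
      also have "distr lborel borel (\<lambda>y. x + (-1) *\<^sub>R y) = (lborel::'a measure)"
        using lborel_affine[of "-1" x] by (simp add: density_1)
      finally show "(\<integral>\<^sup>+y. indicator A (x - y) \<partial>lborel) * indicator B x = emeasure lborel A * indicator B x"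
        by simp
    qed
    also have "\<dots> = emeasure lborel A * emeasure M B" by (simp add: nn_integral_cmult)
    finally show ?thesis by simp
  qed
  show ?thesis unfolding M_def[symmetric]
  proof (rule measure_eqI)
    fix A assume "A \<in> sets M"
    then have A: "A \<in> sets borel" by simp
    have "emeasure M A * emeasure lborel (ball 0 1::'a set) = emeasure lborel A * emeasure lborel (ball 0 1::'a set)"
      using key[OF A, of "ball 0 1"] by (simp add: ballM)
    moreover have "emeasure lborel (ball 0 1::'a set) \<noteq> 0" "emeasure lborel (ball 0 1::'a set) \<noteq> \<infinity>"
      by (simp_all add: emeasure_ball ennreal_eq_0_iff not_le)
    ultimately show "emeasure M A = emeasure lborel A"
      by (metis mult.commute ennreal_mult_cancel_left infinity_ennreal_def)
  qed simp
qed

text \<open>Polar coordinates for radial functions; by the area \<open>\<pi> a\<^sup>2\<close> of discs, both sides agree on half-lines.\<close>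

lemma distr_cmod_lborel:
  "distr lborel borel cmod = density lborel (\<lambda>r. ennreal (2 * pi * r) * indicator {0..} r)"
  (is "_ = ?R")
proof (rule measure_eqI_generator_eq[where E = "range (\<lambda>a::real. {..a})" and A = "\<lambda>n. {..real n}" and \<Omega> = UNIV])
  show "Int_stable (range (\<lambda>a::real. {..a}))"
    by (auto simp: Int_stable_def intro!: range_eqI[of _ _ "min _ _"])
  show "sets (distr lborel borel cmod) = sigma_sets UNIV (range (\<lambda>a::real. {..a}))"
    "sets ?R = sigma_sets UNIV (range (\<lambda>a::real. {..a}))"
    by (simp_all add: borel_eq_atMost)
  have eq: "emeasure (distr lborel borel cmod) {..a} = ennreal (pi * (max 0 a)\<^sup>2)" for a
  proof -
    have "emeasure (distr lborel borel cmod) {..a} = emeasure lborel (cball (0::complex) a)"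
      by (auto simp: emeasure_distr cball_def vimage_def intro!: arg_cong[where f = "emeasure lborel"])
    also have "\<dots> = ennreal (pi * (max 0 a)\<^sup>2)"
      by (cases "0 \<le> a") (auto simp: emeasure_cball unit_ball_vol_2)
    finally show ?thesis .
  qed
  have eq2: "emeasure ?R {..a} = ennreal (pi * (max 0 a)\<^sup>2)" for a
  proof -
    have "emeasure ?R {..a} = (\<integral>\<^sup>+r. ennreal (2 * pi * r) * indicator {0..max 0 a} r \<partial>lborel)"
      by (auto simp: emeasure_density split: split_indicator intro!: nn_integral_cong)
    also have "\<dots> = ennreal (pi * (max 0 a)\<^sup>2 - pi * 0\<^sup>2)"
      by (rule nn_integral_FTC_Icc) (auto intro!: derivative_eq_intros)
    finally show ?thesis by simp
  qed
  show "emeasure (distr lborel borel cmod) X = emeasure ?R X" if "X \<in> range (\<lambda>a::real. {..a})" for X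
    using that eq eq2 by auto
  show "(\<Union>i. {..real i}) = UNIV" by (auto simp: real_arch_simple)
  show "emeasure (distr lborel borel cmod) {..real i} \<noteq> \<infinity>" for i by (simp add: eq)
qed auto

lemma cmod_null_sets:
  assumes "N \<in> null_sets lborel" shows "cmod -` N \<in> null_sets lborel"
proof -
  have [measurable]: "N \<in> sets borel" using assms by auto
  have "emeasure lborel (cmod -` N) = emeasure (distr lborel borel cmod) N"
    by (simp add: emeasure_distr)
  also have "\<dots> = (\<integral>\<^sup>+r. (ennreal (2 * pi * r) * indicator {0..} r) * indicator N r \<partial>lborel)"
    unfolding distr_cmod_lborel by (rule emeasure_density) auto
  also have "\<dots> = (\<integral>\<^sup>+(r::real). 0 \<partial>lborel)"
    using AE_not_in[OF assms] by (intro nn_integral_cong_AE) auto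
  finally show ?thesis
    using measurable_sets[of cmod borel borel N] by (auto simp: null_sets_def)
qed

lemma AE_lborel_cmod:
  assumes "AE r in lborel. P r" shows "AE z in lborel. P (cmod z)"
proof -
  obtain N where N: "N \<in> null_sets lborel" "{r. \<not> P r} \<subseteq> N"
    using assms by (auto elim!: AE_E simp: null_sets_def)
  show ?thesis
    by (rule AE_I'[OF cmod_null_sets[OF N(1)]]) (use N(2) in auto)
qed

section \<open>The weighted area measure\<close>

context disc_weight
begin

lemma weight_cmod_nonneg: "z \<in> unit_disc \<Longrightarrow> 0 \<le> \<omega> (cmod z)"
  by (rule weight_nonneg) auto

text \<open>Null sets of radii pull back to null sets of the plane, so that a Borel version of the weight
suffices for all integrals.\<close>

lemma weight_borel_representative:
  obtains w where "w \<in> borel_measurable borel" "\<And>r. 0 \<le> w r"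
    "AE r in lborel. r \<in> {0..<1} \<longrightarrow> \<omega> r = w r"
proof -
  have "(\<lambda>r. if r \<in> {0..<1} then \<omega> r else 0) \<in> borel_measurable lebesgue"
    using weight_measurable by (subst borel_measurable_if) auto
  then obtain w where w: "w \<in> borel_measurable lborel" "AE r in lborel. (if r \<in> {0..<1} then \<omega> r else 0) = w r"
    by (auto dest!: completion_ex_borel_measurable_real)
  show ?thesis
  proof
    show "(\<lambda>r. max 0 (w r)) \<in> borel_measurable borel" using w(1) by simp
    show "AE r in lborel. r \<in> {0..<1} \<longrightarrow> \<omega> r = max 0 (w r)"
      using w(2) by eventually_elim (metis weight_nonneg max_absorb2)
  qed auto
qed

lemma weight_cmod_measurable: "(\<lambda>z. \<omega> (cmod z)) \<in> borel_measurable (restrict_space lebesgue unit_disc)"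
proof -
  obtain w where w: "w \<in> borel_measurable borel" "\<And>r. 0 \<le> w r"
    "AE r in lborel. r \<in> {0..<1} \<longrightarrow> \<omega> r = w r" by (rule weight_borel_representative) blast
  have "(\<lambda>z. if z \<in> unit_disc then w (cmod z) else 0) \<in> borel_measurable lebesgue"
    using w(1) by (intro measurable_completion) simp
  moreover have "AE z in lebesgue. (if z \<in> unit_disc then w (cmod z) else 0) =
      (if z \<in> unit_disc then \<omega> (cmod z) else 0)"
    using AE_completion[OF AE_lborel_cmod[OF w(3)]] by eventually_elim auto
  ultimately have "(\<lambda>z. if z \<in> unit_disc then \<omega> (cmod z) else 0) \<in> borel_measurable lebesgue"
    by (rule borel_measurable_AE)
  then show ?thesis by (subst (asm) borel_measurable_if) auto
qed

definition area :: "complex measure" where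
  "area = weighted_measure unit_disc (\<lambda>z. \<omega> (cmod z))"

lemma sets_area [simp, measurable_cong]: "sets area = sets (restrict_space borel unit_disc)"
  and space_area [simp]: "space area = unit_disc"
  by (simp_all add: area_def)

lemma measurable_area: "measurable area N = measurable (restrict_space borel unit_disc) N"
  by (rule measurable_cong_sets) auto

lemma measurable_continuous_area:
  fixes g :: "complex \<Rightarrow> 'a::topological_space"
  shows "continuous_on unit_disc g \<Longrightarrow> g \<in> borel_measurable area"
  by (auto simp: measurable_area intro: borel_measurable_continuous_on_restrict)

lemmas integral_area = weighted_measure_integral[OF weight_cmod_measurable weight_cmod_nonneg open_ball[THEN borel_open],
    folded area_def measurable_area]

lemma nn_integral_area:
  obtains w where "w \<in> borel_measurable borel" "\<And>r. 0 \<le> w r"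
    "\<And>g. g \<in> borel_measurable area \<Longrightarrow>
      (\<integral>\<^sup>+z. g z \<partial>area) = (\<integral>\<^sup>+z. ennreal (w (cmod z)) * (g z * indicator unit_disc z) \<partial>lborel)"
    "\<And>g. g \<in> borel_measurable \<nu> \<Longrightarrow>
      (\<integral>\<^sup>+r. g r \<partial>\<nu>) = (\<integral>\<^sup>+r. ennreal (w r) * (g r * indicator {0..<1} r) \<partial>lborel)"
proof -
  obtain w where w: "w \<in> borel_measurable borel" "\<And>r. 0 \<le> w r"
    "AE r in lborel. r \<in> {0..<1} \<longrightarrow> \<omega> r = w r" by (rule weight_borel_representative) blast
  show ?thesis
  proof (rule that[OF w(1,2)])
    fix g :: "complex \<Rightarrow> ennreal" assume "g \<in> borel_measurable area"
    then have g: "g \<in> borel_measurable (restrict_space borel unit_disc)" by (simp add: measurable_area)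
    have "(\<integral>\<^sup>+z. g z \<partial>area) = (\<integral>\<^sup>+z\<in>unit_disc. ennreal (\<omega> (cmod z)) * g z \<partial>lebesgue)"
      unfolding area_def by (rule nn_integral_weighted_measure[OF weight_cmod_measurable _ g]) auto
    also have "\<dots> = (\<integral>\<^sup>+z. ennreal (w (cmod z)) * (g z * indicator unit_disc z) \<partial>lebesgue)"
    proof (rule nn_integral_cong_AE)
      show "AE z in lebesgue. ennreal (\<omega> (cmod z)) * g z * indicator unit_disc z =
          ennreal (w (cmod z)) * (g z * indicator unit_disc z)"
        using AE_completion[OF AE_lborel_cmod[OF w(3)]] by eventually_elim (auto split: split_indicator)
    qed
    also have "\<dots> = (\<integral>\<^sup>+z. ennreal (w (cmod z)) * (g z * indicator unit_disc z) \<partial>lborel)"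
      by (rule nn_integral_completion)
    finally show "(\<integral>\<^sup>+z. g z \<partial>area) = (\<integral>\<^sup>+z. ennreal (w (cmod z)) * (g z * indicator unit_disc z) \<partial>lborel)" .
  next
    fix g :: "real \<Rightarrow> ennreal" assume "g \<in> borel_measurable \<nu>"
    then have g: "g \<in> borel_measurable (restrict_space borel {0..<1})" by (simp add: measurable_weighted_measure)
    have "(\<integral>\<^sup>+r. g r \<partial>\<nu>) = (\<integral>\<^sup>+r\<in>{0..<1}. ennreal (\<omega> r) * g r \<partial>lebesgue)"
      by (rule nn_integral_weighted_measure[OF weight_measurable _ g]) auto
    also have "\<dots> = (\<integral>\<^sup>+r. ennreal (w r) * (g r * indicator {0..<1} r) \<partial>lebesgue)"
    proof (rule nn_integral_cong_AE)
      show "AE r in lebesgue. ennreal (\<omega> r) * g r * indicator {0..<1} r =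
          ennreal (w r) * (g r * indicator {0..<1} r)"
        using AE_completion[OF w(3)] by eventually_elim (auto split: split_indicator)
    qed
    also have "\<dots> = (\<integral>\<^sup>+r. ennreal (w r) * (g r * indicator {0..<1} r) \<partial>lborel)"
      by (rule nn_integral_completion)
    finally show "(\<integral>\<^sup>+r. g r \<partial>\<nu>) = (\<integral>\<^sup>+r. ennreal (w r) * (g r * indicator {0..<1} r) \<partial>lborel)" .
  qed
qed

lemma measurable_cmod_area: "cmod \<in> area \<rightarrow>\<^sub>M \<nu>"
  by (subst measurable_cong_sets[OF refl sets_weighted_measure])
     (auto intro!: measurable_restrict_space2 measurable_continuous_area continuous_intros)

lemma distr_cmod_area: "distr area \<nu> cmod = density \<nu> (\<lambda>r. ennreal (2 * pi * r))"
proof (rule measure_eqI)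
  fix A assume "A \<in> sets (distr area \<nu> cmod)"
  then have A: "A \<in> sets \<nu>" by simp
  then have Ab: "A \<in> sets borel" "A \<subseteq> {0..<1}" by (auto simp: sets_restrict_space)
  obtain w where w[measurable]: "w \<in> borel_measurable borel" and "\<And>r. 0 \<le> w r"
    and wa: "\<And>g. g \<in> borel_measurable area \<Longrightarrow>
      (\<integral>\<^sup>+z. g z \<partial>area) = (\<integral>\<^sup>+z. ennreal (w (cmod z)) * (g z * indicator unit_disc z) \<partial>lborel)"
    and wn: "\<And>g. g \<in> borel_measurable \<nu> \<Longrightarrow>
      (\<integral>\<^sup>+r. g r \<partial>\<nu>) = (\<integral>\<^sup>+r. ennreal (w r) * (g r * indicator {0..<1} r) \<partial>lborel)"
    by (rule nn_integral_area) blast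
  have m: "(\<lambda>r. ennreal (2 * pi * r)) \<in> borel_measurable \<nu>" by (rule measurable_borel_nu) simp
  have "emeasure (distr area \<nu> cmod) A = (\<integral>\<^sup>+r. indicator A r \<partial>distr area \<nu> cmod)"
    using A by simp
  also have "\<dots> = (\<integral>\<^sup>+z. indicator A (cmod z) \<partial>area)"
    using A by (intro nn_integral_distr measurable_cmod_area) auto
  also have "\<dots> = (\<integral>\<^sup>+z. ennreal (w (cmod z)) * (indicator A (cmod z) * indicator unit_disc z) \<partial>lborel)"
    using A by (intro wa measurable_compose[OF measurable_cmod_area]) auto
  also have "\<dots> = (\<integral>\<^sup>+z. ennreal (w (cmod z)) * indicator A (cmod z) \<partial>lborel)"
    using Ab(2) by (intro nn_integral_cong) (auto split: split_indicator)
  also have "\<dots> = (\<integral>\<^sup>+r. ennreal (w r) * indicator A r \<partial>distr lborel borel cmod)"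
    using Ab(1) by (subst nn_integral_distr) auto
  also have "\<dots> = (\<integral>\<^sup>+r. (ennreal (2 * pi * r) * indicator {0..} r) * (ennreal (w r) * indicator A r) \<partial>lborel)"
    unfolding distr_cmod_lborel using Ab(1) by (intro nn_integral_density) auto
  also have "\<dots> = (\<integral>\<^sup>+r. ennreal (w r) * (ennreal (2 * pi * r) * indicator A r * indicator {0..<1} r) \<partial>lborel)"
    using Ab(2) by (intro nn_integral_cong) (auto split: split_indicator simp: mult_ac)
  also have "\<dots> = (\<integral>\<^sup>+r. ennreal (2 * pi * r) * indicator A r \<partial>\<nu>)"
    using A m by (intro wn[symmetric]) auto
  also have "\<dots> = emeasure (density \<nu> (\<lambda>r. ennreal (2 * pi * r))) A"
    using A m by (intro emeasure_density[symmetric])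
  finally show "emeasure (distr area \<nu> cmod) A = emeasure (density \<nu> (\<lambda>r. ennreal (2 * pi * r))) A" .
qed simp

lemma distr_rotation_area:
  assumes c: "cmod c = 1"
  shows "(\<lambda>z. c * z) \<in> area \<rightarrow>\<^sub>M area" and "distr area area (\<lambda>z. c * z) = area"
proof -
  show m: "(\<lambda>z. c * z) \<in> area \<rightarrow>\<^sub>M area"
    by (subst measurable_cong_sets[OF refl sets_area])
       (auto intro!: measurable_restrict_space2 measurable_continuous_area continuous_intros simp: norm_mult c)
  show "distr area area (\<lambda>z. c * z) = area"
  proof (rule measure_eqI)
    fix A assume "A \<in> sets (distr area area (\<lambda>z. c * z))"
    then have A: "A \<in> sets area" by simp
    then have Ab[measurable]: "A \<in> sets borel" and As: "A \<subseteq> unit_disc" by (auto simp: sets_restrict_space)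
    obtain w where w[measurable]: "w \<in> borel_measurable borel" and "\<And>r. 0 \<le> w r"
      and wa: "\<And>g. g \<in> borel_measurable area \<Longrightarrow>
        (\<integral>\<^sup>+z. g z \<partial>area) = (\<integral>\<^sup>+z. ennreal (w (cmod z)) * (g z * indicator unit_disc z) \<partial>lborel)"
      by (rule nn_integral_area) blast
    have "emeasure (distr area area (\<lambda>z. c * z)) A = (\<integral>\<^sup>+z. indicator A z \<partial>distr area area (\<lambda>z. c * z))"
      using A by simp
    also have "\<dots> = (\<integral>\<^sup>+z. indicator A (c * z) \<partial>area)"
      using A by (intro nn_integral_distr m) auto
    also have "\<dots> = (\<integral>\<^sup>+z. ennreal (w (cmod z)) * (indicator A (c * z) * indicator unit_disc z) \<partial>lborel)"
      using A by (intro wa measurable_compose[OF m]) auto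
    also have "\<dots> = (\<integral>\<^sup>+z. ennreal (w (cmod (c * z))) * indicator A (c * z) \<partial>lborel)"
    proof (rule nn_integral_cong)
      fix z
      have "z \<in> unit_disc" if "c * z \<in> A" using that As c by (auto simp: norm_mult)
      then show "ennreal (w (cmod z)) * (indicator A (c * z) * indicator unit_disc z) =
          ennreal (w (cmod (c * z))) * indicator A (c * z)"
        by (auto split: split_indicator simp: norm_mult c)
    qed
    also have "\<dots> = (\<integral>\<^sup>+z. ennreal (w (cmod z)) * indicator A z \<partial>distr lborel borel (\<lambda>z. c * z))"
      by (subst nn_integral_distr) auto
    also have "distr lborel borel (\<lambda>z. c * z) = (lborel :: complex measure)"
      by (rule distr_isometry_lborel) (auto simp: norm_mult c linear_times)
    also have "(\<integral>\<^sup>+z. ennreal (w (cmod z)) * indicator A z \<partial>lborel) =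
        (\<integral>\<^sup>+z. ennreal (w (cmod z)) * (indicator A z * indicator unit_disc z) \<partial>lborel)"
      using As by (intro nn_integral_cong) (auto split: split_indicator)
    also have "\<dots> = (\<integral>\<^sup>+z. indicator A z \<partial>area)"
      using A by (intro wa[symmetric]) auto
    also have "\<dots> = emeasure area A" using A by simp
    finally show "emeasure (distr area area (\<lambda>z. c * z)) A = emeasure area A" .
  qed simp
qed

lemma integral_radial_area:
  fixes g :: "real \<Rightarrow> real"
  assumes g: "g \<in> borel_measurable \<nu>"
  shows "(\<integral>z. g (cmod z) \<partial>area) = 2 * pi * (\<integral>r. r * g r \<partial>\<nu>)"
proof -
  have "(\<integral>z. g (cmod z) \<partial>area) = integral\<^sup>L (distr area \<nu> cmod) g"
    by (rule integral_distr[symmetric]) (use g measurable_cmod_area in auto)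
  also have "\<dots> = (\<integral>r. (2 * pi * r) *\<^sub>R g r \<partial>\<nu>)"
    unfolding distr_cmod_area using g
    by (intro integral_density) (auto intro!: AE_I2 measurable_borel_nu)
  also have "\<dots> = (\<integral>r. 2 * pi * (r * g r) \<partial>\<nu>)" by (simp add: mult.assoc)
  finally show ?thesis by simp
qed

sublocale area: finite_measure area
proof
  have "emeasure area (space area) = emeasure (distr area \<nu> cmod) (space \<nu>)"
    by (subst emeasure_distr[OF measurable_cmod_area sets.top])
       (auto intro!: arg_cong[where f = "emeasure area"])
  also have "\<dots> = (\<integral>\<^sup>+r. ennreal (2 * pi * r) * indicator (space \<nu>) r \<partial>\<nu>)"
    unfolding distr_cmod_area
    by (rule emeasure_density[OF measurable_borel_nu sets.top]) simp
  also have "\<dots> \<le> (\<integral>\<^sup>+r. ennreal (2 * pi) \<partial>\<nu>)"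
    by (intro nn_integral_mono) (auto split: split_indicator intro!: ennreal_leI)
  also have "\<dots> < \<infinity>" by (simp add: nu.emeasure_eq_measure ennreal_mult_less_top)
  finally show "emeasure area (space area) \<noteq> \<infinity>" by simp
qed

lemma integrable_area_bounded:
  fixes g :: "complex \<Rightarrow> 'a::{banach, second_countable_topology}"
  assumes "g \<in> borel_measurable area" "\<And>z. z \<in> unit_disc \<Longrightarrow> norm (g z) \<le> B"
  shows "integrable area g"
  by (rule area.integrable_const_bound[where B = B]) (use assms in \<open>auto intro!: AE_I2\<close>)

definition truncated_moment :: "real \<Rightarrow> nat \<Rightarrow> real" where
  "truncated_moment \<rho> m = (\<integral>r. r * (r ^ (2 * m) * indicator {..<\<rho>} r) \<partial>\<nu>)"

abbreviation cutoff :: "real \<Rightarrow> complex \<Rightarrow> complex" where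
  "cutoff \<rho> z \<equiv> of_real (indicator {..<\<rho>} (cmod z))"

lemma measurable_truncation: "(\<lambda>z. indicator {..<\<rho>} (cmod z) :: real) \<in> borel_measurable area"
proof -
  have "(\<lambda>z. indicator {..<\<rho>} (cmod z) :: real) \<in> borel_measurable borel" by measurable
  then show ?thesis by (auto simp: measurable_area intro!: measurable_restrict_space1)
qed

text \<open>Rotation by the angle \<open>\<pi> / (n - m)\<close> changes the sign of the integral when \<open>n \<noteq> m\<close>.\<close>

lemma integral_truncated_monomials:
  "(\<integral>z. z ^ n * cnj z ^ m * cutoff \<rho> z \<partial>area) =
    (if n = m then of_real (2 * pi * truncated_moment \<rho> m) else 0)" (is "?I = _")
proof (cases "n = m")
  case True
  have "(z ^ n * cnj z ^ m * cutoff \<rho> z :: complex) =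
     of_real (cmod z ^ (2 * m) * indicator {..<\<rho>} (cmod z))" for z
  proof -
    have "z ^ m * cnj z ^ m = of_real (cmod z ^ (2 * m))"
    proof -
      have "z ^ m * cnj z ^ m = (z * cnj z) ^ m" by (simp add: power_mult_distrib)
      also have "\<dots> = ((of_real (cmod z))\<^sup>2) ^ m" by (simp only: complex_norm_square[symmetric] of_real_power)
      finally show ?thesis by (simp add: power_mult)
    qed
    then show ?thesis by (simp add: True)
  qed
  then have "?I = (\<integral>z. complex_of_real (cmod z ^ (2 * m) * indicator {..<\<rho>} (cmod z)) \<partial>area)"
    by (simp only:)
  also have "\<dots> = of_real (\<integral>z. cmod z ^ (2 * m) * indicator {..<\<rho>} (cmod z) \<partial>area)"
    by (rule integral_complex_of_real)
  also have "(\<integral>z. cmod z ^ (2 * m) * indicator {..<\<rho>} (cmod z) \<partial>area) = 2 * pi * truncated_moment \<rho> m"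
    unfolding truncated_moment_def by (rule integral_radial_area) (auto intro!: measurable_borel_nu)
  finally show ?thesis using True by simp
next
  case False
  define c where "c = cis (pi / (real n - real m))"
  have c: "cmod c = 1" by (simp add: c_def)
  have cc: "c ^ n * cnj c ^ m = -1"
  proof -
    have "c ^ n * cnj c ^ m = cis (real n * (pi / (real n - real m)) + real m * - (pi / (real n - real m)))"
      unfolding c_def cis_cnj Complex.DeMoivre cis_mult ..
    also have "real n * (pi / (real n - real m)) + real m * - (pi / (real n - real m)) = pi"
    proof -
      define q where "q = pi / (real n - real m)"
      have "real n * q + real m * - q = (real n - real m) * q" by (simp add: algebra_simps)
      also have "\<dots> = pi" using False by (simp add: q_def)
      finally show ?thesis by (simp only: q_def)
    qed
    finally show ?thesis by simp
  qed
  have m: "(\<lambda>z. z ^ n * cnj z ^ m * cutoff \<rho> z) \<in> borel_measurable area"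
    by (intro borel_measurable_times measurable_compose[OF measurable_truncation borel_measurable_of_real]
         measurable_continuous_area continuous_intros)
  have "?I = integral\<^sup>L (distr area area (\<lambda>z. c * z)) (\<lambda>z. z ^ n * cnj z ^ m * cutoff \<rho> z)"
    by (simp only: distr_rotation_area[OF c])
  also have "\<dots> = (\<integral>z. (c * z) ^ n * cnj (c * z) ^ m * cutoff \<rho> (c * z) \<partial>area)"
    by (rule integral_distr[OF distr_rotation_area(1)[OF c] m])
  also have "\<dots> = (\<integral>z. (c ^ n * cnj c ^ m) * (z ^ n * cnj z ^ m * cutoff \<rho> z) \<partial>area)"
    by (simp add: norm_mult c power_mult_distrib mult_ac)
  also have "\<dots> = - ?I" by (simp only: cc) simp
  finally show ?thesis using False by simp
qed

text \<open>The power series converges uniformly on \<open>\<bar>z\<bar> < \<rho>\<close>, where it is integrated term by term before \<open>\<rho>\<close> tends to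
  \<open>1\<close>; on the whole disc it need not converge in the mean.\<close>

lemma integral_area_monomial:
  assumes f: "f holomorphic_on unit_disc" and int: "integrable area f"
  shows "(\<integral>z. f z * cnj z ^ m \<partial>area) = of_real (2 * pi * mom (2 * m + 1)) * ((deriv ^^ m) f 0 / fact m)"
proof -
  define a where "a n = (deriv ^^ n) f 0 / fact n" for n
  have ser: "(\<lambda>n. a n * z ^ n) sums f z" if "z \<in> unit_disc" for z
    using holomorphic_power_series[OF f that] by (simp add: a_def)
  have trunc: "(\<integral>z. f z * cnj z ^ m * cutoff \<rho> z \<partial>area) =
      of_real (2 * pi * truncated_moment \<rho> m) * a m" if \<rho>: "0 < \<rho>" "\<rho> < 1" for \<rho>
  proof -
    define g where "g n z = a n * (z ^ n * cnj z ^ m * cutoff \<rho> z)" for n z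
    have sa: "summable (\<lambda>n. cmod (a n) * \<rho> ^ n)"
      using holomorphic_taylor_abs_summable[OF f, of \<rho>] \<rho> by (simp add: a_def)
    have gm: "g n \<in> borel_measurable area" for n
      unfolding g_def
      by (intro borel_measurable_times measurable_compose[OF measurable_truncation borel_measurable_of_real]
           measurable_continuous_area continuous_intros)
    have gb: "cmod (g n z) \<le> cmod (a n) * \<rho> ^ n" if "z \<in> unit_disc" for n z
    proof (cases "cmod z < \<rho>")
      case True
      have "cmod z ^ n * cmod z ^ m \<le> \<rho> ^ n * 1"
        using True that \<rho> by (intro mult_mono power_mono power_le_one) auto
      then show ?thesis using True by (auto simp: g_def norm_mult norm_power intro!: mult_left_mono)
    qed (use \<rho> in \<open>simp add: g_def\<close>)
    have "(\<lambda>n. g n z) sums (f z * cnj z ^ m * cutoff \<rho> z)" if "z \<in> unit_disc" for z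
      using sums_mult2[OF ser[OF that], of "cnj z ^ m * cutoff \<rho> z"]
      by (simp add: g_def mult.assoc)
    then have "(\<lambda>n. integral\<^sup>L area (g n)) sums (\<integral>z. f z * cnj z ^ m * cutoff \<rho> z \<partial>area)"
      using gb sa by (intro sums_integral_dominated[OF gm, where w = "\<lambda>_. 1"]) auto
    moreover have "integral\<^sup>L area (g n) = (if n = m then of_real (2 * pi * truncated_moment \<rho> m) * a m else 0)" for n
      unfolding g_def integral_mult_right_zero integral_truncated_monomials by simp
    ultimately have "(\<lambda>n. if n = m then of_real (2 * pi * truncated_moment \<rho> m) * a m else 0) sums
        (\<integral>z. f z * cnj z ^ m * cutoff \<rho> z \<partial>area)" by simp
    moreover have "(\<lambda>n. if n = m then of_real (2 * pi * truncated_moment \<rho> m) * a m else 0) sums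
        (of_real (2 * pi * truncated_moment \<rho> m) * a m)" by (rule sums_single)
    ultimately show ?thesis by (rule sums_unique2)
  qed
  define \<rho> where "\<rho> k = 1 - 1 / real (k + 2)" for k
  have \<rho>: "0 < \<rho> k" "\<rho> k < 1" for k by (auto simp: \<rho>_def field_simps)
  have \<rho>_lim: "\<rho> \<longlonglongrightarrow> 1" unfolding \<rho>_def by real_asymp
  have ind: "(\<lambda>k. indicator {..<\<rho> k} r :: real) \<longlonglongrightarrow> 1" if "r < 1" for r
  proof (rule tendsto_eventually)
    show "\<forall>\<^sub>F k in sequentially. indicator {..<\<rho> k} r = (1::real)"
      using order_tendstoD(1)[OF \<rho>_lim that] by eventually_elim (auto simp: indicator_def)
  qed
  have fm: "f \<in> borel_measurable area" using int by auto
  have "(\<lambda>k. \<integral>z. f z * cnj z ^ m * cutoff (\<rho> k) z \<partial>area) \<longlonglongrightarrow> (\<integral>z. f z * cnj z ^ m \<partial>area)"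
  proof (rule integral_dominated_convergence[where w = "\<lambda>z. cmod (f z)"])
    show "(\<lambda>z. f z * cnj z ^ m) \<in> borel_measurable area"
      by (intro borel_measurable_times fm measurable_continuous_area continuous_intros)
    show "(\<lambda>z. f z * cnj z ^ m * cutoff (\<rho> k) z) \<in> borel_measurable area" for k
      by (intro borel_measurable_times fm measurable_compose[OF measurable_truncation borel_measurable_of_real]
           measurable_continuous_area continuous_intros)
    show "integrable area (\<lambda>z. cmod (f z))" using int by simp
    show "AE z in area. (\<lambda>k. f z * cnj z ^ m * cutoff (\<rho> k) z) \<longlonglongrightarrow> f z * cnj z ^ m"
    proof (rule AE_I2)
      fix z assume "z \<in> space area"
      then have "cmod z < 1" by simp
      from tendsto_mult[OF tendsto_const tendsto_of_real[OF ind[OF this]], of "f z * cnj z ^ m"]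
      show "(\<lambda>k. f z * cnj z ^ m * cutoff (\<rho> k) z) \<longlonglongrightarrow> f z * cnj z ^ m" by simp
    qed
    show "AE z in area. norm (f z * cnj z ^ m * cutoff (\<rho> k) z) \<le> cmod (f z)" for k
      by (rule AE_I2) (auto simp: norm_mult norm_power indicator_def intro!: mult_left_le power_le_one)
  qed
  moreover have "(\<lambda>k. truncated_moment (\<rho> k) m) \<longlonglongrightarrow> mom (2 * m + 1)"
    unfolding truncated_moment_def mom_def
  proof (rule integral_dominated_convergence[where w = "\<lambda>_. 1"])
    show "AE r in \<nu>. (\<lambda>k. r * (r ^ (2 * m) * indicator {..<\<rho> k} r)) \<longlonglongrightarrow> r ^ (2 * m + 1)"
    proof (rule AE_I2)
      fix r assume "r \<in> space \<nu>"
      then have "r < 1" by simp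
      from tendsto_mult[OF tendsto_const ind[OF this], of "r ^ (2 * m + 1)"]
      show "(\<lambda>k. r * (r ^ (2 * m) * indicator {..<\<rho> k} r)) \<longlonglongrightarrow> r ^ (2 * m + 1)" by (simp add: mult.assoc)
    qed
    show "AE r in \<nu>. norm (r * (r ^ (2 * m) * indicator {..<\<rho> k} r)) \<le> 1" for k
      by (rule AE_I2) (auto simp: norm_mult norm_power indicator_def intro!: mult_le_one power_le_one)
  qed (auto intro!: measurable_borel_nu)
  then have "(\<lambda>k. of_real (2 * pi * truncated_moment (\<rho> k) m) * a m) \<longlonglongrightarrow> of_real (2 * pi * mom (2 * m + 1)) * a m"
    by (intro tendsto_intros)
  ultimately show ?thesis
    using trunc[OF \<rho>] by (auto simp: a_def intro: LIMSEQ_unique)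
qed

lemma summable_inverse_moments:
  assumes "0 \<le> q" "q < 1"
  shows "summable (\<lambda>n. real (n + 2) * q ^ n / mom (2 * n + 1))"
proof -
  \<comment> \<open>Any \<open>y\<close> with \<open>q < y\<^sup>2\<close> and \<open>y < 1\<close> works.\<close>
  define y where "y = (1 + q) / 2"
  have y: "0 < y" "y < 1" "q < y\<^sup>2" 
  proof -
    have "0 < (1 - q)\<^sup>2" using assms by simp
    then show "q < y\<^sup>2" by (simp add: y_def power2_eq_square field_simps)
  qed (use assms in \<open>auto simp: y_def\<close>)
  have Wy: "0 < W y" using y by (intro weight_hat_pos) auto
  have "summable (\<lambda>n. real (n + 2) * (q / y\<^sup>2) ^ n)"
  proof -
    have z: "norm (q / y\<^sup>2) < 1" using y assms by (simp add: field_simps)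
    have "summable (\<lambda>n. of_nat (Suc n) * (q / y\<^sup>2) ^ n + (q / y\<^sup>2) ^ n)"
      using geometric_deriv_sums[OF z] summable_geometric[OF z] by (intro summable_add) (auto simp: sums_iff)
    then show ?thesis by (simp add: algebra_simps)
  qed
  then have "summable (\<lambda>n. 1 / (y * W y) * (real (n + 2) * (q / y\<^sup>2) ^ n))"
    by (rule summable_mult)
  then show ?thesis
  proof (rule summable_comparison_test'[of _ 0])
    fix n :: nat
    have "y ^ (2 * n + 1) * W y \<le> mom (2 * n + 1)" using y by (intro mom_lower) auto
    then have "real (n + 2) * q ^ n / mom (2 * n + 1) \<le> real (n + 2) * q ^ n / (y ^ (2 * n + 1) * W y)"
      using assms y Wy mom_pos[of "2 * n + 1"] by (intro divide_left_mono) auto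
    also have "\<dots> = 1 / (y * W y) * (real (n + 2) * (q / y\<^sup>2) ^ n)"
      by (simp add: power_divide power_mult[symmetric] power_add)
    finally show "norm (real (n + 2) * q ^ n / mom (2 * n + 1)) \<le> 1 / (y * W y) * (real (n + 2) * (q / y\<^sup>2) ^ n)"
      using assms mom_pos[of "2 * n + 1"] by simp
  qed
qed

end

section \<open>The reproducing kernel and the Hilbert kernel\<close>

context disc_weight
begin

definition bergman_series :: "real \<Rightarrow> complex \<Rightarrow> complex" where
  "bergman_series t z = (\<Sum>n. of_real (t ^ n / (2 * mom (2 * n + 1))) * z ^ n)"

lemma summable_bergman_coeffs:
  assumes t: "0 \<le> t" "t < 1"
  shows "summable (\<lambda>n. t ^ n / (2 * mom (2 * n + 1)))"
proof (rule summable_comparison_test'[OF summable_inverse_moments[OF t], of 0])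
  fix n :: nat
  have "t ^ n / mom (2 * n + 1) * (1 / 2) \<le> t ^ n / mom (2 * n + 1) * real (n + 2)"
    using t mom_pos[of "2 * n + 1"] by (intro mult_left_mono) auto
  then show "norm (t ^ n / (2 * mom (2 * n + 1))) \<le> real (n + 2) * t ^ n / mom (2 * n + 1)"
    using t mom_pos[of "2 * n + 1"] by (simp add: mult_ac)
qed

lemma bergman_series_sums:
  assumes t: "0 \<le> t" "t < 1" and z: "cmod z \<le> 1"
  shows "(\<lambda>n. of_real (t ^ n / (2 * mom (2 * n + 1))) * z ^ n) sums bergman_series t z"
    and "cmod (bergman_series t z) \<le> (\<Sum>n. t ^ n / (2 * mom (2 * n + 1)))"
proof -
  have b: "norm (of_real (t ^ n / (2 * mom (2 * n + 1))) * z ^ n) \<le> t ^ n / (2 * mom (2 * n + 1))" for n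
    using t z mom_pos[of "2 * n + 1"]
    by (auto simp: norm_mult norm_divide norm_power intro!: divide_right_mono mult_left_le power_le_one)
  show "(\<lambda>n. of_real (t ^ n / (2 * mom (2 * n + 1))) * z ^ n) sums bergman_series t z"
    unfolding bergman_series_def
    by (intro summable_sums summable_comparison_test'[OF summable_bergman_coeffs[OF t], of 0] b)
  show "cmod (bergman_series t z) \<le> (\<Sum>n. t ^ n / (2 * mom (2 * n + 1)))"
    unfolding bergman_series_def by (rule norm_suminf_le[OF b summable_bergman_coeffs[OF t]])
qed

lemma bergman_series_holomorphic:
  assumes t: "0 \<le> t" "t < 1"
  shows "bergman_series t holomorphic_on unit_disc"
  by (rule power_series_holomorphic[where a = "\<lambda>n. of_real (t ^ n / (2 * mom (2 * n + 1)))"])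
     (use bergman_series_sums(1)[OF t] in auto)

lemma bergman2_eq:
  assumes f: "f holomorphic_on unit_disc"
  shows "f \<in> bergman2 \<omega> \<longleftrightarrow> integrable area (\<lambda>z. (cmod (f z))\<^sup>2)"
proof -
  have "(\<lambda>z. (cmod (f z))\<^sup>2) \<in> borel_measurable area"
    by (intro measurable_continuous_area continuous_intros holomorphic_on_imp_continuous_on[OF f])
  then show ?thesis by (subst integral_area) (simp_all add: bergman2_def f mult.commute)
qed

lemma bergman2_bounded:
  assumes f: "f holomorphic_on unit_disc" and B: "\<And>z. z \<in> unit_disc \<Longrightarrow> cmod (f z) \<le> B"
  shows "f \<in> bergman2 \<omega>"
  unfolding bergman2_eq[OF f]
proof (rule integrable_area_bounded[where B = "B\<^sup>2"])
  show "(\<lambda>z. (cmod (f z))\<^sup>2) \<in> borel_measurable area"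
    by (intro measurable_continuous_area continuous_intros holomorphic_on_imp_continuous_on[OF f])
  show "norm ((cmod (f z))\<^sup>2) \<le> B\<^sup>2" if "z \<in> unit_disc" for z
    using B[OF that] by (simp add: power_mono)
qed

lemma bergman2_integrable:
  assumes "f \<in> bergman2 \<omega>"
  shows "f holomorphic_on unit_disc" "integrable area f"
proof -
  show f: "f holomorphic_on unit_disc" using assms by (simp add: bergman2_def)
  have "integrable area (\<lambda>z. 1 + (cmod (f z))\<^sup>2)"
    using assms bergman2_eq[OF f] by auto
  then show "integrable area f"
  proof (rule Bochner_Integration.integrable_bound)
    show "f \<in> borel_measurable area"
      by (intro measurable_continuous_area holomorphic_on_imp_continuous_on[OF f])
    have "x \<le> 1 + x\<^sup>2" for x :: real
      using zero_le_power2[of "x - 1/2"] by (simp add: power2_eq_square algebra_simps)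
    then show "AE z in area. norm (f z) \<le> norm (1 + (cmod (f z))\<^sup>2)" by (auto intro!: AE_I2)
  qed
qed

lemma reproducing_integral_eq:
  assumes f: "f holomorphic_on unit_disc" and g: "g holomorphic_on unit_disc"
  shows "(LINT z:unit_disc|lebesgue. f z * cnj (g z) * complex_of_real (\<omega> (cmod z))) = (\<integral>z. f z * cnj (g z) \<partial>area)"
proof -
  have "(\<lambda>z. f z * cnj (g z)) \<in> borel_measurable area"
    by (intro measurable_continuous_area continuous_intros holomorphic_on_imp_continuous_on f g)
  then show ?thesis by (subst integral_area) (simp_all add: scaleR_conv_of_real mult_ac)
qed

lemma is_bergman_kernel_series:
  assumes t: "0 \<le> t" "t < 1"
  shows "is_bergman_kernel \<omega> (of_real t) (bergman_series t)"
  unfolding is_bergman_kernel_def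
proof (intro conjI ballI)
  show "bergman_series t \<in> bergman2 \<omega>"
    by (rule bergman2_bounded[OF bergman_series_holomorphic[OF t], of "\<Sum>n. t ^ n / (2 * mom (2 * n + 1))"])
       (rule bergman_series_sums(2)[OF t], simp)
  fix f assume "f \<in> bergman2 \<omega>"
  note f = bergman2_integrable[OF this]
  define b where "b n = t ^ n / (2 * mom (2 * n + 1))" for n
  have sb: "summable b" unfolding b_def by (rule summable_bergman_coeffs[OF t])
  have b0: "0 \<le> b n" for n using t mom_pos[of "2 * n + 1"] by (simp add: b_def)
  define g where "g n z = of_real (b n) * (f z * cnj z ^ n)" for n z
  have gb: "cmod (g n z) \<le> b n * cmod (f z)" if "z \<in> unit_disc" for n z
    using that b0 by (auto simp: g_def norm_mult norm_power intro!: mult_left_mono mult_left_le power_le_one)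
  have fm: "f \<in> borel_measurable area" using f(2) by auto
  have gm: "g n \<in> borel_measurable area" for n
    unfolding g_def by (intro borel_measurable_times fm measurable_continuous_area continuous_intros)
  have gs: "(\<lambda>n. g n z) sums (f z * cnj (bergman_series t z))" if "z \<in> unit_disc" for z
  proof -
    have "(\<lambda>n. cnj (of_real (b n) * z ^ n)) sums cnj (bergman_series t z)"
      using bergman_series_sums(1)[OF t, of z] that unfolding b_def by (simp only: sums_cnj) simp
    from sums_mult[OF this, of "f z"] show ?thesis by (simp add: g_def mult_ac)
  qed
  have "(\<lambda>n. integral\<^sup>L area (g n)) sums (\<integral>z. f z * cnj (bergman_series t z) \<partial>area)"
    by (rule sums_integral_dominated[OF gm integrable_norm[OF f(2)] _ sb]) (use gb gs in auto)
  moreover have "integral\<^sup>L area (g n) = of_real pi * ((deriv ^^ n) f 0 / fact n * of_real t ^ n)" for n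
    unfolding g_def integral_mult_right_zero integral_area_monomial[OF f]
    using mom_pos[of "2 * n + 1"] by (simp add: b_def field_simps)
  ultimately have "(\<lambda>n. of_real pi * ((deriv ^^ n) f 0 / fact n * of_real t ^ n)) sums (\<integral>z. f z * cnj (bergman_series t z) \<partial>area)"
    by simp
  moreover have "(\<lambda>n. of_real pi * ((deriv ^^ n) f 0 / fact n * of_real t ^ n)) sums (of_real pi * f (of_real t))"
    using sums_mult[OF holomorphic_power_series[OF f(1), of "of_real t"], of "of_real pi"] t by simp
  ultimately have "(\<integral>z. f z * cnj (bergman_series t z) \<partial>area) = of_real pi * f (of_real t)"
    by (rule sums_unique2)
  then show "f (of_real t) = complex_of_real (1 / pi) *
      (LINT z:unit_disc|lebesgue. f z * cnj (bergman_series t z) * complex_of_real (\<omega> (cmod z)))"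
    unfolding reproducing_integral_eq[OF f(1) bergman_series_holomorphic[OF t]] by simp
qed

text \<open>Testing the reproducing property on monomials determines all Taylor coefficients.\<close>

lemma bergman_kernel_eq_series:
  assumes t: "0 \<le> t" "t < 1" and z: "z \<in> unit_disc"
  shows "bergman_kernel \<omega> (of_real t) z = bergman_series t z"
proof -
  define B where "B = bergman_kernel \<omega> (of_real t)"
  have "is_bergman_kernel \<omega> (of_real t) B"
    unfolding B_def bergman_kernel_def by (rule someI[of "is_bergman_kernel \<omega> (of_real t)", OF is_bergman_kernel_series[OF t]])
  then have B: "B \<in> bergman2 \<omega>" and rep: "\<And>f. f \<in> bergman2 \<omega> \<Longrightarrow> f (of_real t) = complex_of_real (1 / pi) *
      (LINT z:unit_disc|lebesgue. f z * cnj (B z) * complex_of_real (\<omega> (cmod z)))"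
    by (auto simp: is_bergman_kernel_def)
  note Bi = bergman2_integrable[OF B]
  have coeff: "(deriv ^^ n) B 0 / fact n = of_real (t ^ n / (2 * mom (2 * n + 1)))" for n
  proof -
    have hol: "(\<lambda>z::complex. z ^ n) holomorphic_on unit_disc" by (intro holomorphic_intros)
    have "(\<lambda>z. z ^ n) \<in> bergman2 \<omega>"
      by (rule bergman2_bounded[OF hol, of 1]) (auto simp: norm_power intro!: power_le_one)
    from rep[OF this] have "of_real pi * of_real t ^ n = (\<integral>z. z ^ n * cnj (B z) \<partial>area)"
      unfolding reproducing_integral_eq[OF hol Bi(1)] by simp
    also have "\<dots> = (\<integral>z. cnj (B z * cnj z ^ n) \<partial>area)" by (simp add: mult.commute)
    also have "\<dots> = cnj (\<integral>z. B z * cnj z ^ n \<partial>area)" by (rule Bochner_Integration.integral_cnj)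
    also have "\<dots> = cnj (of_real (2 * pi * mom (2 * n + 1)) * ((deriv ^^ n) B 0 / fact n))"
      by (simp only: integral_area_monomial[OF Bi])
    finally have "cnj (of_real pi * of_real t ^ n) = of_real (2 * pi * mom (2 * n + 1)) * ((deriv ^^ n) B 0 / fact n)"
      by (metis complex_cnj_cnj)
    then show ?thesis using mom_pos[of "2 * n + 1"] by (simp add: field_simps)
  qed
  have "(\<lambda>n. of_real (t ^ n / (2 * mom (2 * n + 1))) * z ^ n) sums B z"
    using holomorphic_power_series[OF Bi(1) z] by (simp add: coeff)
  then show ?thesis
    unfolding B_def[symmetric] bergman_series_def by (rule sums_unique)
qed

text \<open>The power series \<open>F\<close> with these coefficients generates the kernel of the operator, as \<open>F(t z)\<close>.\<close>

definition averaged_coeff :: "nat \<Rightarrow> real" where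
  "averaged_coeff n = 1 / (2 * real (n + 1) * mom (2 * n + 1))"

definition averaged_series :: "complex \<Rightarrow> complex" where
  "averaged_series w = (\<Sum>n. of_real (averaged_coeff n) * w ^ n)"

lemma averaged_coeff_pos: "0 < averaged_coeff n"
  using mom_pos[of "2 * n + 1"] by (simp add: averaged_coeff_def)

lemma summable_averaged_coeff:
  assumes q: "0 \<le> q" "q < 1"
  shows "summable (\<lambda>n. averaged_coeff n * q ^ n)"
proof (rule summable_comparison_test'[OF summable_inverse_moments[OF q], of 0])
  fix n :: nat
  have "q ^ n / mom (2 * n + 1) * (1 / (2 * real (n + 1))) \<le> q ^ n / mom (2 * n + 1) * real (n + 2)"
  proof (intro mult_left_mono)
    have "1 / (2 * real (n + 1)) \<le> 1" by simp
    then show "1 / (2 * real (n + 1)) \<le> real (n + 2)" by linarith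
  qed (use q mom_pos[of "2 * n + 1"] in auto)
  then show "norm (averaged_coeff n * q ^ n) \<le> real (n + 2) * q ^ n / mom (2 * n + 1)"
    using q averaged_coeff_pos[of n] by (simp add: averaged_coeff_def mult_ac)
qed

lemma averaged_series_sums:
  assumes "cmod w < 1"
  shows "(\<lambda>n. of_real (averaged_coeff n) * w ^ n) sums averaged_series w"
    and "summable (\<lambda>n. cmod (of_real (averaged_coeff n) * w ^ n))"
proof -
  show "summable (\<lambda>n. cmod (of_real (averaged_coeff n) * w ^ n))"
    using summable_averaged_coeff[of "cmod w"] assms averaged_coeff_pos
    by (simp add: norm_mult norm_power abs_of_pos)
  from summable_norm_cancel[OF this]
  show "(\<lambda>n. of_real (averaged_coeff n) * w ^ n) sums averaged_series w"
    unfolding averaged_series_def by (rule summable_sums)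
qed

lemma averaged_series_holomorphic: "averaged_series holomorphic_on unit_disc"
  by (rule power_series_holomorphic[where a = "\<lambda>n. of_real (averaged_coeff n)"])
     (use averaged_series_sums(1) in auto)

lemma norm_averaged_series_le:
  assumes "cmod w \<le> q" "q < 1"
  shows "cmod (averaged_series w) \<le> (\<Sum>n. averaged_coeff n * q ^ n)"
  unfolding averaged_series_def
proof (rule norm_suminf_le)
  have "0 \<le> q" using assms norm_ge_zero order_trans by blast
  then show "summable (\<lambda>n. averaged_coeff n * q ^ n)" by (rule summable_averaged_coeff) fact
  show "norm (of_real (averaged_coeff n) * w ^ n) \<le> averaged_coeff n * q ^ n" for n
    using assms averaged_coeff_pos[of n]
    by (auto simp: norm_mult norm_power intro!: mult_left_mono power_mono)
qed

lemma hilbert_kernel_eq: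
  assumes t: "0 \<le> t" "t < 1" and z: "z \<in> unit_disc"
  shows "hilbert_kernel \<omega> t z = averaged_series (of_real t * z)"
proof (cases "z = 0")
  case True
  have "bergman_series t 0 = of_real (1 / (2 * mom 1))"
    unfolding bergman_series_def by (subst powser_zero) simp
  moreover have "averaged_series 0 = of_real (1 / (2 * mom 1))"
    unfolding averaged_series_def by (subst powser_zero) (simp add: averaged_coeff_def)
  ultimately show ?thesis
    using True bergman_kernel_eq_series[OF t, of 0] by (simp add: hilbert_kernel_def)
next
  case False
  define c where "c n = (if n = 0 then 0 else of_real (averaged_coeff (n - 1) * t ^ (n - 1)) :: complex)" for n
  have P: "(\<lambda>n. c n * w ^ n) sums (w * averaged_series (of_real t * w))" if "w \<in> unit_disc" for w
  proof -
    have "cmod (of_real t * w) \<le> cmod w" using t by (auto simp: norm_mult intro!: mult_left_le_one_le)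
    then have "cmod (of_real t * w) < 1" using that by simp
    from sums_mult[OF averaged_series_sums(1)[OF this], of w]
    have "(\<lambda>n. c (Suc n) * w ^ Suc n) sums (w * averaged_series (of_real t * w))"
      by (simp add: c_def power_mult_distrib mult_ac)
    then have "(\<lambda>n. c n * w ^ n) sums (w * averaged_series (of_real t * w) + c 0 * w ^ 0)"
      by (subst (asm) sums_Suc_iff) simp
    then show ?thesis by (simp add: c_def)
  qed
  have dc: "diffs c n = of_real (t ^ n / (2 * mom (2 * n + 1)))" for n
  proof -
    have "diffs c n = of_real (real (Suc n) * (averaged_coeff n * t ^ n))"
      by (simp add: diffs_def c_def)
    also have "real (Suc n) * (averaged_coeff n * t ^ n) = t ^ n / (2 * mom (2 * n + 1))"
      by (simp add: averaged_coeff_def del: of_nat_Suc)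
    finally show ?thesis .
  qed
  have D: "((\<lambda>w. \<Sum>n. c n * w ^ n) has_field_derivative bergman_kernel \<omega> (of_real t) w) (at w)"
    if "w \<in> unit_disc" for w
  proof -
    have "((\<lambda>w. \<Sum>n. c n * w ^ n) has_field_derivative (\<Sum>n. diffs c n * w ^ n)) (at w)"
      by (rule termdiffs_strong'[where K = 1]) (use P that in \<open>auto simp: sums_iff\<close>)
    then show ?thesis
      unfolding bergman_kernel_eq_series[OF t that] bergman_series_def by (simp only: dc)
  qed
  have "(bergman_kernel \<omega> (of_real t) has_contour_integral
      (\<Sum>n. c n * pathfinish (linepath 0 z) ^ n) - (\<Sum>n. c n * pathstart (linepath 0 z) ^ n)) (linepath 0 z)"
  proof (rule contour_integral_primitive[where S = unit_disc])
    show "((\<lambda>w. \<Sum>n. c n * w ^ n) has_field_derivative bergman_kernel \<omega> (of_real t) w) (at w within unit_disc)"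
      if "w \<in> unit_disc" for w
      using D[OF that] by (rule has_field_derivative_at_within)
    show "path_image (linepath 0 z) \<subseteq> unit_disc"
      using z by (simp add: closed_segment_subset convex_ball)
  qed (rule valid_path_linepath)
  moreover have "(\<Sum>n. c n * z ^ n) = z * averaged_series (of_real t * z)"
    using P[OF z] by (simp add: sums_iff)
  moreover have "(\<Sum>n. c n * 0 ^ n) = 0"
    by (subst powser_zero) (simp add: c_def)
  ultimately have "contour_integral (linepath 0 z) (bergman_kernel \<omega> (of_real t)) = z * averaged_series (of_real t * z)"
    by (auto dest!: contour_integral_unique)
  then show ?thesis using False by (simp add: hilbert_kernel_def)
qed

end

section \<open>Integral means of the Hilbert kernel\<close>

context disc_weight
begin

abbreviation inverse_hat_integral :: "real \<Rightarrow> real" where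
  "inverse_hat_integral t \<equiv> (LINT s:{0..t}|lebesgue. 1 / W s)"

lemma measurable_weight_hat: "(\<lambda>s. 1 / measure \<nu> {max 0 s..<1}) \<in> borel_measurable borel"
proof -
  have "mono (\<lambda>s. - measure \<nu> {max 0 s..<1})"
    by (intro monoI) (auto intro!: nu.finite_measure_mono simp: sets_restrict_space_iff)
  from borel_measurable_uminus[OF borel_measurable_mono[OF this]]
  have [measurable]: "(\<lambda>s. measure \<nu> {max 0 s..<1}) \<in> borel_measurable borel" by simp
  show ?thesis by measurable
qed

lemma measurable_inverse_hat: "(\<lambda>s. indicator {0..t} s *\<^sub>R (1 / W s)) \<in> borel_measurable borel"
proof -
  have "(\<lambda>s. indicator {0..t} s *\<^sub>R (1 / W s)) = (\<lambda>s. indicator {0..t} s *\<^sub>R (1 / measure \<nu> {max 0 s..<1}))"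
    by (auto split: split_indicator simp: weight_hat_eq)
  moreover have "(\<lambda>s. indicator {0..t} s *\<^sub>R (1 / measure \<nu> {max 0 s..<1})) \<in> borel_measurable borel"
    by (intro borel_measurable_scaleR) (use measurable_weight_hat in auto)
  ultimately show ?thesis by simp
qed

lemma inverse_hat_integrable:
  assumes t: "t < 1"
  shows "set_integrable lborel {0..t} (\<lambda>s. 1 / W s)"
  unfolding set_integrable_def
proof (rule integrableI_bounded_set[where A = "{0..t}" and B = "1 / W t"])
  show "AE s in lborel. s \<in> {0..t} \<longrightarrow> norm (indicator {0..t} s *\<^sub>R (1 / W s)) \<le> 1 / W t"
  proof (intro AE_I2 impI)
    fix s assume s: "s \<in> {0..t}"
    then have "0 < W t" "W t \<le> W s" using t by (auto intro!: weight_hat_pos weight_hat_antimono)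
    then show "norm (indicator {0..t} s *\<^sub>R (1 / W s)) \<le> 1 / W t" using s by (simp add: frac_le)
  qed
qed (use measurable_inverse_hat in \<open>auto simp: emeasure_lborel_Icc_eq\<close>)

lemma inverse_hat_integral_lborel: "inverse_hat_integral t = (\<integral>s. indicator {0..t} s *\<^sub>R (1 / W s) \<partial>lborel)"
  unfolding set_lebesgue_integral_def by (rule integral_completion) (use measurable_inverse_hat in simp)

lemma inverse_hat_integral_nonneg: "t < 1 \<Longrightarrow> 0 \<le> inverse_hat_integral t"
  unfolding set_lebesgue_integral_def
  by (rule Bochner_Integration.integral_nonneg) (auto split: split_indicator intro!: less_imp_le weight_hat_pos)

lemma nn_integral_inverse_hat:
  assumes t: "t < 1"
  shows "(\<integral>\<^sup>+s. ennreal (1 / W s) * indicator {0..t} s \<partial>lborel) = ennreal (inverse_hat_integral t)"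
proof -
  have "(\<integral>\<^sup>+s. ennreal (1 / W s) * indicator {0..t} s \<partial>lborel) = (\<integral>\<^sup>+s. ennreal (indicator {0..t} s *\<^sub>R (1 / W s)) \<partial>lborel)"
    by (intro nn_integral_cong) (auto split: split_indicator)
  also have "\<dots> = ennreal (inverse_hat_integral t)"
    unfolding inverse_hat_integral_lborel
    using inverse_hat_integrable[OF t] t
    by (intro nn_integral_eq_integral)
       (auto simp: set_integrable_def split: split_indicator intro!: AE_I2 less_imp_le weight_hat_pos)
  finally show ?thesis .
qed

lemma inverse_hat_integral_mono: 
  assumes "s \<le> t" "t < 1" shows "inverse_hat_integral s \<le> inverse_hat_integral t"
proof -
  have "ennreal (inverse_hat_integral s) \<le> ennreal (inverse_hat_integral t)"
    unfolding nn_integral_inverse_hat[OF assms(2), symmetric] nn_integral_inverse_hat[OF le_less_trans[OF assms], symmetric]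
    using assms(1) by (intro nn_integral_mono) (auto split: split_indicator)
  then show ?thesis using inverse_hat_integral_nonneg[OF assms(2)] by simp
qed

lemma inverse_hat_integral_increment:
  assumes st: "0 \<le> s" "s \<le> t" "t < 1"
  shows "inverse_hat_integral t \<le> inverse_hat_integral s + (t - s) / W t"
proof -
  have Wt: "0 < W t" using st by (intro weight_hat_pos) auto
  have i: "integrable lborel (\<lambda>x. indicator {0..r} x *\<^sub>R (1 / W x))" if "r < 1" for r
    using inverse_hat_integrable[OF that] by (simp add: set_integrable_def)
  have c: "integrable lborel (\<lambda>x. indicator {s..t} x *\<^sub>R (1 / W t))"
    by (simp add: emeasure_lborel_Icc_eq)
  have "inverse_hat_integral t \<le> (\<integral>x. indicator {0..s} x *\<^sub>R (1 / W x) + indicator {s..t} x *\<^sub>R (1 / W t) \<partial>lborel)"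
    unfolding inverse_hat_integral_lborel
  proof (rule integral_mono[OF i Bochner_Integration.integrable_add[OF i c]])
    fix x
    show "indicator {0..t} x *\<^sub>R (1 / W x) \<le> indicator {0..s} x *\<^sub>R (1 / W x) + indicator {s..t} x *\<^sub>R (1 / W t)"
    proof (cases "x \<in> {0..t}")
      case True
      then have "W t \<le> W x" by (intro weight_hat_antimono) auto
      then have "1 / W x \<le> 1 / W t" using Wt by (intro divide_left_mono) (auto simp: mult_pos_pos)
      then show ?thesis using True Wt by (auto split: split_indicator)
    next
      case False
      then show ?thesis using st Wt by (auto split: split_indicator)
    qed
  qed (use st in auto)
  also have "\<dots> = inverse_hat_integral s + (t - s) / W t"
    using st by (subst Bochner_Integration.integral_add[OF i c])
      (auto simp: inverse_hat_integral_lborel)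
  finally show ?thesis .
qed

text \<open>The coefficients of the second derivative of \<open>w\<^sup>2 averaged_series w\<close>.\<close>

definition second_coeff :: "nat \<Rightarrow> real" where
  "second_coeff n = real (n + 2) / (2 * mom (2 * n + 1))"

definition second_series :: "complex \<Rightarrow> complex" where
  "second_series w = (\<Sum>n. of_real (second_coeff n) * w ^ n)"

lemma second_coeff_nonneg: "0 \<le> second_coeff n"
  using mom_pos[of "2 * n + 1"] by (simp add: second_coeff_def)

lemma averaged_coeff_eq: "averaged_coeff n = second_coeff n / (real (n + 1) * real (n + 2))"
  by (simp add: averaged_coeff_def second_coeff_def)

lemma summable_second_coeff:
  assumes q: "0 \<le> q" "q < 1"
  shows "summable (\<lambda>n. second_coeff n * q ^ n)"
  using summable_divide[OF summable_inverse_moments[OF q], of 2]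
  by (simp add: second_coeff_def mult.commute)

lemma second_series_sums:
  assumes "cmod w < 1"
  shows "(\<lambda>n. of_real (second_coeff n) * w ^ n) sums second_series w"
proof -
  have "summable (\<lambda>n. cmod (of_real (second_coeff n) * w ^ n))"
    using summable_second_coeff[of "cmod w"] assms second_coeff_nonneg
    by (simp add: norm_mult norm_power)
  from summable_norm_cancel[OF this] show ?thesis
    unfolding second_series_def by (rule summable_sums)
qed

lemma second_series_holomorphic: "second_series holomorphic_on unit_disc"
  by (rule power_series_holomorphic[where a = "\<lambda>n. of_real (second_coeff n)"])
     (use second_series_sums in auto)

text \<open>Taylor's formula with integral remainder for \<open>w\<^sup>2 averaged_series w\<close>, which vanishes to second order at
\<open>0\<close>, along the segment from \<open>0\<close> to \<open>\<rho> z\<close>.\<close>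

lemma averaged_series_eq_integral:
  assumes \<rho>: "0 \<le> \<rho>" "\<rho> < 1" and z: "cmod z = 1"
  shows "of_real (\<rho>\<^sup>2) * averaged_series (of_real \<rho> * z) =
      (\<integral>x. (indicator {0..\<rho>} x * (\<rho> - x)) *\<^sub>R second_series (of_real x * z) \<partial>lborel)"
proof -
  define g where "g n x = (of_real (second_coeff n) * z ^ n) * of_real ((\<rho> - x) * x ^ n * indicator {0..\<rho>} x)" for n x
  have FTC: "has_bochner_integral lborel (\<lambda>x. ((\<rho> - x) * x ^ n) * indicator {0..\<rho>} x) (\<rho> ^ (n + 2) / (real (n + 1) * real (n + 2)))" for n
  proof -
    have "has_bochner_integral lborel (\<lambda>x. ((\<rho> - x) * x ^ n) * indicator {0..\<rho>} x)
       ((\<rho> * (\<rho> ^ (n + 1) / real (n + 1)) - \<rho> ^ (n + 2) / real (n + 2)) - (\<rho> * (0 ^ (n + 1) / real (n + 1)) - 0 ^ (n + 2) / real (n + 2)))"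
    proof (rule has_bochner_integral_FTC_Icc_nonneg)
      fix x
      have p: "((\<lambda>x. x ^ Suc k / real (Suc k)) has_real_derivative x ^ k) (at x)" for k
        using DERIV_cdivide[OF DERIV_pow[of "Suc k" x], of "real (Suc k)"] by (simp del: of_nat_Suc)
      show "((\<lambda>x. \<rho> * (x ^ (n + 1) / real (n + 1)) - x ^ (n + 2) / real (n + 2)) has_real_derivative (\<rho> - x) * x ^ n) (at x)"
        using DERIV_diff[OF DERIV_cmult[OF p[of n], of \<rho>] p[of "Suc n"]]
        by (simp add: left_diff_distrib del: of_nat_Suc)
    qed (use \<rho> in auto)
    also have "((\<rho> * (\<rho> ^ (n + 1) / real (n + 1)) - \<rho> ^ (n + 2) / real (n + 2)) - (\<rho> * (0 ^ (n + 1) / real (n + 1)) - 0 ^ (n + 2) / real (n + 2)))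
       = \<rho> ^ (n + 2) / (real (n + 1) * real (n + 2))"
      by (simp add: field_simps)
    finally show ?thesis .
  qed
  have gint: "integral\<^sup>L lborel (g n) = of_real (\<rho>\<^sup>2) * (of_real (averaged_coeff n) * (of_real \<rho> * z) ^ n)" for n
  proof -
    have "integral\<^sup>L lborel (g n) = (of_real (second_coeff n) * z ^ n) * of_real (\<rho> ^ (n + 2) / (real (n + 1) * real (n + 2)))"
      unfolding g_def integral_mult_right_zero integral_complex_of_real
      using FTC[of n] by (simp only: has_bochner_integral_iff)
    also have "\<dots> = of_real (second_coeff n * (\<rho> ^ (n + 2) / (real (n + 1) * real (n + 2)))) * z ^ n" by simp
    also have "second_coeff n * (\<rho> ^ (n + 2) / (real (n + 1) * real (n + 2))) = \<rho>\<^sup>2 * (averaged_coeff n * \<rho> ^ n)"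
      by (simp add: averaged_coeff_eq power_add power2_eq_square)
    finally show ?thesis by (simp add: power_mult_distrib mult_ac)
  qed
  have s: "summable (\<lambda>n. second_coeff n * \<rho> ^ n)" by (rule summable_second_coeff[OF \<rho>])
  have gb: "cmod (g n x) \<le> (second_coeff n * \<rho> ^ n) * indicator {0..\<rho>} x" for n x
  proof (cases "x \<in> {0..\<rho>}")
    case True
    then have "(\<rho> - x) * x ^ n \<le> 1 * \<rho> ^ n" using \<rho> by (intro mult_mono power_mono) auto
    moreover have "cmod (g n x) = second_coeff n * ((\<rho> - x) * x ^ n)"
      using True second_coeff_nonneg[of n] z by (simp add: g_def norm_mult norm_power del: of_real_mult of_real_diff of_real_power)
    ultimately show ?thesis using True second_coeff_nonneg[of n] by (auto intro!: mult_left_mono)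
  qed (simp add: g_def)
  have gs: "(\<lambda>n. g n x) sums ((indicator {0..\<rho>} x * (\<rho> - x)) *\<^sub>R second_series (of_real x * z))" for x
  proof (cases "x \<in> {0..\<rho>}")
    case True
    then have "cmod (of_real x * z) < 1" using \<rho> z by (simp add: norm_mult)
    from sums_mult[OF second_series_sums[OF this], of "of_real (\<rho> - x)"] show ?thesis
      using True by (simp add: g_def power_mult_distrib scaleR_conv_of_real mult_ac)
  qed (simp add: g_def)
  have gm: "g n \<in> borel_measurable lborel" for n 
    unfolding g_def
    by (intro borel_measurable_times[OF borel_measurable_const]
          measurable_compose[OF borel_measurable_has_bochner_integral[OF FTC] borel_measurable_of_real])
  have "(\<lambda>n. integral\<^sup>L lborel (g n)) sums
      (\<integral>x. (indicator {0..\<rho>} x * (\<rho> - x)) *\<^sub>R second_series (of_real x * z) \<partial>lborel)"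
    by (rule sums_integral_dominated[OF gm _ gb s gs]) (simp add: emeasure_lborel_Icc_eq)
  then have "(\<lambda>n. of_real (\<rho>\<^sup>2) * (of_real (averaged_coeff n) * (of_real \<rho> * z) ^ n)) sums
     (\<integral>x. (indicator {0..\<rho>} x * (\<rho> - x)) *\<^sub>R second_series (of_real x * z) \<partial>lborel)"
    by (simp only: gint)
  moreover have "(\<lambda>n. of_real (\<rho>\<^sup>2) * (of_real (averaged_coeff n) * (of_real \<rho> * z) ^ n)) sums
      (of_real (\<rho>\<^sup>2) * averaged_series (of_real \<rho> * z))"
    using \<rho> z by (intro sums_mult averaged_series_sums) (simp add: norm_mult)
  ultimately show ?thesis by (rule sums_unique2[symmetric])
qed

end

context doubling_weight
begin

text \<open>The coefficients of \<open>(1 - w) second_series w\<close>.\<close>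

definition difference_coeff :: "nat \<Rightarrow> real" where
  "difference_coeff n = second_coeff n - (if n = 0 then 0 else second_coeff (n - 1))"

text \<open>The coefficients \<open>second_coeff n\<close> grow like \<open>n / m\<^sub>n\<close>; in their differences the factor \<open>n\<close> is lost, because
\<open>m\<^sub>n\<^sub>-\<^sub>1 - m\<^sub>n\<close> is at most of the order \<open>m\<^sub>n\<^sub>-\<^sub>1 / n\<close>.\<close>

lemma difference_coeff_bound: "\<bar>difference_coeff n\<bar> \<le> (1 + 4 * K) / mom (2 * n + 1)"
proof (cases "n = 0")
  case True
  then show ?thesis using K_ge_1 mom_pos[of 1]
    by (simp add: difference_coeff_def second_coeff_def divide_right_mono)
next
  case False
  define p where "p = mom (2 * n - 1)"
  define q where "q = mom (2 * n + 1)"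
  have pq: "0 < p" "0 < q" "q \<le> p" by (auto simp: p_def q_def mom_pos mom_antimono)
  have "2 * n - 1 = 2 * (n - 1) + 1" using False by simp
  then have "second_coeff (n - 1) = real (n + 1) / (2 * p)"
    using False by (simp add: second_coeff_def p_def)
  moreover have "second_coeff n = real (n + 2) / (2 * q)"
    by (simp add: second_coeff_def q_def)
  ultimately have "difference_coeff n = real (n + 2) / (2 * q) - real (n + 1) / (2 * p)"
    using False by (simp only: difference_coeff_def if_False)
  also have "\<dots> = (1 / q + real (n + 1) * (p - q) / (p * q)) / 2"
    using pq by (simp add: field_simps)
  finally have e: "difference_coeff n = (1 / q + real (n + 1) * (p - q) / (p * q)) / 2" .
  have "real (n + 1) * (p - q) \<le> 4 * K * p"
    using mom_difference_bound[of n] False by (simp add: p_def q_def)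
  then have "real (n + 1) * (p - q) / (p * q) \<le> 4 * K * p / (p * q)"
    using pq by (intro divide_right_mono) auto
  also have "\<dots> = 4 * K / q" using pq by simp
  finally have u: "real (n + 1) * (p - q) / (p * q) \<le> 4 * K / q" .
  have l: "0 \<le> real (n + 1) * (p - q) / (p * q)" "0 \<le> 1 / q" using pq by auto
  have "(1 + 4 * K) / q = 1 / q + 4 * K / q" by (simp add: add_divide_distrib)
  moreover have "\<bar>(a + b) / 2\<bar> \<le> a + c" if "0 \<le> a" "0 \<le> b" "b \<le> c" for a b c :: real
    using that by (subst abs_of_nonneg) (simp_all add: field_simps)
  from this[OF l(2) l(1) u] have "\<bar>difference_coeff n\<bar> \<le> 1 / q + 4 * K / q" by (simp only: e)
  ultimately show ?thesis by (simp only: q_def)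
qed

lemma doubling_twice:
  assumes x: "0 \<le> x" "x < 1"
  shows "W x \<le> K\<^sup>2 * W ((3 + x) / 4)"
proof -
  have "W x \<le> K * W ((1 + x) / 2)" using x by (intro doubling) auto
  also have "\<dots> \<le> K * (K * W ((1 + (1 + x) / 2) / 2))"
    using x K_ge_1 by (intro mult_left_mono doubling) auto
  also have "(1 + (1 + x) / 2) / 2 = (3 + x) / 4" by (simp add: field_simps)
  finally show ?thesis by (simp add: power2_eq_square mult.assoc)
qed

text \<open>With the lower bound \<open>y ^ (2 * n + 1) * W y\<close> for the moments at a radius \<open>y\<close> such that \<open>x \<le> y ^ 4\<close>, the sum
  is dominated by a geometric series; at \<open>y = (3 + x) / 4\<close> two doublings compare \<open>W y\<close> with \<open>W x\<close>.\<close>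

lemma inverse_moment_square_sum:
  assumes x: "0 \<le> x" "x < 1"
  shows "summable (\<lambda>n. (x ^ n / mom (2 * n + 1))\<^sup>2)"
    and "(\<Sum>n. (x ^ n / mom (2 * n + 1))\<^sup>2) \<le> 4 * K ^ 4 / ((1 - x) * (W x)\<^sup>2)"
proof -
  define y where "y = (3 + x) / 4"
  have y: "3/4 \<le> y" "y < 1" using x by (auto simp: y_def)
  have Wy: "0 < W y" using y by (intro weight_hat_pos) auto
  have Wx: "0 < W x" using x by (intro weight_hat_pos) auto
  have xy: "x \<le> y ^ 4"
  proof -
    have "0 \<le> (y - 1)\<^sup>2 * (y\<^sup>2 + 2 * y + 3)" using y by simp
    also have "\<dots> = y ^ 4 - x" by (simp add: y_def power2_eq_square power4_eq_xxxx field_simps)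
    finally show ?thesis by simp
  qed
  have y4: "y ^ 4 < 1" using y by (simp add: power_less_one_iff)
  have geo: "(\<lambda>n. 1 / (y\<^sup>2 * (W y)\<^sup>2) * (y ^ 4) ^ n) sums (1 / (y\<^sup>2 * (W y)\<^sup>2) * (1 / (1 - y ^ 4)))"
    using y4 y by (intro sums_mult geometric_sums) simp
  have b: "(x ^ n / mom (2 * n + 1))\<^sup>2 \<le> 1 / (y\<^sup>2 * (W y)\<^sup>2) * (y ^ 4) ^ n" for n
  proof -
    have "y ^ (2 * n + 1) * W y \<le> mom (2 * n + 1)" using y by (intro mom_lower) auto
    then have "x ^ n / mom (2 * n + 1) \<le> (y ^ 4) ^ n / (y ^ (2 * n + 1) * W y)"
      using x xy y Wy by (intro frac_le power_mono) auto
    then have "(x ^ n / mom (2 * n + 1))\<^sup>2 \<le> ((y ^ 4) ^ n / (y ^ (2 * n + 1) * W y))\<^sup>2"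
      using x mom_pos[of "2 * n + 1"] by (intro power_mono) auto
    also have "\<dots> = 1 / (y\<^sup>2 * (W y)\<^sup>2) * (y ^ 4) ^ n"
    proof -
      have "((y ^ 4) ^ n)\<^sup>2 = (y ^ (2 * n))\<^sup>2 * (y ^ 4) ^ n"
        by (simp flip: power_mult power_add) 
      moreover have "(y ^ (2 * n + 1))\<^sup>2 = (y ^ (2 * n))\<^sup>2 * y\<^sup>2" by (simp add: power_mult_distrib mult.commute)
      ultimately show ?thesis using y by (simp add: power_divide power_mult_distrib)
    qed
    finally show ?thesis .
  qed
  show s: "summable (\<lambda>n. (x ^ n / mom (2 * n + 1))\<^sup>2)"
    by (rule summable_comparison_test'[OF sums_summable[OF geo], of 0]) (use b in auto)
  have "(\<Sum>n. (x ^ n / mom (2 * n + 1))\<^sup>2) \<le> 1 / (y\<^sup>2 * (W y)\<^sup>2) * (1 / (1 - y ^ 4))"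
    using suminf_le[OF b s sums_summable[OF geo]] geo by (simp add: sums_iff)
  also have "\<dots> = 1 / ((y\<^sup>2 * (1 - y ^ 4)) * (W y)\<^sup>2)" by simp
  also have "\<dots> \<le> 1 / ((1 - y) * (W y)\<^sup>2)"
  proof (intro divide_left_mono mult_right_mono)
    have y2: "9/16 \<le> y\<^sup>2" using power_mono[of "3/4" y 2] y by (simp add: power2_eq_square)
    have "1 \<le> 9/16 * (7/4 * (25/16 :: real))" by simp
    also have "\<dots> \<le> y\<^sup>2 * ((1 + y) * (1 + y\<^sup>2))"
      using y y2 by (intro mult_mono) auto
    finally have "(1 - y) * 1 \<le> (1 - y) * (y\<^sup>2 * ((1 + y) * (1 + y\<^sup>2)))"
      using y by (intro mult_left_mono) auto
    also have "\<dots> = y\<^sup>2 * (1 - y ^ 4)" by (simp add: power2_eq_square power4_eq_xxxx algebra_simps)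
    finally show "1 - y \<le> y\<^sup>2 * (1 - y ^ 4)" by simp
    then have "0 < y\<^sup>2 * (1 - y ^ 4)" using y by linarith
    then show "0 < y\<^sup>2 * (1 - y ^ 4) * (W y)\<^sup>2 * ((1 - y) * (W y)\<^sup>2)" using y y4 Wy by (intro mult_pos_pos) auto
  qed auto
  also have "1 - y = (1 - x) / 4" by (simp add: y_def field_simps)
  also have "1 / ((1 - x) / 4 * (W y)\<^sup>2) = 4 * K ^ 4 / ((1 - x) * (K\<^sup>2 * W y)\<^sup>2)"
    using K_ge_1 by (simp add: power_mult_distrib)
  also have "\<dots> \<le> 4 * K ^ 4 / ((1 - x) * (W x)\<^sup>2)"
  proof (intro divide_left_mono mult_left_mono power_mono)
    show "W x \<le> K\<^sup>2 * W y" using doubling_twice[OF x] by (simp add: y_def)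
    show "0 < (1 - x) * (K\<^sup>2 * W y)\<^sup>2 * ((1 - x) * (W x)\<^sup>2)" using x Wx Wy K_ge_1 by auto
  qed (use x Wx K_ge_1 in auto)
  finally show "(\<Sum>n. (x ^ n / mom (2 * n + 1))\<^sup>2) \<le> 4 * K ^ 4 / ((1 - x) * (W x)\<^sup>2)" .
qed

text \<open>The Cauchy-Schwarz inequality for the product of \<open>1 / (1 - z)\<close> and \<open>(1 - z) second_series z\<close>.  It is used in
  the form of the inequality between arithmetic and geometric means, with weights \<open>1 / W x\<close> and \<open>W x\<close> that make
  both terms of the same size.\<close>

lemma second_series_mean:
  assumes x: "0 \<le> x" "x < 1"
  shows "circle_mean second_series x \<le> (1 + (1 + 4 * K)\<^sup>2 * (4 * K ^ 4)) / (W x * (1 - x))"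
proof -
  define C where "C = (1 + 4 * K)\<^sup>2 * (4 * K ^ 4)"
  have C: "0 \<le> C" unfolding C_def by simp
  define u where "u \<theta> = (\<Sum>n. of_real (x ^ n) * cis (real n * \<theta>))" for \<theta>
  define v where "v \<theta> = (\<Sum>n. of_real (difference_coeff n * x ^ n) * cis (real n * \<theta>))" for \<theta>
  have Wx: "0 < W x" using x by (intro weight_hat_pos) auto
  have su: "summable (\<lambda>n. cmod (of_real (x ^ n)))" using x by (simp add: norm_power)
  have ss: "summable (\<lambda>n. second_coeff n * x ^ n)" by (rule summable_second_coeff[OF x])
  have "summable (\<lambda>n. (1 + 4 * K) * (real (n + 2) * x ^ n / mom (2 * n + 1)))"
    by (intro summable_mult summable_inverse_moments x)
  then have sv: "summable (\<lambda>n. cmod (of_real (difference_coeff n * x ^ n)))"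
  proof (rule summable_comparison_test'[of _ 0])
    fix n :: nat
    have "\<bar>difference_coeff n\<bar> * x ^ n \<le> ((1 + 4 * K) / mom (2 * n + 1)) * x ^ n"
      using x by (intro mult_right_mono difference_coeff_bound) auto
    also have "\<dots> \<le> ((1 + 4 * K) / mom (2 * n + 1) * x ^ n) * real (n + 2)"
    proof -
      have "0 \<le> (1 + 4 * K) / mom (2 * n + 1) * x ^ n"
        using x K_ge_1 mom_pos[of "2 * n + 1"] by simp
      from mult_left_mono[OF _ this, of 1 "real (n + 2)"] show ?thesis by simp
    qed
    finally show "norm (cmod (of_real (difference_coeff n * x ^ n))) \<le> (1 + 4 * K) * (real (n + 2) * x ^ n / mom (2 * n + 1))"
      using x by (simp add: norm_mult norm_power mult_ac)
  qed
  have uv: "second_series (of_real x * cis \<theta>) = u \<theta> * v \<theta>" for \<theta>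
  proof -
    define z where "z = of_real x * cis \<theta>"
    have z: "cmod z < 1" using x by (simp add: z_def norm_mult)
    have "u \<theta> = 1 / (1 - z)" unfolding u_def z_def using x by (intro circle_geometric_series) auto
    moreover have "(\<lambda>n. of_real (difference_coeff n) * z ^ n) sums ((1 - z) * second_series z)"
    proof -
      have "(\<lambda>n. of_real (second_coeff n) * z ^ Suc n) sums (z * second_series z)"
        using sums_mult[OF second_series_sums[OF z], of z] by (simp add: mult_ac)
      then have "(\<lambda>n. of_real (if n = 0 then 0 else second_coeff (n - 1)) * z ^ n) sums (z * second_series z + 0)"
        using sums_Suc_iff[of "\<lambda>n. of_real (if n = 0 then 0 else second_coeff (n - 1)) * z ^ n" "z * second_series z"] by simp
      from sums_diff[OF second_series_sums[OF z] this] show ?thesis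
        by (simp add: difference_coeff_def algebra_simps)
    qed
    then have "v \<theta> = (1 - z) * second_series z"
      unfolding v_def by (intro sums_unique[symmetric])
        (simp only: of_real_mult mult.assoc cis_power z_def)
    moreover have "1 - z \<noteq> 0" using z by auto
    ultimately show ?thesis by (simp add: z_def[symmetric])
  qed
  have ui: "(\<integral>\<theta>. (cmod (u \<theta>))\<^sup>2 \<partial>circ) \<le> 1 / (1 - x)"
  proof -
    have "(\<lambda>n. (x\<^sup>2) ^ n) sums (\<integral>\<theta>. (cmod (u \<theta>))\<^sup>2 \<partial>circ)"
    proof -
      have "(cmod (of_real (x ^ n)))\<^sup>2 = (x\<^sup>2) ^ n" for n
        by (simp only: norm_of_real power2_abs power_mult[symmetric] mult.commute)
      then show ?thesis using circle_l2_norm[OF su] by (simp only: u_def)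
    qed
    moreover have "(\<lambda>n. (x\<^sup>2) ^ n) sums (1 / (1 - x\<^sup>2))"
      using x by (intro geometric_sums) (simp add: power_less_one_iff abs_square_less_1)
    ultimately have "(\<integral>\<theta>. (cmod (u \<theta>))\<^sup>2 \<partial>circ) = 1 / (1 - x\<^sup>2)" by (rule sums_unique2)
    also have "\<dots> \<le> 1 / (1 - x)"
    proof (rule divide_left_mono)
      have "x * x \<le> 1 * x" using x by (intro mult_right_mono) auto
      then show "1 - x \<le> 1 - x\<^sup>2" by (simp add: power2_eq_square)
      then show "0 < (1 - x\<^sup>2) * (1 - x)" using x by (intro mult_pos_pos) auto
    qed simp
    finally show ?thesis .
  qed
  have vi: "(\<integral>\<theta>. (cmod (v \<theta>))\<^sup>2 \<partial>circ) \<le> C / ((1 - x) * (W x)\<^sup>2)"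
  proof -
    have "(\<lambda>n. (cmod (of_real (difference_coeff n * x ^ n)))\<^sup>2) sums (\<integral>\<theta>. (cmod (v \<theta>))\<^sup>2 \<partial>circ)"
      using circle_l2_norm[OF sv] by (simp only: v_def)
    then have v: "(\<lambda>n. (difference_coeff n * x ^ n)\<^sup>2) sums (\<integral>\<theta>. (cmod (v \<theta>))\<^sup>2 \<partial>circ)"
      by (simp only: norm_of_real power2_abs)
    have "(difference_coeff n * x ^ n)\<^sup>2 \<le> (1 + 4 * K)\<^sup>2 * (x ^ n / mom (2 * n + 1))\<^sup>2" for n
    proof -
      have "\<bar>difference_coeff n * x ^ n\<bar> \<le> (1 + 4 * K) / mom (2 * n + 1) * x ^ n"
        using mult_right_mono[OF difference_coeff_bound[of n], of "x ^ n"] x by (simp add: abs_mult)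
      then have "\<bar>difference_coeff n * x ^ n\<bar>\<^sup>2 \<le> ((1 + 4 * K) / mom (2 * n + 1) * x ^ n)\<^sup>2"
        by (intro power_mono) auto
      then show ?thesis by (simp add: power_mult_distrib power_divide)
    qed
    then have "(\<Sum>n. (difference_coeff n * x ^ n)\<^sup>2) \<le> (\<Sum>n. (1 + 4 * K)\<^sup>2 * (x ^ n / mom (2 * n + 1))\<^sup>2)"
      by (rule suminf_le[OF _ sums_summable[OF v] summable_mult[OF inverse_moment_square_sum(1)[OF x]]])
    then have "(\<integral>\<theta>. (cmod (v \<theta>))\<^sup>2 \<partial>circ) \<le> (\<Sum>n. (1 + 4 * K)\<^sup>2 * (x ^ n / mom (2 * n + 1))\<^sup>2)"
      by (simp only: sums_unique[OF v])
    also have "\<dots> = (1 + 4 * K)\<^sup>2 * (\<Sum>n. (x ^ n / mom (2 * n + 1))\<^sup>2)"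
      by (rule suminf_mult[OF inverse_moment_square_sum(1)[OF x]])
    also have "\<dots> \<le> (1 + 4 * K)\<^sup>2 * (4 * K ^ 4 / ((1 - x) * (W x)\<^sup>2))"
      by (intro mult_left_mono inverse_moment_square_sum(2)[OF x]) simp
    finally show ?thesis by (simp add: C_def)
  qed
  have cu: "continuous_on UNIV u" unfolding u_def[abs_def] by (rule series_circle_bounds(2)[OF su])
  have cv: "continuous_on UNIV v" unfolding v_def[abs_def] by (rule series_circle_bounds(2)[OF sv])
  have iu: "integrable circ (\<lambda>\<theta>. (cmod (u \<theta>))\<^sup>2)" and iv: "integrable circ (\<lambda>\<theta>. (cmod (v \<theta>))\<^sup>2)"
    and iuv: "integrable circ (\<lambda>\<theta>. cmod (u \<theta> * v \<theta>))"
    by (intro integrable_circ_continuous continuous_intros cu cv)+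
  have "circle_mean second_series x = (\<integral>\<theta>. cmod (u \<theta> * v \<theta>) \<partial>circ)"
    unfolding uv[symmetric] by (rule circle_mean_eq(1)[OF continuous_on_sphere_disc[OF second_series_holomorphic x(2)] x(1)])
  also have "\<dots> \<le> (\<integral>\<theta>. 1 / W x * (cmod (u \<theta>))\<^sup>2 + W x * (cmod (v \<theta>))\<^sup>2 \<partial>circ)"
  proof (rule integral_mono[OF iuv])
    show "integrable circ (\<lambda>\<theta>. 1 / W x * (cmod (u \<theta>))\<^sup>2 + W x * (cmod (v \<theta>))\<^sup>2)"
      using iu iv by (intro Bochner_Integration.integrable_add integrable_mult_right)
    fix \<theta>
    have "a * b \<le> 1 / W x * a\<^sup>2 + W x * b\<^sup>2" if "0 \<le> a" "0 \<le> b" for a b :: real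
    proof -
      have "0 \<le> 1 / W x * (a - W x * b)\<^sup>2" using Wx by simp
      also have "\<dots> = 1 / W x * a\<^sup>2 + W x * b\<^sup>2 - 2 * (a * b)"
        using Wx by (simp add: power2_eq_square field_simps)
      finally show ?thesis using mult_nonneg_nonneg[OF that] by linarith
    qed
    then show "cmod (u \<theta> * v \<theta>) \<le> 1 / W x * (cmod (u \<theta>))\<^sup>2 + W x * (cmod (v \<theta>))\<^sup>2"
      by (simp add: norm_mult)
  qed
  also have "\<dots> = 1 / W x * (\<integral>\<theta>. (cmod (u \<theta>))\<^sup>2 \<partial>circ) + W x * (\<integral>\<theta>. (cmod (v \<theta>))\<^sup>2 \<partial>circ)"
    using iu iv by (subst Bochner_Integration.integral_add) auto
  also have "\<dots> \<le> 1 / W x * (1 / (1 - x)) + W x * (C / ((1 - x) * (W x)\<^sup>2))"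
    using Wx by (intro add_mono mult_left_mono ui vi) auto
  also have "\<dots> = (1 + C) / (W x * (1 - x))"
    using Wx x by (simp add: power2_eq_square add_divide_distrib)
  finally show ?thesis by (simp add: C_def)
qed

text \<open>The factor \<open>\<rho> - x \<le> 1 - x\<close> of the integral remainder compensates the factor \<open>1 / (1 - x)\<close> of
\<open>second_series_mean\<close>.\<close>

lemma averaged_series_mean:
  obtains C where "0 < C" "\<And>\<rho>. 0 \<le> \<rho> \<Longrightarrow> \<rho> < 1 \<Longrightarrow>
    circle_mean averaged_series \<rho> \<le> C * (1 + inverse_hat_integral \<rho>)"
proof -
  define C1 where "C1 = 1 + (1 + 4 * K)\<^sup>2 * (4 * K ^ 4)"
  define C2 where "C2 = (\<Sum>n. averaged_coeff n * (1/2) ^ n)"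
  have C1: "0 < C1" unfolding C1_def by (intro add_pos_nonneg) auto
  have C2: "0 \<le> C2"
    unfolding C2_def using averaged_coeff_pos by (intro suminf_nonneg summable_averaged_coeff) (auto intro: less_imp_le)
  show ?thesis
  proof (rule that)
    show "0 < 4 * C1 + C2" using C1 C2 by linarith
    fix \<rho> :: real assume \<rho>: "0 \<le> \<rho>" "\<rho> < 1"
    note J = inverse_hat_integral_nonneg[OF \<rho>(2)]
    note cm = circle_mean_eq[OF continuous_on_sphere_disc[OF averaged_series_holomorphic \<rho>(2)] \<rho>(1)]
    \<comment> \<open>Taylor's formula controls \<open>\<rho>\<^sup>2\<close> times the mean, so small \<open>\<rho>\<close> are treated separately.\<close>
    show "circle_mean averaged_series \<rho> \<le> (4 * C1 + C2) * (1 + inverse_hat_integral \<rho>)"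
    proof (cases "\<rho> \<le> 1/2")
      case True
      have "circle_mean averaged_series \<rho> \<le> (\<integral>\<theta>. C2 \<partial>circ)"
        using cm(2) True \<rho> unfolding cm(1) C2_def
        by (intro integral_mono norm_averaged_series_le integrable_norm) (auto simp: norm_mult)
      also have "\<dots> = C2 * 1" by simp
      also have "\<dots> \<le> (4 * C1 + C2) * (1 + inverse_hat_integral \<rho>)"
        using C1 C2 J by (intro mult_mono) auto
      finally show ?thesis .
    next
      case False
      let ?H = "\<lambda>\<theta> x. ennreal ((1 - x) * indicator {0..\<rho>} x * cmod (second_series (of_real x * cis \<theta>)))"
      interpret P: pair_sigma_finite circ lborel ..
      have pm: "(\<lambda>(\<theta>, x). ?H \<theta> x) \<in> borel_measurable (circ \<Otimes>\<^sub>M lborel)"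
      proof -
        have "continuous_on (cball 0 \<rho>) second_series"
          by (rule holomorphic_on_imp_continuous_on[OF holomorphic_on_subset[OF second_series_holomorphic]]) (use \<rho> in auto)
        note [measurable] = measurable_polar[OF this \<rho>(1)]
        have "(\<lambda>p. ennreal ((1 - snd p) * cmod (indicator (UNIV \<times> {0..\<rho>}) p *\<^sub>R second_series (of_real (snd p) * cis (fst p)))))
           \<in> borel_measurable (borel \<Otimes>\<^sub>M borel)" by measurable
        moreover have "(\<lambda>(\<theta>, x). ?H \<theta> x) = (\<lambda>p. ennreal ((1 - snd p) * cmod (indicator (UNIV \<times> {0..\<rho>}) p *\<^sub>R second_series (of_real (snd p) * cis (fst p)))))"
          by (auto simp: fun_eq_iff split: split_indicator)
        moreover have "measurable (circ \<Otimes>\<^sub>M lborel) N = measurable (borel \<Otimes>\<^sub>M borel) N" for N :: "ennreal measure"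
          by (intro measurable_cong_sets sets_pair_measure_cong) auto
        ultimately show ?thesis by simp
      qed
      have 1: "ennreal (\<rho>\<^sup>2 * cmod (averaged_series (of_real \<rho> * cis \<theta>))) \<le> (\<integral>\<^sup>+x. ?H \<theta> x \<partial>lborel)" for \<theta>
      proof -
        have e: "of_real (\<rho>\<^sup>2) * averaged_series (of_real \<rho> * cis \<theta>) =
            (\<integral>x. (indicator {0..\<rho>} x * (\<rho> - x)) *\<^sub>R second_series (of_real x * cis \<theta>) \<partial>lborel)"
          by (rule averaged_series_eq_integral[OF \<rho>]) simp
        have "continuous_on {0..\<rho>} (\<lambda>x. (\<rho> - x) *\<^sub>R second_series (of_real x * cis \<theta>))"
          by (intro continuous_intros continuous_on_compose2[OF holomorphic_on_imp_continuous_on[OF second_series_holomorphic]])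
             (use \<rho> in \<open>auto simp: norm_mult\<close>)
        then have "set_integrable lborel {0..\<rho>} (\<lambda>x. (\<rho> - x) *\<^sub>R second_series (of_real x * cis \<theta>))"
          by (rule borel_integrable_atLeastAtMost')
        then have i: "integrable lborel (\<lambda>x. (indicator {0..\<rho>} x * (\<rho> - x)) *\<^sub>R second_series (of_real x * cis \<theta>))"
          by (simp add: set_integrable_def)
        have "ennreal (\<rho>\<^sup>2 * cmod (averaged_series (of_real \<rho> * cis \<theta>))) = ennreal (norm (of_real (\<rho>\<^sup>2) * averaged_series (of_real \<rho> * cis \<theta>)))"
          by (simp add: norm_mult norm_power)
        also have "\<dots> \<le> (\<integral>\<^sup>+x. ennreal (norm ((indicator {0..\<rho>} x * (\<rho> - x)) *\<^sub>R second_series (of_real x * cis \<theta>))) \<partial>lborel)"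
          unfolding e by (rule integral_norm_bound_ennreal[OF i])
        also have "\<dots> \<le> (\<integral>\<^sup>+x. ?H \<theta> x \<partial>lborel)"
          using \<rho> by (intro nn_integral_mono ennreal_leI) (auto split: split_indicator intro!: mult_right_mono)
        finally show ?thesis .
      qed
      have "ennreal (\<rho>\<^sup>2 * circle_mean averaged_series \<rho>) = (\<integral>\<^sup>+\<theta>. ennreal (\<rho>\<^sup>2 * cmod (averaged_series (of_real \<rho> * cis \<theta>))) \<partial>circ)"
        using cm(2) unfolding cm(1) by (subst nn_integral_eq_integral) auto
      also have "\<dots> \<le> (\<integral>\<^sup>+\<theta>. (\<integral>\<^sup>+x. ?H \<theta> x \<partial>lborel) \<partial>circ)"
        by (intro nn_integral_mono 1)
      also have "\<dots> = (\<integral>\<^sup>+x. (\<integral>\<^sup>+\<theta>. ?H \<theta> x \<partial>circ) \<partial>lborel)"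
        by (rule P.Fubini'[symmetric, OF pm])
      also have "\<dots> \<le> (\<integral>\<^sup>+x. ennreal C1 * (ennreal (1 / W x) * indicator {0..\<rho>} x) \<partial>lborel)"
      proof (rule nn_integral_mono)
        fix x :: real
        show "(\<integral>\<^sup>+\<theta>. ?H \<theta> x \<partial>circ) \<le> ennreal C1 * (ennreal (1 / W x) * indicator {0..\<rho>} x)"
        proof (cases "x \<in> {0..\<rho>}")
          case True
          then have x: "0 \<le> x" "x < 1" using \<rho> by auto
          then have Wx: "0 < W x" by (rule weight_hat_pos)
          note i = circle_mean_eq(1,2)[OF continuous_on_sphere_disc[OF second_series_holomorphic x(2)] x(1)]
          have "(\<integral>\<^sup>+\<theta>. ?H \<theta> x \<partial>circ) = ennreal ((1 - x) * circle_mean second_series x)"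
            using True x i(2) unfolding i(1) by (subst nn_integral_eq_integral) auto
          also have "\<dots> \<le> ennreal ((1 - x) * (C1 / (W x * (1 - x))))"
            unfolding C1_def using x by (intro ennreal_leI mult_left_mono second_series_mean) auto
          also have "(1 - x) * (C1 / (W x * (1 - x))) = C1 * (1 / W x)" using x by simp
          finally show ?thesis using True C1 Wx by (simp add: ennreal_mult' flip: ennreal_mult)
        qed simp
      qed
      also have "\<dots> = ennreal C1 * (\<integral>\<^sup>+x. ennreal (1 / W x) * indicator {0..\<rho>} x \<partial>lborel)"
      proof (rule nn_integral_cmult)
        have "(\<lambda>x. ennreal (1 / W x) * indicator {0..\<rho>} x) = (\<lambda>x. ennreal (indicator {0..\<rho>} x *\<^sub>R (1 / W x)))"
          by (auto split: split_indicator)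
        then show "(\<lambda>x. ennreal (1 / W x) * indicator {0..\<rho>} x) \<in> borel_measurable lborel"
          using measurable_inverse_hat[of \<rho>] by simp
      qed
      also have "\<dots> = ennreal (C1 * inverse_hat_integral \<rho>)"
        using C1 by (simp only: nn_integral_inverse_hat[OF \<rho>(2)] ennreal_mult'[symmetric])
      finally have "\<rho>\<^sup>2 * circle_mean averaged_series \<rho> \<le> C1 * inverse_hat_integral \<rho>"
        using C1 J by (subst (asm) ennreal_le_iff) auto
      moreover have "(1/2)\<^sup>2 * circle_mean averaged_series \<rho> \<le> \<rho>\<^sup>2 * circle_mean averaged_series \<rho>"
        using False by (intro mult_right_mono power_mono circle_mean_nonneg) auto
      ultimately have "circle_mean averaged_series \<rho> \<le> (4 * C1) * inverse_hat_integral \<rho>"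
        by (simp add: power2_eq_square)
      also have "\<dots> \<le> (4 * C1 + C2) * (1 + inverse_hat_integral \<rho>)"
        using C1 C2 J by (intro mult_mono) auto
      finally show ?thesis .
    qed
  qed
qed

text \<open>On the interval from \<open>1 - 1 / (n + 1)\<close> to \<open>1 - 1 / (n + 2)\<close> the function \<open>1 / W\<close> is at most a multiple of
\<open>1 / m\<^sub>n\<^sub>+\<^sub>1\<close>, while the powers \<open>t\<^sup>n\<close> stay away from zero as long as \<open>n\<close> is at most of the order \<open>1 / (1 - t)\<close>.\<close>

lemma hardy_sum_lower:
  obtains C where "0 < C" "\<And>t. 0 \<le> t \<Longrightarrow> t < 1 \<Longrightarrow>
    \<exists>N. 1 + inverse_hat_integral t \<le> C * (\<Sum>n\<le>N. t ^ n / ((real (n + 1))\<^sup>2 * mom (2 * n + 1)))"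
proof -
  obtain C where C: "1 \<le> C" "\<And>n. mom (2 * n + 1) \<le> C * W (1 - 1 / real (n + 1))"
    by (rule mom_upper) blast
  define r where "r n = 1 - 1 / real (n + 1)" for n
  have r: "0 \<le> r n" "r n < 1" "r n \<le> r (Suc n)" for n by (auto simp: r_def field_simps)
  have step: "(r (Suc n) - r n) / W (r (Suc n)) \<le> 2 * C * (1 / ((real (Suc n + 1))\<^sup>2 * mom (2 * Suc n + 1)))" for n
  proof -
    have W: "0 < W (r (Suc n))" using r by (intro weight_hat_pos)
    have m: "0 < mom (2 * Suc n + 1)" by (rule mom_pos)
    have "1 / W (r (Suc n)) \<le> C / mom (2 * Suc n + 1)"
      using C(2)[of "Suc n"] W m by (simp add: r_def field_simps)
    moreover have "r (Suc n) - r n \<le> 2 / (real (Suc n + 1))\<^sup>2"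
    proof -
      have c: "1 / (a * b) = 2 / (2 * a * b)" for a b :: real by simp
      have "r (Suc n) - r n = 1 / (real (n + 1) * real (n + 2))" by (simp add: r_def field_simps)
      also have "\<dots> = 2 / (2 * real (n + 1) * real (n + 2))" by (rule c)
      also have "\<dots> \<le> 2 / (real (n + 2) * real (n + 2))"
        by (intro divide_left_mono mult_right_mono) auto
      also have "\<dots> = 2 / (real (Suc n + 1))\<^sup>2" by (simp add: power2_eq_square)
      finally show ?thesis .
    qed
    ultimately have "(r (Suc n) - r n) * (1 / W (r (Suc n))) \<le> 2 / (real (Suc n + 1))\<^sup>2 * (C / mom (2 * Suc n + 1))"
      using r[of n] W C(1) by (intro mult_mono) auto
    then show ?thesis by (simp add: mult_ac)
  qed
  have Jr: "inverse_hat_integral (r N) \<le> 2 * C * (\<Sum>n<N. 1 / ((real (Suc n + 1))\<^sup>2 * mom (2 * Suc n + 1)))" for N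
  proof (induction N)
    case 0
    have "ennreal (inverse_hat_integral 0) = 0"
      using nn_integral_inverse_hat[of 0] by simp
    then have "inverse_hat_integral (r 0) = 0"
      using inverse_hat_integral_nonneg[of 0] by (simp only: r_def) (simp add: ennreal_eq_0_iff)
    then show ?case by simp
  next
    case (Suc N)
    have "inverse_hat_integral (r (Suc N)) \<le> inverse_hat_integral (r N) + (r (Suc N) - r N) / W (r (Suc N))"
      by (intro inverse_hat_integral_increment r)
    with Suc step[of N] show ?case by (simp add: distrib_left)
  qed
  define D where "D = mom 1 + 2 * C * exp 2 + (1 + inverse_hat_integral (1/2)) * mom 1"
  have J2: "0 \<le> inverse_hat_integral (1/2)" by (rule inverse_hat_integral_nonneg) simp
  have D: "0 < D" unfolding D_def using mom_pos[of 1] C(1) J2 by (intro add_pos_nonneg mult_nonneg_nonneg) auto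
  show ?thesis
  proof (rule that[OF D])
    fix t :: real assume t: "0 \<le> t" "t < 1"
    let ?f = "\<lambda>n. t ^ n / ((real (n + 1))\<^sup>2 * mom (2 * n + 1))"
    have f0: "0 \<le> ?f n" for n using t mom_pos[of "2 * n + 1"] by (intro divide_nonneg_nonneg mult_nonneg_nonneg) auto
    \<comment> \<open>For \<open>t < 1 / 2\<close> the term of order \<open>0\<close> is already large enough; the powers of \<open>t\<close> may vanish there.\<close>
    show "\<exists>N. 1 + inverse_hat_integral t \<le> D * (\<Sum>n\<le>N. ?f n)"
    proof (cases "t < 1/2")
      case True
      have "1 + inverse_hat_integral t \<le> 1 + inverse_hat_integral (1/2)"
        using True by (intro add_left_mono inverse_hat_integral_mono) auto
      also have "\<dots> = (1 + inverse_hat_integral (1/2)) * mom 1 * ?f 0" using mom_pos[of 1] by simp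
      also have "\<dots> \<le> D * ?f 0"
        unfolding D_def using mom_pos[of 1] C(1) by (intro mult_right_mono f0) auto
      finally show ?thesis by (intro exI[of _ 0]) simp
    next
      case False
      \<comment> \<open>The index of the interval \<open>[r N, r (N + 1))\<close> that contains \<open>t\<close>.\<close>
      define N where "N = nat \<lfloor>1 / (1 - t)\<rfloor> - 1"
      have fl: "2 \<le> \<lfloor>1 / (1 - t)\<rfloor>" using False t by (simp add: le_floor_iff field_simps)
      have "N + 1 = nat \<lfloor>1 / (1 - t)\<rfloor>" "1 \<le> N"
        using fl unfolding N_def by linarith+
      then have "real (N + 1) = of_int \<lfloor>1 / (1 - t)\<rfloor>" using fl by (metis of_nat_nat order_trans zero_le_numeral)
      then have N1: "real (N + 1) \<le> 1 / (1 - t)" "1 / (1 - t) < real (N + 1) + 1" "1 \<le> N"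
        using \<open>1 \<le> N\<close> by (simp_all only: of_int_floor_le real_of_int_floor_add_one_gt)
      have "real (N + 1) * (1 - t) \<le> 1" "1 < real (N + 2) * (1 - t)"
        using N1(1,2) t by (simp_all add: pos_le_divide_eq pos_divide_less_eq add.commute)
      then have "1 - t \<le> 1 / real (N + 1)" "1 / real (N + 2) \<le> 1 - t"
        by (simp_all add: pos_le_divide_eq pos_divide_le_eq mult.commute del: of_nat_add)
      then have tr: "r N \<le> t" "t \<le> r (Suc N)"
        by (simp_all add: r_def)
      have pw: "exp (-2) \<le> t ^ n" if "n \<le> Suc N" for n
      proof -
        have "1 + 1 / real N \<le> exp (1 / real N)" by (rule exp_ge_add_one_self)
        then have "1 / exp (1 / real N) \<le> 1 / (1 + 1 / real N)" using N1(3) by (intro divide_left_mono) (auto intro!: mult_pos_pos add_pos_nonneg)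
        also have "\<dots> = r N" using N1(3) by (simp add: r_def field_simps)
        \<comment> \<open>Since \<open>N \<ge> 1\<close>, the exponent \<open>(N + 1) / N\<close> is at most \<open>2\<close>.\<close>
        finally have e: "exp (- (1 / real N)) \<le> r N" by (simp add: exp_minus divide_inverse)
        have "exp (-2) \<le> exp (- (real (Suc N) / real N))" using N1(3) by (simp add: field_simps)
        also have "\<dots> = exp (- (1 / real N)) ^ Suc N" by (subst exp_of_nat_mult[symmetric]) simp
        also have "\<dots> \<le> t ^ Suc N" using e tr(1) by (intro power_mono) auto
        also have "\<dots> \<le> t ^ n" using that t by (intro power_decreasing) auto
        finally show ?thesis .
      qed
      have "inverse_hat_integral t \<le> inverse_hat_integral (r (Suc N))"
        by (intro inverse_hat_integral_mono tr r)
      also have "\<dots> \<le> 2 * C * (\<Sum>n<Suc N. 1 / ((real (Suc n + 1))\<^sup>2 * mom (2 * Suc n + 1)))" by (rule Jr)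
      also have "\<dots> \<le> 2 * C * (\<Sum>n<Suc N. exp 2 * ?f (Suc n))"
      proof (intro mult_left_mono sum_mono)
        fix n assume "n \<in> {..<Suc N}"
        then have "exp (-2) \<le> t ^ Suc n" by (intro pw) auto
        then have "exp 2 * exp (-2) \<le> exp 2 * t ^ Suc n" by (intro mult_left_mono) auto
        then have "1 \<le> exp 2 * t ^ Suc n" by (simp flip: exp_add)
        then have "1 / ((real (Suc n + 1))\<^sup>2 * mom (2 * Suc n + 1)) \<le> exp 2 * t ^ Suc n / ((real (Suc n + 1))\<^sup>2 * mom (2 * Suc n + 1))"
          using mom_pos[of "2 * Suc n + 1"] by (intro divide_right_mono mult_nonneg_nonneg) auto
        then show "1 / ((real (Suc n + 1))\<^sup>2 * mom (2 * Suc n + 1)) \<le> exp 2 * ?f (Suc n)"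
          by (simp only: times_divide_eq_right)
      qed (use C(1) in auto)
      also have "\<dots> = 2 * C * exp 2 * (\<Sum>n<Suc N. ?f (Suc n))" by (simp only: sum_distrib_left mult.assoc)
      finally have J: "inverse_hat_integral t \<le> 2 * C * exp 2 * (\<Sum>n<Suc N. ?f (Suc n))" .
      have S: "(\<Sum>n\<le>Suc N. ?f n) = ?f 0 + (\<Sum>n<Suc N. ?f (Suc n))"
        by (simp only: lessThan_Suc_atMost[symmetric] sum.lessThan_Suc_shift)
      have s0: "0 \<le> (\<Sum>n<Suc N. ?f (Suc n))" by (intro sum_nonneg f0)
      have "1 + inverse_hat_integral t \<le> mom 1 * ?f 0 + 2 * C * exp 2 * (\<Sum>n<Suc N. ?f (Suc n))"
        using J mom_pos[of 1] by simp
      also have "\<dots> \<le> D * ?f 0 + D * (\<Sum>n<Suc N. ?f (Suc n))"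
        unfolding D_def using mom_pos[of 1] C(1) J2
        by (intro add_mono mult_right_mono f0 s0) (auto intro!: add_nonneg_nonneg mult_nonneg_nonneg)
      also have "\<dots> = D * (\<Sum>n\<le>Suc N. ?f n)" by (simp only: S distrib_left)
      finally show ?thesis by blast
    qed
  qed
qed

end

section \<open>The Carleson condition\<close>

context disc_weight
begin

abbreviation "\<mu> \<equiv> radial_measure (mu_density \<omega>)"

lemma mu_density_eq: "mu_density \<omega> t = \<omega> t * (1 + inverse_hat_integral t)"
  by (simp add: mu_density_def)

lemma measurable_inverse_hat_integral: "inverse_hat_integral \<in> borel_measurable (restrict_space borel {0..<1})"
  by (rule borel_measurable_mono_on_fnc) (auto intro!: mono_onI inverse_hat_integral_mono)

lemma mu_density_measurable: "mu_density \<omega> \<in> borel_measurable (restrict_space lebesgue {0..<1})"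
  unfolding mu_density_eq[abs_def]
  by (intro borel_measurable_times borel_measurable_add weight_measurable
        measurable_restrict_lebesgue[OF measurable_inverse_hat_integral]) auto

lemma nn_integral_mu:
  assumes g: "g \<in> borel_measurable (restrict_space borel {0..<1})"
  shows "(\<integral>\<^sup>+t. g t \<partial>\<mu>) = (\<integral>\<^sup>+t. ennreal (1 + inverse_hat_integral t) * g t \<partial>\<nu>)"
proof -
  have "(\<integral>\<^sup>+t. g t \<partial>\<mu>) = (\<integral>\<^sup>+t\<in>{0..<1}. ennreal (mu_density \<omega> t) * g t \<partial>lebesgue)"
    by (rule nn_integral_weighted_measure[OF mu_density_measurable _ g]) auto
  also have "\<dots> = (\<integral>\<^sup>+t\<in>{0..<1}. ennreal (\<omega> t) * (ennreal (1 + inverse_hat_integral t) * g t) \<partial>lebesgue)"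
    using weight_nonneg inverse_hat_integral_nonneg
    by (intro nn_integral_cong) (auto split: split_indicator simp: mu_density_eq ennreal_mult mult.assoc)
  also have "\<dots> = (\<integral>\<^sup>+t. ennreal (1 + inverse_hat_integral t) * g t \<partial>\<nu>)"
    by (rule nn_integral_weighted_measure[OF weight_measurable, symmetric])
       (use g measurable_inverse_hat_integral in auto)
  finally show ?thesis .
qed

lemma mu_weight_eq: "mu_weight \<omega> = distr \<mu> (restrict_space borel unit_disc) complex_of_real"
proof -
  have 1: "complex_of_real \<in> restrict_space borel {0..<1} \<rightarrow>\<^sub>M restrict_space borel unit_disc"
    by (intro measurable_restrict_space2 measurable_restrict_space1) (auto simp: space_restrict_space)
  show ?thesis
    unfolding mu_weight_def weighted_measure_def
    by (subst distr_distr) (use 1 measurable_restrict_borel_lebesgue[of "{0..<1::real}"] in \<open>auto simp: comp_def\<close>)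
qed

lemma of_real_measurable_mu: "complex_of_real \<in> \<mu> \<rightarrow>\<^sub>M restrict_space borel unit_disc"
  unfolding measurable_weighted_measure
  by (intro measurable_restrict_space2 measurable_restrict_space1) (auto simp: space_restrict_space)

text \<open>The third condition of the theorem, with a real constant instead of a supremum in the extended reals.\<close>

definition tail_condition :: "real \<Rightarrow> bool" where
  "tail_condition B \<longleftrightarrow> 0 \<le> B \<and> (\<forall>a\<in>{0..<1}. emeasure \<mu> {a..<1} \<le> ennreal (B * (1 - a)))"

lemma emeasure_mu_tail: "0 \<le> a \<Longrightarrow> emeasure \<mu> {a..<1} = (\<integral>\<^sup>+t\<in>{a..<1}. ennreal (mu_density \<omega> t) \<partial>lebesgue)"
  by (rule emeasure_radial_measure_tail[OF mu_density_measurable])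

lemma tail_condition_iff:
  "(SUP a\<in>{0..<1}. ennreal (1 / (1 - a)) * (\<integral>\<^sup>+t\<in>{a..<1}. ennreal (mu_density \<omega> t) \<partial>lebesgue)) < \<infinity> \<longleftrightarrow>
    (\<exists>B. tail_condition B)" (is "?S < \<infinity> \<longleftrightarrow> _")
proof
  assume S: "?S < \<infinity>"
  have "emeasure \<mu> {a..<1} \<le> ennreal (enn2real ?S * (1 - a))" if a: "a \<in> {0..<1}" for a
  proof -
    have "ennreal (1 / (1 - a)) * emeasure \<mu> {a..<1} \<le> ?S"
      using a emeasure_mu_tail[of a] by (intro SUP_upper2[OF a]) auto
    then have "ennreal (1 - a) * (ennreal (1 / (1 - a)) * emeasure \<mu> {a..<1}) \<le> ennreal (1 - a) * ?S"
      by (intro mult_left_mono) auto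
    moreover have "ennreal (1 - a) * ennreal (1 / (1 - a)) = 1"
      using a by (simp flip: ennreal_mult)
    ultimately have "emeasure \<mu> {a..<1} \<le> ennreal (1 - a) * ?S" by (simp add: mult.assoc[symmetric])
    also have "?S = ennreal (enn2real ?S)" using S by (intro ennreal_enn2real[symmetric]) auto
    also have "ennreal (1 - a) * \<dots> = ennreal (enn2real ?S * (1 - a))"
      using a by (simp add: mult.commute flip: ennreal_mult)
    finally show ?thesis .
  qed
  then show "\<exists>B. tail_condition B" unfolding tail_condition_def by (intro exI[of _ "enn2real ?S"]) auto
next
  assume "\<exists>B. tail_condition B"
  then obtain B where B: "0 \<le> B" "\<And>a. a \<in> {0..<1} \<Longrightarrow> emeasure \<mu> {a..<1} \<le> ennreal (B * (1 - a))"
    by (auto simp: tail_condition_def)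
  have "?S \<le> ennreal B"
  proof (rule SUP_least)
    fix a :: real assume a: "a \<in> {0..<1}"
    have "ennreal (1 / (1 - a)) * (\<integral>\<^sup>+t\<in>{a..<1}. ennreal (mu_density \<omega> t) \<partial>lebesgue) \<le> ennreal (1 / (1 - a)) * ennreal (B * (1 - a))"
      using B(2)[OF a] a emeasure_mu_tail[of a] by (intro mult_left_mono) auto
    also have "\<dots> = ennreal B" using a B(1) by (simp flip: ennreal_mult)
    finally show "ennreal (1 / (1 - a)) * (\<integral>\<^sup>+t\<in>{a..<1}. ennreal (mu_density \<omega> t) \<partial>lebesgue) \<le> ennreal B" .
  qed
  then show "?S < \<infinity>" by (rule order.strict_trans1) simp
qed

lemma nn_integral_mu_le:
  assumes B: "tail_condition B" and f: "f \<in> H1"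
  shows "(\<integral>\<^sup>+t. ennreal (cmod (f (of_real t))) \<partial>\<mu>) \<le> ennreal (32 * B * H1_norm f)"
  using B f by (intro radial_carleson_embedding) (auto simp: tail_condition_def)

lemma tail_condition_imp_carleson:
  assumes B: "tail_condition B"
  shows "carleson_H1 (mu_weight \<omega>)"
proof -
  have "integrable (mu_weight \<omega>) f \<and> (LINT z|mu_weight \<omega>. cmod (f z)) \<le> (32 * B) * H1_norm f" if f: "f \<in> H1" for f
  proof -
    have hol: "f holomorphic_on unit_disc" using f by (simp add: H1_def)
    then have fm: "f \<in> borel_measurable (restrict_space borel unit_disc)"
      by (intro borel_measurable_continuous_on_restrict holomorphic_on_imp_continuous_on)
    have fr: "(\<lambda>t. f (of_real t)) \<in> borel_measurable \<mu>"
      using measurable_holomorphic_radius[OF hol] by (simp add: measurable_weighted_measure)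
    note le = nn_integral_mu_le[OF B f]
    have "integrable \<mu> (\<lambda>t. f (of_real t))"
      by (rule integrableI_bounded[OF fr]) (use le in \<open>auto intro: le_less_trans\<close>)
    moreover have "(\<integral>t. cmod (f (of_real t)) \<partial>\<mu>) \<le> 32 * B * H1_norm f"
      by (rule integral_real_bounded[OF _ le]) (use B H1_norm_nonneg[OF f] in \<open>auto simp: tail_condition_def\<close>)
    ultimately show ?thesis
      unfolding mu_weight_eq using fm of_real_measurable_mu
      by (simp add: integrable_distr_eq integral_distr)
  qed
  moreover have "sets (mu_weight \<omega>) = sets (restrict_space borel unit_disc)" by (simp add: mu_weight_def)
  ultimately show ?thesis unfolding carleson_H1_def by blast
qed

text \<open>The squared Cauchy kernel is at least \<open>1 / (2 (1 - a))\<close> on \<open>[a,1)\<close>.\<close>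

lemma squared_cauchy_tail:
  assumes a: "0 \<le> a" "a < 1" and C: "0 \<le> C"
    and le: "(\<integral>\<^sup>+t. ennreal ((1 - a\<^sup>2) / (1 - a * t)\<^sup>2) \<partial>\<mu>) \<le> ennreal C"
  shows "emeasure \<mu> {a..<1} \<le> ennreal (2 * C * (1 - a))"
proof -
  have m: "(\<lambda>t. ennreal ((1 - a\<^sup>2) / (1 - a * t)\<^sup>2)) \<in> borel_measurable \<mu>"
    unfolding measurable_weighted_measure by (intro measurable_restrict_space1) measurable
  have s: "{a..<1} \<in> sets \<mu>" using a by (auto simp: sets_restrict_space_iff)
  have "emeasure \<mu> {a..<1} = (\<integral>\<^sup>+t. indicator {a..<1} t \<partial>\<mu>)" using s by simp
  also have "\<dots> \<le> (\<integral>\<^sup>+t. ennreal (2 * (1 - a)) * ennreal ((1 - a\<^sup>2) / (1 - a * t)\<^sup>2) \<partial>\<mu>)"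
  proof (rule nn_integral_mono)
    fix t assume "t \<in> space \<mu>"
    then have t: "0 \<le> t" "t < 1" by auto
    show "indicator {a..<1} t \<le> ennreal (2 * (1 - a)) * ennreal ((1 - a\<^sup>2) / (1 - a * t)\<^sup>2)"
    proof (cases "a \<le> t")
      case True
      have "ennreal 1 \<le> ennreal (2 * (1 - a) * ((1 - a\<^sup>2) / (1 - a * t)\<^sup>2))"
        by (rule ennreal_leI) (rule squared_cauchy_real(3)[OF a t True])
      also have "\<dots> = ennreal (2 * (1 - a)) * ennreal ((1 - a\<^sup>2) / (1 - a * t)\<^sup>2)"
        using a squared_cauchy_real(2)[OF a t] by (intro ennreal_mult) auto
      finally show ?thesis using True t by simp
    qed simp
  qed
  also have "\<dots> = ennreal (2 * (1 - a)) * (\<integral>\<^sup>+t. ennreal ((1 - a\<^sup>2) / (1 - a * t)\<^sup>2) \<partial>\<mu>)"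
    by (rule nn_integral_cmult[OF m])
  also have "\<dots> \<le> ennreal (2 * (1 - a)) * ennreal C" by (intro mult_left_mono le) simp
  also have "\<dots> = ennreal (2 * C * (1 - a))" using a C by (simp add: mult_ac flip: ennreal_mult)
  finally show ?thesis .
qed

lemma carleson_imp_tail_condition:
  assumes "carleson_H1 (mu_weight \<omega>)"
  shows "\<exists>B. tail_condition B"
proof -
  obtain C where C: "\<And>f. f \<in> H1 \<Longrightarrow> integrable (mu_weight \<omega>) f \<and> (LINT z|mu_weight \<omega>. cmod (f z)) \<le> C * H1_norm f"
    using assms by (auto simp: carleson_H1_def)
  \<comment> \<open>The constant \<open>C\<close> may be negative, hence the modulus.\<close>
  have "emeasure \<mu> {a..<1} \<le> ennreal (2 * \<bar>C\<bar> * (1 - a))" if a: "0 \<le> a" "a < 1" for a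
  proof (rule squared_cauchy_tail[OF a])
    note f = squared_cauchy_H1[OF a]
    have fm: "squared_cauchy a \<in> borel_measurable (restrict_space borel unit_disc)"
      using f(1) by (intro borel_measurable_continuous_on_restrict holomorphic_on_imp_continuous_on) (simp add: H1_def)
    have i: "integrable \<mu> (\<lambda>t. squared_cauchy a (of_real t))"
      using C[OF f(1)] of_real_measurable_mu fm unfolding mu_weight_eq by (simp add: integrable_distr_eq)
    have "(\<integral>t. cmod (squared_cauchy a (of_real t)) \<partial>\<mu>) \<le> C * H1_norm (squared_cauchy a)"
      using C[OF f(1)] of_real_measurable_mu fm unfolding mu_weight_eq by (simp add: integral_distr)
    also have "\<dots> \<le> \<bar>C\<bar> * 1" using f H1_norm_nonneg[OF f(1)] by (intro mult_mono) auto
    finally have le: "(\<integral>t. cmod (squared_cauchy a (of_real t)) \<partial>\<mu>) \<le> \<bar>C\<bar>" by simp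
    have "(\<integral>\<^sup>+t. ennreal ((1 - a\<^sup>2) / (1 - a * t)\<^sup>2) \<partial>\<mu>) = (\<integral>\<^sup>+t. ennreal (cmod (squared_cauchy a (of_real t))) \<partial>\<mu>)"
    proof (rule nn_integral_cong)
      fix t assume "t \<in> space \<mu>"
      then have t: "0 \<le> t" "t < 1" by auto
      show "ennreal ((1 - a\<^sup>2) / (1 - a * t)\<^sup>2) = ennreal (cmod (squared_cauchy a (of_real t)))"
        unfolding squared_cauchy_real(1)[OF a t] norm_of_real
        using squared_cauchy_real(2)[OF a t] by (simp only: abs_of_nonneg)
    qed
    also have "\<dots> = ennreal (\<integral>t. cmod (squared_cauchy a (of_real t)) \<partial>\<mu>)"
      using i by (intro nn_integral_eq_integral) auto
    also have "\<dots> \<le> ennreal \<bar>C\<bar>" by (rule ennreal_leI[OF le])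
    finally show "(\<integral>\<^sup>+t. ennreal ((1 - a\<^sup>2) / (1 - a * t)\<^sup>2) \<partial>\<mu>) \<le> ennreal \<bar>C\<bar>" .
  qed simp
  then show ?thesis unfolding tail_condition_def by (intro exI[of _ "2 * \<bar>C\<bar>"]) auto
qed

lemma dilation_in_disc:
  assumes "0 \<le> t" "t < 1" "z \<in> unit_disc"
  shows "cmod (of_real t * z) \<le> cmod z" "cmod (of_real t * z) < 1"
  using mult_left_le_one_le[of "cmod z" t] assms by (auto simp: norm_mult)

lemma hilbert_op_as_integral:
  assumes f: "f holomorphic_on unit_disc" and int: "integrable \<nu> (\<lambda>t. f (of_real t))" and z: "z \<in> unit_disc"
  shows "integrable \<nu> (\<lambda>t. f (of_real t) * averaged_series (of_real t * z))"
    and "set_integrable lebesgue {0..<1} (hilbert_integrand \<omega> f z)"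
    and "hilbert_op \<omega> f z = (\<integral>t. f (of_real t) * averaged_series (of_real t * z) \<partial>\<nu>)"
proof -
  have Am: "(\<lambda>t. averaged_series (of_real t * z)) \<in> borel_measurable (restrict_space borel {0..<1})"
    by (intro borel_measurable_continuous_on_restrict
          continuous_on_compose2[OF holomorphic_on_imp_continuous_on[OF averaged_series_holomorphic]] continuous_intros)
       (use dilation_in_disc(2)[OF _ _ z] in auto)
  have m: "(\<lambda>t. f (of_real t) * averaged_series (of_real t * z)) \<in> borel_measurable (restrict_space borel {0..<1})"
    by (intro borel_measurable_times measurable_holomorphic_radius[OF f] Am)
  have b: "cmod (averaged_series (of_real t * z)) \<le> (\<Sum>n. averaged_coeff n * cmod z ^ n)" if "t \<in> {0..<1}" for t
    using that z dilation_in_disc(1)[of t z] by (intro norm_averaged_series_le) auto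
  show i: "integrable \<nu> (\<lambda>t. f (of_real t) * averaged_series (of_real t * z))"
  proof (rule Bochner_Integration.integrable_bound[of _ "\<lambda>t. (\<Sum>n. averaged_coeff n * cmod z ^ n) * cmod (f (of_real t))"])
    show "AE t in \<nu>. norm (f (of_real t) * averaged_series (of_real t * z)) \<le> norm ((\<Sum>n. averaged_coeff n * cmod z ^ n) * cmod (f (of_real t)))"
    proof (rule AE_I2)
      fix t assume "t \<in> space \<nu>"
      then have "t \<in> {0..<1}" by simp
      from mult_right_mono[OF order_trans[OF b[OF this] abs_ge_self], of "cmod (f (of_real t))"]
      show "norm (f (of_real t) * averaged_series (of_real t * z)) \<le> norm ((\<Sum>n. averaged_coeff n * cmod z ^ n) * cmod (f (of_real t)))"
        by (simp add: norm_mult abs_mult mult.commute)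
    qed
    show "integrable \<nu> (\<lambda>t. (\<Sum>n. averaged_coeff n * cmod z ^ n) * cmod (f (of_real t)))"
      using int by (intro integrable_mult_right integrable_norm)
  qed (use m in \<open>simp add: measurable_weighted_measure\<close>)
  have e: "hilbert_integrand \<omega> f z t = \<omega> t *\<^sub>R (f (of_real t) * averaged_series (of_real t * z))" if "t \<in> {0..<1}" for t
    using that z by (simp add: hilbert_integrand_def hilbert_kernel_eq scaleR_conv_of_real mult_ac)
  have e': "indicator {0..<1} t *\<^sub>R hilbert_integrand \<omega> f z t = indicator {0..<1} t *\<^sub>R (\<omega> t *\<^sub>R (f (of_real t) * averaged_series (of_real t * z)))" for t
    using e[of t] by (auto split: split_indicator)
  show "set_integrable lebesgue {0..<1} (hilbert_integrand \<omega> f z)"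
  proof -
    have "set_integrable lebesgue {0..<1} (\<lambda>t. \<omega> t *\<^sub>R (f (of_real t) * averaged_series (of_real t * z)))"
      using i integral_nu(1)[OF _ m] by blast
    then show ?thesis unfolding set_integrable_def e' .
  qed
  show "hilbert_op \<omega> f z = (\<integral>t. f (of_real t) * averaged_series (of_real t * z) \<partial>\<nu>)"
    using integral_nu(2)[OF _ m] unfolding hilbert_op_def set_lebesgue_integral_def e' by simp
qed

lemma hilbert_op_sums:
  assumes f: "f holomorphic_on unit_disc" and int: "integrable \<nu> (\<lambda>t. f (of_real t))" and z: "z \<in> unit_disc"
  shows "(\<lambda>n. of_real (averaged_coeff n) * (\<integral>t. f (of_real t) * of_real t ^ n \<partial>\<nu>) * z ^ n) sums hilbert_op \<omega> f z"
proof -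
  define g where "g n t = (of_real (averaged_coeff n) * z ^ n) * (f (of_real t) * of_real t ^ n)" for n t
  define q where "q = cmod z"
  have q: "0 \<le> q" "q < 1" using z by (auto simp: q_def)
  have s: "summable (\<lambda>n. averaged_coeff n * q ^ n)" by (rule summable_averaged_coeff[OF q])
  have fm: "(\<lambda>t. f (of_real t)) \<in> borel_measurable \<nu>" using int by auto
  have tm: "(\<lambda>t. complex_of_real t ^ n) \<in> borel_measurable \<nu>" for n by (rule measurable_borel_nu) measurable
  have gm: "g n \<in> borel_measurable \<nu>" for n unfolding g_def by (intro borel_measurable_times fm tm) auto
  have gb: "cmod (g n t) \<le> (averaged_coeff n * q ^ n) * cmod (f (of_real t))" if "t \<in> {0..<1}" for n t
  proof -
    have "cmod (g n t) = (averaged_coeff n * q ^ n) * (cmod (f (of_real t)) * t ^ n)"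
      using that averaged_coeff_pos[of n] by (simp add: g_def norm_mult norm_power q_def)
    also have "\<dots> \<le> (averaged_coeff n * q ^ n) * cmod (f (of_real t))"
      using that averaged_coeff_pos[of n] q by (intro mult_left_mono mult_left_le power_le_one) auto
    finally show ?thesis .
  qed
  have gs: "(\<lambda>n. g n t) sums (f (of_real t) * averaged_series (of_real t * z))" if "t \<in> {0..<1}" for t
  proof -
    have "cmod (of_real t * z) < 1" using dilation_in_disc(2)[of t z] z that by auto
    from sums_mult[OF averaged_series_sums(1)[OF this], of "f (of_real t)"]
    show ?thesis by (simp add: g_def power_mult_distrib mult_ac)
  qed
  have "(\<lambda>n. integral\<^sup>L \<nu> (g n)) sums (\<integral>t. f (of_real t) * averaged_series (of_real t * z) \<partial>\<nu>)"
    by (rule sums_integral_dominated[OF gm integrable_norm[OF int] _ s]) (use gb gs in auto)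
  moreover have "integral\<^sup>L \<nu> (g n) = of_real (averaged_coeff n) * (\<integral>t. f (of_real t) * of_real t ^ n \<partial>\<nu>) * z ^ n" for n
    unfolding g_def integral_mult_right_zero by (simp add: mult_ac)
  ultimately show ?thesis
    by (simp add: hilbert_op_as_integral(3)[OF f int z])
qed

lemma hilbert_op_holomorphic:
  assumes f: "f holomorphic_on unit_disc" and int: "integrable \<nu> (\<lambda>t. f (of_real t))"
  shows "hilbert_op \<omega> f holomorphic_on unit_disc"
  by (rule power_series_holomorphic[where a = "\<lambda>n. of_real (averaged_coeff n) * (\<integral>t. f (of_real t) * of_real t ^ n \<partial>\<nu>)"])
     (use hilbert_op_sums[OF f int] in auto)

end

section \<open>Boundedness of the Hilbert-type operator\<close>

context doubling_weight
begin

text \<open>By Fubini's theorem the mean of \<open>hilbert_op \<omega> f\<close> is at most the integral of \<open>\<bar>f\<bar>\<close> times the mean of the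
kernel, hence at most a multiple of the integral of \<open>\<bar>f\<bar>\<close> with respect to \<open>\<mu>\<close>.\<close>

lemma tail_condition_imp_bounded:
  assumes B: "tail_condition B"
  shows "hilbert_op_bounded_H1 \<omega>"
proof -
  obtain C where C: "0 < C" and mean: "\<And>\<rho>. 0 \<le> \<rho> \<Longrightarrow> \<rho> < 1 \<Longrightarrow>
    circle_mean averaged_series \<rho> \<le> C * (1 + inverse_hat_integral \<rho>)"
    by (rule averaged_series_mean) blast
  have B0: "0 \<le> B" using B by (simp add: tail_condition_def)
  have "hilbert_op_defined \<omega> f \<and> hilbert_op \<omega> f \<in> H1 \<and> H1_norm (hilbert_op \<omega> f) \<le> (C * (32 * B)) * H1_norm f"
    if f: "f \<in> H1" for f
  proof -
    have hol: "f holomorphic_on unit_disc" using f by (simp add: H1_def)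
    note fr = measurable_holomorphic_radius[OF hol]
    have fm: "(\<lambda>t. ennreal (cmod (f (of_real t)))) \<in> borel_measurable (restrict_space borel {0..<1})"
      by (rule measurable_compose[OF measurable_compose[OF fr borel_measurable_norm] measurable_ennreal])
    have mu: "(\<integral>\<^sup>+t. ennreal (1 + inverse_hat_integral t) * ennreal (cmod (f (of_real t))) \<partial>\<nu>) \<le> ennreal (32 * B * H1_norm f)"
      using nn_integral_mu_le[OF B f] by (simp only: nn_integral_mu[OF fm])
    have int: "integrable \<nu> (\<lambda>t. f (of_real t))"
    proof (rule integrableI_bounded)
      show "(\<lambda>t. f (of_real t)) \<in> borel_measurable \<nu>" using fr by (simp add: measurable_weighted_measure)
      have "(\<integral>\<^sup>+t. ennreal (norm (f (of_real t))) \<partial>\<nu>) \<le> (\<integral>\<^sup>+t. ennreal (1 + inverse_hat_integral t) * ennreal (cmod (f (of_real t))) \<partial>\<nu>)"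
      proof (rule nn_integral_mono)
        fix t assume "t \<in> space \<nu>"
        then have "0 \<le> inverse_hat_integral t" by (intro inverse_hat_integral_nonneg) auto
        then have "1 \<le> ennreal (1 + inverse_hat_integral t)" by simp
        from mult_right_mono[OF this, of "ennreal (cmod (f (of_real t)))"]
        show "ennreal (norm (f (of_real t))) \<le> ennreal (1 + inverse_hat_integral t) * ennreal (cmod (f (of_real t)))" by simp
      qed
      also note mu
      also have "ennreal (32 * B * H1_norm f) < \<infinity>" by simp
      finally show "(\<integral>\<^sup>+t. ennreal (norm (f (of_real t))) \<partial>\<nu>) < \<infinity>" .
    qed
    note hh = hilbert_op_holomorphic[OF hol int]
    have mean_le: "circle_mean (hilbert_op \<omega> f) r \<le> (C * (32 * B)) * H1_norm f" if r: "0 < r" "r < 1" for r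
    proof -
      note cm = circle_mean_eq[OF continuous_on_sphere_disc[OF hh r(2)] less_imp_le[OF r(1)]]
      have rd: "of_real r * cis \<theta> \<in> unit_disc" for \<theta> using r by (simp add: norm_mult)
      let ?H = "\<lambda>\<theta> t. ennreal (cmod (f (of_real t) * averaged_series (of_real t * (of_real r * cis \<theta>))))"
      interpret P: pair_sigma_finite circ \<nu> ..
      have pm: "(\<lambda>(\<theta>, t). ?H \<theta> t) \<in> borel_measurable (circ \<Otimes>\<^sub>M \<nu>)"
      proof -
        have 1: "(\<lambda>p. f (of_real (snd p))) \<in> borel_measurable (circ \<Otimes>\<^sub>M \<nu>)"
          using fr by (intro measurable_compose[OF measurable_snd]) (simp add: measurable_weighted_measure)
        have 2: "(\<lambda>p. (fst p, snd p)) \<in> circ \<Otimes>\<^sub>M \<nu> \<rightarrow>\<^sub>M (borel :: real measure) \<Otimes>\<^sub>M borel"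
          by (intro measurable_Pair measurable_compose[OF measurable_fst] measurable_compose[OF measurable_snd measurable_ident_nu])
             auto
        have "cmod (of_real r * w) < 1" if "cmod w \<le> 1" for w
          using order_le_less_trans[OF mult_left_le[OF that less_imp_le[OF r(1)]] r(2)] r by (simp add: norm_mult)
        then have "continuous_on (cball 0 1) (\<lambda>w. averaged_series (of_real r * w))"
          by (intro continuous_on_compose2[OF holomorphic_on_imp_continuous_on[OF averaged_series_holomorphic]] continuous_intros) auto
        from measurable_compose[OF 2 measurable_polar[OF this zero_le_one]]
        have 3: "(\<lambda>p. indicator (UNIV \<times> {0..1}) p *\<^sub>R averaged_series (of_real r * (of_real (snd p) * cis (fst p)))) \<in> borel_measurable (circ \<Otimes>\<^sub>M \<nu>)"
          by simp
        have "(\<lambda>p. ennreal (cmod (f (of_real (snd p)) * (indicator (UNIV \<times> {0..1}) p *\<^sub>R averaged_series (of_real r * (of_real (snd p) * cis (fst p))))))) \<in> borel_measurable (circ \<Otimes>\<^sub>M \<nu>)"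
          by (rule measurable_compose[OF measurable_compose[OF borel_measurable_times[OF 1 3] borel_measurable_norm] measurable_ennreal])
        then show ?thesis
          by (rule measurable_cong[THEN iffD1, rotated]) (auto simp: space_pair_measure mult.left_commute)
      qed
      have "ennreal (circle_mean (hilbert_op \<omega> f) r) = (\<integral>\<^sup>+\<theta>. ennreal (cmod (hilbert_op \<omega> f (of_real r * cis \<theta>))) \<partial>circ)"
        using cm(1,2) by (simp add: nn_integral_eq_integral)
      also have "\<dots> \<le> (\<integral>\<^sup>+\<theta>. (\<integral>\<^sup>+t. ?H \<theta> t \<partial>\<nu>) \<partial>circ)"
        unfolding hilbert_op_as_integral(3)[OF hol int rd]
        by (intro nn_integral_mono integral_norm_bound_ennreal hilbert_op_as_integral(1)[OF hol int rd])
      also have "\<dots> = (\<integral>\<^sup>+t. (\<integral>\<^sup>+\<theta>. ?H \<theta> t \<partial>circ) \<partial>\<nu>)"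
        by (rule P.Fubini'[symmetric, OF pm])
      also have "\<dots> \<le> (\<integral>\<^sup>+t. ennreal C * (ennreal (1 + inverse_hat_integral t) * ennreal (cmod (f (of_real t)))) \<partial>\<nu>)"
      proof (rule nn_integral_mono)
        fix t assume "t \<in> space \<nu>"
        then have t: "0 \<le> t" "t < 1" by auto
        define \<rho> where "\<rho> = t * r"
        have \<rho>: "0 \<le> \<rho>" "\<rho> < 1" "\<rho> \<le> t" using t r mult_left_le[of r t] by (auto simp: \<rho>_def)
        note i = circle_mean_eq(1,2)[OF continuous_on_sphere_disc[OF averaged_series_holomorphic \<rho>(2)] \<rho>(1)]
        have "(\<integral>\<^sup>+\<theta>. ?H \<theta> t \<partial>circ) = (\<integral>\<^sup>+\<theta>. ennreal (cmod (f (of_real t)) * cmod (averaged_series (of_real \<rho> * cis \<theta>))) \<partial>circ)"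
          by (simp add: norm_mult \<rho>_def mult.assoc)
        also have "\<dots> = ennreal (cmod (f (of_real t)) * circle_mean averaged_series \<rho>)"
          using i(2) unfolding i(1) by (subst nn_integral_eq_integral) auto
        also have "\<dots> \<le> ennreal (cmod (f (of_real t)) * (C * (1 + inverse_hat_integral t)))"
        proof (intro ennreal_leI mult_left_mono)
          have "circle_mean averaged_series \<rho> \<le> C * (1 + inverse_hat_integral \<rho>)"
            by (rule mean[OF \<rho>(1,2)])
          also have "\<dots> \<le> C * (1 + inverse_hat_integral t)"
            using C \<rho> t by (intro mult_left_mono add_left_mono inverse_hat_integral_mono) auto
          finally show "circle_mean averaged_series \<rho> \<le> C * (1 + inverse_hat_integral t)" .
        qed simp
        also have "\<dots> = ennreal C * (ennreal (1 + inverse_hat_integral t) * ennreal (cmod (f (of_real t))))"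
        proof -
          have "ennreal (x * (C * y)) = ennreal C * (ennreal y * ennreal x)" if "0 \<le> x" "0 \<le> y" for x y
            using C that by (simp add: mult_ac flip: ennreal_mult)
          from this[of "cmod (f (of_real t))" "1 + inverse_hat_integral t"] show ?thesis
            using inverse_hat_integral_nonneg[OF t(2)] by simp
        qed
        finally show "(\<integral>\<^sup>+\<theta>. ?H \<theta> t \<partial>circ) \<le> ennreal C * (ennreal (1 + inverse_hat_integral t) * ennreal (cmod (f (of_real t))))" .
      qed
      also have "\<dots> = ennreal C * (\<integral>\<^sup>+t. ennreal (1 + inverse_hat_integral t) * ennreal (cmod (f (of_real t))) \<partial>\<nu>)"
        by (rule nn_integral_cmult) (use fm measurable_inverse_hat_integral in \<open>auto simp: measurable_weighted_measure\<close>)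
      also have "\<dots> \<le> ennreal C * ennreal (32 * B * H1_norm f)" by (intro mult_left_mono mu) simp
      also have "\<dots> = ennreal ((C * (32 * B)) * H1_norm f)"
        using C B0 H1_norm_nonneg[OF f] by (simp add: mult_ac flip: ennreal_mult)
      finally show ?thesis
        using C B0 H1_norm_nonneg[OF f] by (subst (asm) ennreal_le_iff) auto
    qed
    have "hilbert_op_defined \<omega> f"
      unfolding hilbert_op_defined_def using hilbert_op_as_integral(2)[OF hol int] by blast
    with H1_I[OF hh mean_le] show ?thesis by blast
  qed
  then show ?thesis unfolding hilbert_op_bounded_H1_def by blast
qed

text \<open>Hardy's inequality for the image of \<open>squared_cauchy a\<close>, whose Taylor coefficients are nonnegative, has a
left-hand side of the form \<open>\<integral> squared_cauchy a \<cdot> S / 2 d\<nu>\<close> with the sum \<open>S\<close> of \<open>hardy_sum_lower\<close>.\<close>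

lemma bounded_imp_tail_condition:
  assumes "hilbert_op_bounded_H1 \<omega>"
  shows "\<exists>B. tail_condition B"
proof -
  obtain A where A: "\<And>f. f \<in> H1 \<Longrightarrow> hilbert_op \<omega> f \<in> H1 \<and> H1_norm (hilbert_op \<omega> f) \<le> A * H1_norm f"
    using assms by (auto simp: hilbert_op_bounded_H1_def)
  obtain C where C: "0 < C" and low: "\<And>t. 0 \<le> t \<Longrightarrow> t < 1 \<Longrightarrow>
    \<exists>N. 1 + inverse_hat_integral t \<le> C * (\<Sum>n\<le>N. t ^ n / ((real (n + 1))\<^sup>2 * mom (2 * n + 1)))"
    by (rule hardy_sum_lower) blast
  have "emeasure \<mu> {a..<1} \<le> ennreal (2 * (C * (2 * pi * \<bar>A\<bar>)) * (1 - a))" if a: "0 \<le> a" "a < 1" for a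
  proof (rule squared_cauchy_tail[OF a])
    note f = squared_cauchy_H1[OF a]
    have hol: "squared_cauchy a holomorphic_on unit_disc" using f(1) by (simp add: H1_def)
    define p where "p t = (1 - a\<^sup>2) / (1 - a * t)\<^sup>2" for t
    have p0: "0 \<le> p t" if "0 \<le> t" "t < 1" for t unfolding p_def by (rule squared_cauchy_real(2)[OF a that])
    have pm: "p \<in> borel_measurable (restrict_space borel {0..<1})"
      unfolding p_def by (intro measurable_restrict_space1) measurable
    have pb: "p t \<le> (1 - a\<^sup>2) / (1 - a)\<^sup>2" if "0 \<le> t" "t < 1" for t
    proof -
      have "a * t \<le> a" using a that by (intro mult_left_le) auto
      then show ?thesis unfolding p_def using a
        by (intro divide_left_mono power_mono mult_pos_pos) (auto simp: power_le_one)
    qed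
    have pi: "integrable \<nu> (\<lambda>t. p t * t ^ n)" for n
    proof (rule integrable_nu_bounded)
      show "(\<lambda>t. p t * t ^ n) \<in> borel_measurable \<nu>"
        by (intro borel_measurable_times measurable_borel_nu[of "\<lambda>t. t ^ n"]) (use pm in \<open>auto simp: measurable_weighted_measure\<close>)
      show "norm (p t * t ^ n) \<le> (1 - a\<^sup>2) / (1 - a)\<^sup>2 * 1" if "t \<in> {0..<1}" for t
      proof -
        have "0 \<le> p t" "p t \<le> (1 - a\<^sup>2) / (1 - a)\<^sup>2" using that p0[of t] pb[of t] by auto
        moreover from this have "p t * t ^ n \<le> (1 - a\<^sup>2) / (1 - a)\<^sup>2 * 1"
          using that by (intro mult_mono power_le_one) auto
        ultimately show ?thesis using that by (simp only: norm_mult real_norm_def abs_of_nonneg) (simp add: abs_mult)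
      qed
    qed
    have fp: "squared_cauchy a (of_real t) = of_real (p t)" if "t \<in> {0..<1}" for t
      using squared_cauchy_real(1)[OF a, of t] that by (simp add: p_def)
    have int: "integrable \<nu> (\<lambda>t. squared_cauchy a (of_real t))"
    proof -
      have "integrable \<nu> (\<lambda>t. complex_of_real (p t))" using pi[of 0] by simp
      then show ?thesis by (rule Bochner_Integration.integrable_cong[THEN iffD1, rotated -1]) (auto simp: fp)
    qed
    define c where "c n = averaged_coeff n * (\<integral>t. p t * t ^ n \<partial>\<nu>)" for n
    have c0: "0 \<le> c n" for n
      unfolding c_def using averaged_coeff_pos[of n] p0
      by (intro mult_nonneg_nonneg Bochner_Integration.integral_nonneg) auto
    have ser: "(\<lambda>n. of_real (c n) * z ^ n) sums hilbert_op \<omega> (squared_cauchy a) z" if "z \<in> unit_disc" for z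
    proof -
      have "(\<integral>t. squared_cauchy a (of_real t) * of_real t ^ n \<partial>\<nu>) = (\<integral>t. complex_of_real (p t * t ^ n) \<partial>\<nu>)" for n
        by (intro Bochner_Integration.integral_cong refl) (simp add: fp)
      then have "(\<integral>t. squared_cauchy a (of_real t) * of_real t ^ n \<partial>\<nu>) = of_real (\<integral>t. p t * t ^ n \<partial>\<nu>)" for n
        by (simp only: integral_complex_of_real)
      then show ?thesis using hilbert_op_sums[OF hol int that] by (simp add: c_def)
    qed
    have H: "hilbert_op \<omega> (squared_cauchy a) \<in> H1" "H1_norm (hilbert_op \<omega> (squared_cauchy a)) \<le> \<bar>A\<bar>"
    proof -
      have "A * H1_norm (squared_cauchy a) \<le> \<bar>A\<bar> * 1"
        using f H1_norm_nonneg[OF f(1)] by (intro mult_mono) auto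
      then show "hilbert_op \<omega> (squared_cauchy a) \<in> H1" "H1_norm (hilbert_op \<omega> (squared_cauchy a)) \<le> \<bar>A\<bar>"
        using A[OF f(1)] by auto
    qed
    have hol_H: "hilbert_op \<omega> (squared_cauchy a) holomorphic_on unit_disc" using H(1) by (simp add: H1_def)
    \<comment> \<open>Hardy's inequality needs absolutely summable coefficients, which dilation by \<open>r\<close> provides.\<close>
    have partial: "(\<Sum>n\<le>N. c n * r ^ n / real (n + 1)) \<le> pi * \<bar>A\<bar>" if r: "0 < r" "r < 1" for r N
    proof -
      have "(\<lambda>n. of_real (c n) * of_real r ^ n) sums hilbert_op \<omega> (squared_cauchy a) (of_real r)"
        using ser[of "of_real r"] r by simp
      then have "summable (\<lambda>n. complex_of_real (c n * r ^ n))" by (simp add: sums_iff)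
      then have sc: "summable (\<lambda>n. c n * r ^ n)" by (simp only: summable_complex_of_real)
      have cr: "0 \<le> c n * r ^ n" for n using c0 r by simp
      note hardy = hardy_inequality_nonneg[OF sc cr]
      have "(\<Sum>n\<le>N. c n * r ^ n / real (n + 1)) \<le> (\<Sum>n. c n * r ^ n / real (n + 1))"
        by (rule sum_le_suminf[OF hardy(2)]) (use cr in auto)
      also note hardy(1)
      also have "(\<integral>x. cmod (\<Sum>n. of_real (c n * r ^ n) * cis (real n * x)) \<partial>circ) = circle_mean (hilbert_op \<omega> (squared_cauchy a)) r"
      proof -
        have "(\<Sum>n. of_real (c n * r ^ n) * cis (real n * x)) = hilbert_op \<omega> (squared_cauchy a) (of_real r * cis x)" for x
        proof -
          have "(\<Sum>n. of_real (c n * r ^ n) * cis (real n * x)) = (\<Sum>n. of_real (c n) * (of_real r * cis x) ^ n)"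
            by (simp only: of_real_mult mult.assoc cis_power)
          also have "\<dots> = hilbert_op \<omega> (squared_cauchy a) (of_real r * cis x)"
            by (rule sums_unique[OF ser, symmetric]) (use r in \<open>simp add: norm_mult\<close>)
          finally show ?thesis .
        qed
        then show ?thesis
          using circle_mean_eq(1)[OF continuous_on_sphere_disc[OF hol_H r(2)]] r by simp
      qed
      also have "pi * circle_mean (hilbert_op \<omega> (squared_cauchy a)) r \<le> pi * \<bar>A\<bar>"
        using circle_mean_le_H1_norm[OF H(1) r] H(2) by (intro mult_left_mono) auto
      finally show ?thesis .
    qed
    have partial1: "(\<Sum>n\<le>N. c n / real (n + 1)) \<le> pi * \<bar>A\<bar>" for N
    proof (rule tendsto_upperbound)
      have "((\<lambda>r. \<Sum>n\<le>N. c n * r ^ n / real (n + 1)) \<longlongrightarrow> (\<Sum>n\<le>N. c n * 1 ^ n / real (n + 1))) (at_left 1)"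
        by (intro tendsto_intros) auto
      then show "((\<lambda>r. \<Sum>n\<le>N. c n * r ^ n / real (n + 1)) \<longlongrightarrow> (\<Sum>n\<le>N. c n / real (n + 1))) (at_left (1::real))" by simp
      show "\<forall>\<^sub>F r in at_left 1. (\<Sum>n\<le>N. c n * r ^ n / real (n + 1)) \<le> pi * \<bar>A\<bar>"
        by (rule eventually_mono[OF eventually_at_left_real[OF zero_less_one]]) (use partial in auto)
    qed simp
    define S where "S N t = (\<Sum>n\<le>N. t ^ n / ((real (n + 1))\<^sup>2 * mom (2 * n + 1)))" for N t
    have S0: "0 \<le> t ^ n / ((real (n + 1))\<^sup>2 * mom (2 * n + 1))" if "0 \<le> t" for t n
      using that mom_pos[of "2 * n + 1"] by (intro divide_nonneg_nonneg mult_nonneg_nonneg) auto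
    have S_mono: "S M t \<le> S N t" if "0 \<le> t" "M \<le> N" for M N t
      unfolding S_def using that S0 by (intro sum_mono2) auto
    have pS: "(\<integral>t. p t * S N t \<partial>\<nu>) \<le> 2 * pi * \<bar>A\<bar>" "integrable \<nu> (\<lambda>t. p t * S N t)" for N
    proof -
      have e: "p t * S N t = (\<Sum>n\<le>N. 1 / ((real (n + 1))\<^sup>2 * mom (2 * n + 1)) * (p t * t ^ n))" for t
        by (simp add: S_def sum_distrib_left mult_ac)
      show "integrable \<nu> (\<lambda>t. p t * S N t)"
        unfolding e by (intro Bochner_Integration.integrable_sum integrable_mult_right pi)
      have "(\<integral>t. p t * S N t \<partial>\<nu>) = (\<Sum>n\<le>N. 1 / ((real (n + 1))\<^sup>2 * mom (2 * n + 1)) * (\<integral>t. p t * t ^ n \<partial>\<nu>))"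
        unfolding e by (subst Bochner_Integration.integral_sum) (auto intro!: integrable_mult_right pi)
      also have "\<dots> = 2 * (\<Sum>n\<le>N. c n / real (n + 1))"
      proof -
        have "1 / (b\<^sup>2 * m) * I = 2 * (1 / (2 * b * m) * I / b)" for b m I :: real
          by (simp add: power2_eq_square)
        then show ?thesis
          unfolding sum_distrib_left c_def averaged_coeff_def by (intro sum.cong refl)
      qed
      also have "\<dots> \<le> 2 * pi * \<bar>A\<bar>" using partial1[of N] by simp
      finally show "(\<integral>t. p t * S N t \<partial>\<nu>) \<le> 2 * pi * \<bar>A\<bar>" .
    qed
    have "(\<integral>\<^sup>+t. ennreal ((1 - a\<^sup>2) / (1 - a * t)\<^sup>2) \<partial>\<mu>) = (\<integral>\<^sup>+t. ennreal (1 + inverse_hat_integral t) * ennreal (p t) \<partial>\<nu>)"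
      using nn_integral_mu[of "\<lambda>t. ennreal (p t)"] pm by (simp add: p_def)
    also have "\<dots> \<le> (\<integral>\<^sup>+t. (SUP N. ennreal C * ennreal (p t * S N t)) \<partial>\<nu>)"
    proof (rule nn_integral_mono)
      fix t assume "t \<in> space \<nu>"
      then have t: "0 \<le> t" "t < 1" by auto
      obtain N where "1 + inverse_hat_integral t \<le> C * S N t" using low[OF t] by (auto simp: S_def)
      then have "ennreal (1 + inverse_hat_integral t) * ennreal (p t) \<le> ennreal (C * S N t) * ennreal (p t)"
        by (intro mult_right_mono ennreal_leI) auto
      also have "\<dots> = ennreal C * ennreal (p t * S N t)"
        using C p0[OF t] sum_nonneg[of "{..N}", OF S0[OF t(1)]] by (simp add: S_def mult_ac flip: ennreal_mult)
      also have "\<dots> \<le> (SUP N. ennreal C * ennreal (p t * S N t))" by (rule SUP_upper) simp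
      finally show "ennreal (1 + inverse_hat_integral t) * ennreal (p t) \<le> (SUP N. ennreal C * ennreal (p t * S N t))" .
    qed
    also have "\<dots> = (SUP N. \<integral>\<^sup>+t. ennreal C * ennreal (p t * S N t) \<partial>\<nu>)"
    proof (rule nn_integral_monotone_convergence_SUP_AE)
      show "AE t in \<nu>. ennreal C * ennreal (p t * S N t) \<le> ennreal C * ennreal (p t * S (Suc N) t)" for N
        using p0 S_mono by (intro AE_I2 mult_left_mono ennreal_leI) auto
      show "(\<lambda>t. ennreal C * ennreal (p t * S N t)) \<in> borel_measurable \<nu>" for N
        by (rule measurable_compose[OF borel_measurable_integrable[OF pS(2)[of N]], of "\<lambda>x. ennreal C * ennreal x"]) simp
    qed
    also have "\<dots> \<le> ennreal (C * (2 * pi * \<bar>A\<bar>))"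
    proof (rule SUP_least)
      fix N
      have "(\<integral>\<^sup>+t. ennreal C * ennreal (p t * S N t) \<partial>\<nu>) = ennreal C * (\<integral>\<^sup>+t. ennreal (p t * S N t) \<partial>\<nu>)"
        using pS(2)[of N] by (intro nn_integral_cmult) auto
      also have "(\<integral>\<^sup>+t. ennreal (p t * S N t) \<partial>\<nu>) = ennreal (\<integral>t. p t * S N t \<partial>\<nu>)"
        using pS(2)[of N] p0 S0 by (intro nn_integral_eq_integral) (auto simp: S_def intro!: AE_I2 mult_nonneg_nonneg sum_nonneg)
      also have "ennreal C * \<dots> \<le> ennreal C * ennreal (2 * pi * \<bar>A\<bar>)"
        by (intro mult_left_mono ennreal_leI pS(1)) simp
      also have "\<dots> = ennreal (C * (2 * pi * \<bar>A\<bar>))" using C by (simp flip: ennreal_mult)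
      finally show "(\<integral>\<^sup>+t. ennreal C * ennreal (p t * S N t) \<partial>\<nu>) \<le> ennreal (C * (2 * pi * \<bar>A\<bar>))" .
    qed
    finally show "(\<integral>\<^sup>+t. ennreal ((1 - a\<^sup>2) / (1 - a * t)\<^sup>2) \<partial>\<mu>) \<le> ennreal (C * (2 * pi * \<bar>A\<bar>))" .
  qed (use C in auto)
  then show ?thesis unfolding tail_condition_def
    using C by (intro exI[of _ "2 * (C * (2 * pi * \<bar>A\<bar>))"]) auto
qed

end

theorem theorem2:
  fixes \<omega> :: "real \<Rightarrow> real"
  assumes "\<omega> \<in> D_hat"
  shows "(hilbert_op_bounded_H1 \<omega> \<longleftrightarrow> carleson_H1 (mu_weight \<omega>)) \<and>
         (carleson_H1 (mu_weight \<omega>) \<longleftrightarrow>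
            (SUP a\<in>{0..<1}. ennreal (1 / (1 - a)) *
               (\<integral>\<^sup>+t\<in>{a..<1}. ennreal (mu_density \<omega> t) \<partial>lebesgue)) < \<infinity>)"
proof -
  obtain K where "radial_weight \<omega>" "1 \<le> K" "\<And>r. r \<in> {0..<1} \<Longrightarrow> weight_hat \<omega> r \<le> K * weight_hat \<omega> ((1 + r) / 2)"
    using assms by (auto simp: D_hat_def)
  then interpret doubling_weight \<omega> K by unfold_locales
  show ?thesis
    unfolding tail_condition_iff
    using tail_condition_imp_bounded tail_condition_imp_carleson bounded_imp_tail_condition carleson_imp_tail_condition
    by blast
qed

end
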